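(* Let $f$ be a transcendental meromorphic function in $\mathbb{C}$ such that $f^{-1}$ has a logarithmic singularity over $\infty$. Then the upper box dimension of $I(f)\cap J(f)$ is $2$ and the packing dimension of $J(f)$ is $2$.
   Context: $J(f)$ is the Julia set of $f$ and $I(f)$ is the set of $z\in\mathbb{C}$ with all $f^n(z)$ defined and $f^n(z)\to\infty$. Logarithmic singularity over $\infty$: with $D_\chi(\infty,r)$ the spherical disc of radius $r$ about $\infty$, choose for each $r>0$ a component $U_r$ of $f^{-1}(D_\chi(\infty,r))$ with $U_{r_1}\subset U_{r_2}$ for $r_1<r_2$ and $\bigcap_r U_r=\emptyset$; this singularity is logarithmic if for some $r>0$ the restriction $f:U_r\to D_\chi(\infty,r)\setminus\{\infty\}$ is a universal covering. *)

theory Defs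
  imports "HOL-Complex_Analysis.Complex_Analysis" "HOL-Computational_Algebra.Polynomial"
begin

text \<open>Riemann sphere modelled as complex option (None = infinity), with the chordal metric.\<close>

fun chordal :: "complex option \<Rightarrow> complex option \<Rightarrow> real" where
  "chordal (Some a) (Some b) = 2 * cmod (a - b) / sqrt ((1 + (cmod a)\<^sup>2) * (1 + (cmod b)\<^sup>2))"
| "chordal (Some a) None = 2 / sqrt (1 + (cmod a)\<^sup>2)"
| "chordal None (Some b) = 2 / sqrt (1 + (cmod b)\<^sup>2)"
| "chordal None None = 0"

definition meromorphic_plane :: "(complex \<Rightarrow> complex) \<Rightarrow> bool" where
  "meromorphic_plane f \<longleftrightarrow> f meromorphic_on UNIV \<and> (\<forall>z. \<not> is_pole f z \<longrightarrow> isCont f z)"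

definition transcendental_fn :: "(complex \<Rightarrow> complex) \<Rightarrow> bool" where
  "transcendental_fn f \<longleftrightarrow>
     \<not> (\<exists>p q :: complex poly. q \<noteq> 0 \<and> (\<forall>z. poly q z \<noteq> 0 \<longrightarrow> f z = poly p z / poly q z))"

text \<open>f as a map of the sphere-valued points: poles go to infinity; f(infinity) is
  undefined, and we keep infinity absorbing (so an orbit that reaches infinity stays there).\<close>
definition fext :: "(complex \<Rightarrow> complex) \<Rightarrow> complex option \<Rightarrow> complex option" where
  "fext f w = (case w of None \<Rightarrow> None | Some z \<Rightarrow> (if is_pole f z then None else Some (f z)))"

definition iter :: "(complex \<Rightarrow> complex) \<Rightarrow> nat \<Rightarrow> complex \<Rightarrow> complex option" where
  "iter f n z = (fext f ^^ n) (Some z)"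

definition normal_seq :: "complex set \<Rightarrow> (nat \<Rightarrow> complex \<Rightarrow> complex option) \<Rightarrow> bool" where
  "normal_seq U F \<longleftrightarrow>
     (\<forall>r::nat \<Rightarrow> nat. strict_mono r \<longrightarrow>
        (\<exists>s g. strict_mono s \<and>
           (\<forall>K. compact K \<and> K \<subseteq> U \<longrightarrow>
              (\<forall>e>0. \<forall>\<^sub>F n in sequentially. \<forall>w\<in>K. chordal (F (r (s n)) w) (g w) < e))))"

definition fatou :: "(complex \<Rightarrow> complex) \<Rightarrow> complex set" where
  "fatou f = {z. \<exists>U. open U \<and> z \<in> U \<and> (\<forall>n. \<forall>w\<in>U. iter f n w \<noteq> None)
                   \<and> normal_seq U (iter f)}"

definition julia :: "(complex \<Rightarrow> complex) \<Rightarrow> complex set" where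
  "julia f = UNIV - fatou f"

definition escaping :: "(complex \<Rightarrow> complex) \<Rightarrow> complex set" where
  "escaping f = {z. (\<forall>n. iter f n z \<noteq> None) \<and>
                    filterlim (\<lambda>n. the (iter f n z)) at_infinity sequentially}"

definition log_sing_infty :: "(complex \<Rightarrow> complex) \<Rightarrow> bool" where
  "log_sing_infty f \<longleftrightarrow>
    (\<exists>U :: real \<Rightarrow> complex set.
       (\<forall>r>0. U r \<in> components {z. chordal (fext f (Some z)) None < r}) \<and>
       (\<forall>r1 r2. 0 < r1 \<and> r1 < r2 \<longrightarrow> U r1 \<subseteq> U r2) \<and>
       (\<Inter>r\<in>{0<..}. U r) = {} \<and>
       (\<exists>r>0. covering_space (U r) f {w. chordal (Some w) None < r} \<and> simply_connected (U r)))"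

definition cover_num :: "('a \<Rightarrow> 'a \<Rightarrow> real) \<Rightarrow> 'a set \<Rightarrow> real \<Rightarrow> nat" where
  "cover_num d E \<delta> = Inf {card F | F. finite F \<and> E \<subseteq> \<Union>F \<and> (\<forall>A\<in>F. \<forall>x\<in>A. \<forall>y\<in>A. d x y \<le> \<delta>)}"

definition upper_box_dim :: "('a \<Rightarrow> 'a \<Rightarrow> real) \<Rightarrow> 'a set \<Rightarrow> ereal" where
  "upper_box_dim d E =
     (if E = {} then 0
      else if (\<forall>\<delta>>0. \<exists>F. finite F \<and> E \<subseteq> \<Union>F \<and> (\<forall>A\<in>F. \<forall>x\<in>A. \<forall>y\<in>A. d x y \<le> \<delta>))
      then Limsup (at_right 0) (\<lambda>\<delta>. ereal (ln (real (cover_num d E \<delta>)) / - ln \<delta>))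
      else \<infinity>)"

text \<open>Packing dimension (Euclidean metric) via the modified upper box dimension.\<close>
definition packing_dim :: "complex set \<Rightarrow> ereal" where
  "packing_dim E = (INF A \<in> {A :: nat \<Rightarrow> complex set. E \<subseteq> \<Union>(range A)}.
                      SUP i. upper_box_dim dist (A i))"

end

(*
  On the tract, f is exp composed with a conformal map onto a half-plane; lam is a logarithm of the
  inverse psi of that map, so that f (exp (lam w)) = exp w. Points whose orbit has logarithms
  u 0, u 1, ... in the half-plane with lam (u (n+1)) = u n modulo 2 pi i and Re (u n) tending to
  infinity escape. They lie in the Julia set: lam contracts far to the right (its image contains no
  large disc, by Bloch's theorem), so the derivatives of the iterates grow too fast for normality.

  Let L be the set of all such u 0. It is 2 pi i periodic, invariant under lam, and relatively dense
  far to the right. Since Re lam is unbounded on the real axis, |lam' t| >= t^(-1-e) for some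
  arbitrarily large t. There lam has bounded distortion on a disc of radius comparable to t, which
  contains about t^2 separated points of L; their images have mutual distance about t^(-1-e). Since
  Re (lam t) = O(log t), pulling these points back to a fixed bounded region along branches of lam
  costs only a power of log t. So L has upper box dimension 2 in that region and then, by
  contraction, near each of its points. Baire's theorem turns this into the packing dimension.
*)
theory Submission
  imports Defs "HOL-Real_Asymp.Real_Asymp"
begin

section \<open>Upper box dimension two\<close>

text \<open>Two losses shape the argument. On the real axis a good lower bound for
  \<open>deriv lam\<close> is available only at some large t, not at all of them. Hence many
  separated points are found only at some arbitrarily small scales, which is what an upper box
  dimension detects and a lower one does not.

  The second loss is the pull-back: it takes an unbounded number of steps, each of which shrinks
  separations. It is controlled by a potential. The shrinking factor in passing from w to
  \<open>lam w\<close> is at least the quotient of \<open>Re w powr (- K)\<close> by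
  \<open>Re (lam w) powr (- K)\<close>, so the product telescopes to a single power of the starting
  real part. The starting point is itself the image under \<open>lam\<close> of a point t, which is
  why only a power of log t is lost.

  Dimension two is carried by separated sets rather than covers, because separated sets pass forward
  through maps that shrink distances at most by a fixed factor. The distortion constants come from
  Schottky's and Bloch's theorems; their size is irrelevant, only their uniformity counts.\<close>

text \<open>At some arbitrarily fine scales, \<open>E\<close> contains about as many separated points as a planar region.\<close>
definition full_dim :: "('a \<Rightarrow> 'a \<Rightarrow> real) \<Rightarrow> 'a set \<Rightarrow> bool" where
  "full_dim d E \<longleftrightarrow> (\<forall>e>0. \<forall>b>0. \<exists>\<delta>. 0 < \<delta> \<and> \<delta> < b \<and>
     (\<exists>S. finite S \<and> S \<subseteq> E \<and> (\<forall>x\<in>S. \<forall>y\<in>S. x \<noteq> y \<longrightarrow> \<delta> < d x y) \<and> \<delta> powr (e - 2) \<le> real (card S)))"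

lemma full_dimE:
  assumes "full_dim d E" "e > 0" "b > 0"
  obtains \<delta> S where "0 < \<delta>" "\<delta> < b" "finite S" "S \<subseteq> E"
    "\<forall>x\<in>S. \<forall>y\<in>S. x \<noteq> y \<longrightarrow> \<delta> < d x y" "\<delta> powr (e - 2) \<le> real (card S)"
proof -
  note * = assms(1)[unfolded full_dim_def, THEN spec, THEN mp, OF assms(2), THEN spec, THEN mp, OF assms(3)]
  show ?thesis using * that by (elim exE conjE)
qed

lemma full_dim_mono: "full_dim d A \<Longrightarrow> A \<subseteq> B \<Longrightarrow> full_dim d B"
  unfolding full_dim_def by (elim all_forward imp_forward ex_forward conj_forward) (auto intro: subset_trans)

section \<open>Covering numbers against separated sets\<close>

definition fine_cover :: "('a \<Rightarrow> 'a \<Rightarrow> real) \<Rightarrow> 'a set \<Rightarrow> real \<Rightarrow> 'a set set \<Rightarrow> bool" where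
  "fine_cover d E \<delta> F \<longleftrightarrow> finite F \<and> E \<subseteq> \<Union>F \<and> (\<forall>A\<in>F. \<forall>x\<in>A. \<forall>y\<in>A. d x y \<le> \<delta>)"

lemma fine_coverI:
  "finite F \<Longrightarrow> E \<subseteq> \<Union>F \<Longrightarrow> (\<And>A x y. A \<in> F \<Longrightarrow> x \<in> A \<Longrightarrow> y \<in> A \<Longrightarrow> d x y \<le> \<delta>) \<Longrightarrow> fine_cover d E \<delta> F"
  unfolding fine_cover_def by (intro conjI ballI)

lemma fine_coverD:
  assumes "fine_cover d E \<delta> F"
  shows "finite F" "E \<subseteq> \<Union>F" "\<And>A x y. A \<in> F \<Longrightarrow> x \<in> A \<Longrightarrow> y \<in> A \<Longrightarrow> d x y \<le> \<delta>"
  using assms unfolding fine_cover_def by simp_all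

lemma fine_cover_mono:
  assumes "fine_cover d E \<delta> F" "E' \<subseteq> E" "\<delta> \<le> \<delta>'"
  shows "fine_cover d E' \<delta>' F"
proof (rule fine_coverI)
  show "E' \<subseteq> \<Union>F" using assms(2) fine_coverD(2)[OF assms(1)] by (rule subset_trans)
  show "d x y \<le> \<delta>'" if "A \<in> F" "x \<in> A" "y \<in> A" for A x y
    using fine_coverD(3)[OF assms(1) that] assms(3) by simp
qed (rule fine_coverD(1)[OF assms(1)])

lemma cover_num_le: "fine_cover d E \<delta> F \<Longrightarrow> cover_num d E \<delta> \<le> card F"
  unfolding cover_num_def fine_cover_def[symmetric] by (rule cInf_lower) auto

lemma cover_num_ge:
  assumes "fine_cover d E \<delta> F0" "\<And>F. fine_cover d E \<delta> F \<Longrightarrow> n \<le> card F"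
  shows "n \<le> cover_num d E \<delta>"
  unfolding cover_num_def fine_cover_def[symmetric] by (rule cInf_greatest) (use assms in auto)

lemma upper_box_dim_eq:
  "upper_box_dim d E = (if E = {} then 0 else if \<forall>\<delta>>0. \<exists>F. fine_cover d E \<delta> F
     then Limsup (at_right 0) (\<lambda>\<delta>. ereal (ln (real (cover_num d E \<delta>)) / - ln \<delta>)) else \<infinity>)"
  unfolding upper_box_dim_def fine_cover_def ..

text \<open>Strict separation against diameter at most \<delta> forces distinct points of
  \<open>S\<close> into distinct members of \<open>F\<close>.\<close>

lemma card_separated_le_cover:
  assumes "fine_cover d E \<delta> F" "S \<subseteq> E" "\<forall>x\<in>S. \<forall>y\<in>S. x \<noteq> y \<longrightarrow> \<delta> < d x y"
  shows "card S \<le> card F"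
proof -
  note F = fine_coverD[OF assms(1)]
  have "\<exists>A. A \<in> F \<and> x \<in> A" if "x \<in> S" for x
    using subsetD[OF subset_trans[OF assms(2) F(2)] that] by (rule UnionE) auto
  then obtain g where g: "\<And>x. x \<in> S \<Longrightarrow> g x \<in> F \<and> x \<in> g x"
    by metis
  have "inj_on g S"
  proof (rule inj_onI, rule ccontr)
    fix x y assume "x \<in> S" "y \<in> S" "g x = g y" "x \<noteq> y"
    then show False
      using F(3)[of "g x" x y] g[of x] g[of y] assms(3) by fastforce
  qed
  then show ?thesis
    by (rule card_inj_on_le) (use g F(1) in auto)
qed

text \<open>Only the Limsup branch of the definition needs work: a nonempty separated set excludes
  the empty case, and the value for sets that are not totally bounded is infinite.\<close>

lemma full_dim_imp_upper_box_dim_ge: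
  assumes "full_dim d E"
  shows "2 \<le> upper_box_dim d E"
proof -
  have ne: "E \<noteq> {}"
  proof
    assume "E = {}"
    obtain \<delta> S where "0 < \<delta>" "S \<subseteq> E" "\<delta> powr (1 - 2) \<le> real (card S)"
      by (rule full_dimE[OF assms, of 1 1]) auto
    with \<open>E = {}\<close> show False by auto
  qed
  have L: "2 \<le> Limsup (at_right 0) (\<lambda>\<delta>. ereal (ln (real (cover_num d E \<delta>)) / - ln \<delta>))"
    if tb: "\<forall>\<delta>>0. \<exists>F. fine_cover d E \<delta> F"
  proof (rule ccontr)
    let ?g = "\<lambda>\<delta>. ereal (ln (real (cover_num d E \<delta>)) / - ln \<delta>)"
    assume "\<not> 2 \<le> Limsup (at_right 0) ?g"
    then have "Limsup (at_right 0) ?g < 2" by simp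
    then obtain c where c: "Limsup (at_right 0) ?g < ereal c" "ereal c < 2"
      using ereal_dense2 by blast
    have "\<forall>\<^sub>F \<delta> in at_right 0. ?g \<delta> < ereal c"
      using c(1) by (rule Limsup_lessD)
    then obtain b where b: "b > 0" "\<And>\<delta>. 0 < \<delta> \<Longrightarrow> \<delta> < b \<Longrightarrow> ?g \<delta> < ereal c"
      unfolding eventually_at_right_field by auto
    have "c < 2" using c(2) by simp
    then have c2: "2 - c > 0" by simp
    have b1: "min b 1 > 0" using b(1) by simp
    \<comment> \<open>With 2 - c in the role of e the cardinality is at least
      \<open>\<delta> powr (- c)\<close>, so the quotient in the Limsup is at least c at this
      \<delta>, although it is below c on all of (0, b).\<close>
    obtain \<delta> S where \<delta>: "0 < \<delta>" "\<delta> < min b 1" "finite S" "S \<subseteq> E"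
      "\<forall>x\<in>S. \<forall>y\<in>S. x \<noteq> y \<longrightarrow> \<delta> < d x y" "\<delta> powr ((2 - c) - 2) \<le> real (card S)"
      by (rule full_dimE[OF assms c2 b1])
    obtain F0 where "fine_cover d E \<delta> F0" using tb \<delta>(1) by auto
    then have "card S \<le> cover_num d E \<delta>"
      by (rule cover_num_ge) (rule card_separated_le_cover[OF _ \<delta>(4,5)])
    then have "\<delta> powr (- c) \<le> real (cover_num d E \<delta>)" using \<delta>(6) by simp
    then have "ln (\<delta> powr (- c)) \<le> ln (real (cover_num d E \<delta>))"
      using \<delta>(1) by (intro ln_mono) auto
    then have "c * (- ln \<delta>) \<le> ln (real (cover_num d E \<delta>))"
      using \<delta>(1) by (simp add: ln_powr)
    moreover have "- ln \<delta> > 0" using \<delta>(1,2) by simp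
    ultimately have "c \<le> ln (real (cover_num d E \<delta>)) / - ln \<delta>"
      by (subst pos_le_divide_eq)
    then show False using b(2)[of \<delta>] \<delta>(1,2) by auto
  qed
  show ?thesis
    unfolding upper_box_dim_eq using ne L by auto
qed

lemma upper_box_dim_le_two:
  assumes cov: "\<And>\<delta>. 0 < \<delta> \<Longrightarrow> \<delta> < 1 \<Longrightarrow> \<exists>F. fine_cover d E \<delta> F \<and> real (card F) \<le> C / \<delta>\<^sup>2"
  shows "upper_box_dim d E \<le> 2"
proof -
  have tb: "\<exists>F. fine_cover d E \<delta> F" if "\<delta> > 0" for \<delta>
  proof -
    have m: "0 < min \<delta> (1/2)" "min \<delta> (1/2) < 1" using that by auto
    obtain F where "fine_cover d E (min \<delta> (1/2)) F" using cov[OF m] by auto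
    then have "fine_cover d E \<delta> F" by (rule fine_cover_mono) auto
    then show ?thesis ..
  qed
  \<comment> \<open>The maximum with 1 makes the logarithm of the bound nonnegative, so that it also
    dominates \<open>ln 0 = 0\<close>, the value that a covering number 0 produces.\<close>
  define C' where "C' = max C 1"
  have "Limsup (at_right 0) (\<lambda>\<delta>. ereal (ln (real (cover_num d E \<delta>)) / - ln \<delta>))
        \<le> Limsup (at_right 0) (\<lambda>\<delta>. ereal (ln (C' / \<delta>\<^sup>2) / - ln \<delta>))"
  proof (rule Limsup_mono)
    have "\<forall>\<^sub>F \<delta> in at_right 0. 0 < \<delta> \<and> \<delta> < (1::real)"
      unfolding eventually_at_right_field by (intro exI[of _ 1]) auto
    then show "\<forall>\<^sub>F \<delta> in at_right 0. ereal (ln (real (cover_num d E \<delta>)) / - ln \<delta>)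
        \<le> ereal (ln (C' / \<delta>\<^sup>2) / - ln \<delta>)"
    proof eventually_elim
      case (elim \<delta>)
      then obtain F where F: "fine_cover d E \<delta> F" "real (card F) \<le> C / \<delta>\<^sup>2"
        using cov[of \<delta>] by auto
      have "C / \<delta>\<^sup>2 \<le> C' / \<delta>\<^sup>2" using elim by (intro divide_right_mono) (auto simp: C'_def)
      then have *: "real (cover_num d E \<delta>) \<le> C' / \<delta>\<^sup>2" using F(2) cover_num_le[OF F(1)] by linarith
      have "\<delta>\<^sup>2 \<le> 1" using elim by (simp add: power_le_one)
      then have "1 \<le> C' / \<delta>\<^sup>2" using elim by (simp add: C'_def le_divide_eq)
      then have "ln (real (cover_num d E \<delta>)) \<le> ln (C' / \<delta>\<^sup>2)"
        using * by (cases "cover_num d E \<delta> = 0") auto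
      moreover have "- ln \<delta> > 0" using elim by simp
      ultimately show ?case
        by (simp only: ereal_less_eq) (rule divide_right_mono, auto)
    qed
  qed
  also have "\<dots> = 2"
  proof (rule lim_imp_Limsup)
    have "C' > 0" by (simp add: C'_def)
    then have "((\<lambda>\<delta>. ln (C' / \<delta>\<^sup>2) / - ln \<delta>) \<longlongrightarrow> 2) (at_right 0)"
      by real_asymp
    then show "((\<lambda>\<delta>. ereal (ln (C' / \<delta>\<^sup>2) / - ln \<delta>)) \<longlongrightarrow> 2) (at_right 0)"
      unfolding numeral_eq_ereal by (rule tendsto_ereal)
  qed auto
  finally show ?thesis
    unfolding upper_box_dim_eq using tb by auto
qed

section \<open>Quadratic covers in the plane and on the sphere\<close>

lemma grid_cover:
  fixes R \<delta> :: real
  assumes "0 < \<delta>" "\<delta> < 1" "R \<ge> 0"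
  shows "\<exists>F. fine_cover dist (cball 0 R :: complex set) \<delta> F \<and> real (card F) \<le> (4 * R + 5)\<^sup>2 / \<delta>\<^sup>2"
proof -
  \<comment> \<open>Cells of side \<delta> / 2 suffice, since the diameter is estimated by the sum
    of the two coordinate differences.\<close>
  define h where "h = \<delta> / 2"
  define m where "m = \<lceil>R / h\<rceil>"
  have h: "h > 0" using assms by (simp add: h_def)
  have "0 \<le> R / h" using assms h by simp
  then have m: "m \<ge> 0" by (simp add: m_def le_ceiling_iff)
  define cell where "cell = (\<lambda>(i,j). {z. \<lfloor>Re z / h\<rfloor> = i \<and> \<lfloor>Im z / h\<rfloor> = j})"
  define F where "F = cell ` ({- m - 1..m} \<times> {- m - 1..m})"
  have fin: "finite F" by (simp add: F_def)
  have sub: "cball 0 R \<subseteq> \<Union>F"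
  proof
    have key: "\<lfloor>x / h\<rfloor> \<in> {- m - 1..m}" if "\<bar>x\<bar> \<le> R" for x
    proof -
      have "\<bar>x / h\<bar> \<le> R / h" using that h by (simp add: divide_right_mono)
      also have "R / h \<le> of_int m" by (simp add: m_def)
      finally show ?thesis by (auto; linarith)
    qed
    fix z :: complex assume "z \<in> cball 0 R"
    then have "\<bar>Re z\<bar> \<le> R" "\<bar>Im z\<bar> \<le> R"
      using abs_Re_le_cmod[of z] abs_Im_le_cmod[of z] by auto
    with key have "(\<lfloor>Re z / h\<rfloor>, \<lfloor>Im z / h\<rfloor>) \<in> {- m - 1..m} \<times> {- m - 1..m}" by blast
    moreover have "z \<in> cell (\<lfloor>Re z / h\<rfloor>, \<lfloor>Im z / h\<rfloor>)" by (simp add: cell_def)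
    ultimately show "z \<in> \<Union>F" unfolding F_def by blast
  qed
  have diam: "dist x y \<le> \<delta>" if A: "A \<in> F" "x \<in> A" "y \<in> A" for A x y
  proof -
    have key: "\<bar>a - b\<bar> \<le> h" if "\<lfloor>a / h\<rfloor> = \<lfloor>b / h\<rfloor>" for a b :: real
    proof -
      have "\<bar>a / h - b / h\<bar> \<le> 1" using that by linarith
      then show ?thesis using h by (simp add: diff_divide_distrib[symmetric])
    qed
    have "\<bar>Re x - Re y\<bar> \<le> h" "\<bar>Im x - Im y\<bar> \<le> h"
      using A by (auto simp: F_def cell_def intro!: key)
    then have "cmod (x - y) \<le> h + h"
      using cmod_le[of "x - y"] by simp
    then show ?thesis by (simp add: dist_norm h_def)
  qed
  have card: "real (card F) \<le> (4 * R + 5)\<^sup>2 / \<delta>\<^sup>2"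
  proof -
    have "card F \<le> card ({- m - 1..m} \<times> {- m - 1..m})"
      unfolding F_def by (rule card_image_le) auto
    also have "\<dots> = (nat (2 * m + 2))\<^sup>2"
      by (simp add: card_cartesian_product power2_eq_square algebra_simps)
    finally have "real (card F) \<le> (real (nat (2 * m + 2)))\<^sup>2"
      by (metis of_nat_le_iff of_nat_power)
    also have "real (nat (2 * m + 2)) = 2 * of_int m + 2" using m by simp
    also have "(2 * of_int m + 2)\<^sup>2 \<le> ((4 * R + 5) / \<delta>)\<^sup>2"
    proof (rule power_mono)
      have "of_int m \<le> R / h + 1" by (simp add: m_def)
      then have "2 * of_int m + 2 \<le> 4 * R / \<delta> + 4" by (simp add: h_def)
      also have "\<dots> \<le> (4 * R + 5) / \<delta>" using assms by (simp add: field_simps)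
      finally show "2 * of_int m + 2 \<le> (4 * R + 5) / \<delta>" .
    qed (use m in auto)
    finally show ?thesis by (simp add: power_divide)
  qed
  show ?thesis
    by (rule exI[of _ F]) (rule conjI[OF fine_coverI[OF fin sub diam] card])
qed

lemma upper_box_dim_bounded_le_two: "bounded E \<Longrightarrow> upper_box_dim dist (E :: complex set) \<le> 2"
proof -
  assume "bounded E"
  then obtain R where R: "R > 0" "E \<subseteq> cball 0 R" using bounded_subset_ballD[of E 0] ball_subset_cball by blast
  show ?thesis
  proof (rule upper_box_dim_le_two)
    fix \<delta> :: real assume "0 < \<delta>" "\<delta> < 1"
    from grid_cover[OF this, of R] R(1) obtain F where
      F: "fine_cover dist (cball 0 R :: complex set) \<delta> F" "real (card F) \<le> (4 * R + 5)\<^sup>2 / \<delta>\<^sup>2"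
      by auto
    show "\<exists>F. fine_cover dist E \<delta> F \<and> real (card F) \<le> (4 * R + 5)\<^sup>2 / \<delta>\<^sup>2"
      by (rule exI[of _ F]) (rule conjI[OF fine_cover_mono[OF F(1) R(2) order_refl] F(2)])
  qed
qed

lemma packing_dim_le_two: "packing_dim E \<le> 2"
proof -
  have "z \<in> \<Union>(range (\<lambda>n. E \<inter> cball 0 (real n)))" if "z \<in> E" for z
    using that real_arch_simple[of "cmod z"] by auto
  then have "E \<subseteq> \<Union>(range (\<lambda>n. E \<inter> cball 0 (real n)))" by (rule subsetI)
  then have "(\<lambda>n. E \<inter> cball 0 (real n)) \<in> {A :: nat \<Rightarrow> complex set. E \<subseteq> \<Union>(range A)}"
    by (simp only: mem_Collect_eq)
  then have "packing_dim E \<le> (SUP i. upper_box_dim dist (E \<inter> cball 0 (real i)))"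
    unfolding packing_dim_def by (rule INF_lower)
  also have "\<dots> \<le> 2"
    by (intro SUP_least upper_box_dim_bounded_le_two) (simp add: bounded_Int)
  finally show ?thesis .
qed

lemma chordal_le_dist: "chordal (Some a) (Some b) \<le> 2 * dist a b"
proof -
  have "1 \<le> (1 + (cmod a)\<^sup>2) * (1 + (cmod b)\<^sup>2)"
    by (metis add_increasing2 le_numeral_extra(4) mult_ge1_I zero_le_power2)
  then have "1 \<le> sqrt ((1 + (cmod a)\<^sup>2) * (1 + (cmod b)\<^sup>2))" by simp
  then show ?thesis
    using mult_left_mono[of 1 _ "2 * cmod (a - b)"] by (simp add: dist_norm divide_le_eq)
qed

text \<open>Inversion is a rotation of the sphere. It carries the outside of the unit disc into the
  disc, so one grid in the disc also serves sets that are unbounded in the plane.\<close>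

lemma chordal_inverse:
  assumes "a \<noteq> 0" "b \<noteq> 0"
  shows "chordal (Some (inverse a)) (Some (inverse b)) = chordal (Some a) (Some b)"
proof -
  have "inverse a - inverse b = (b - a) / (a * b)" using assms by (simp add: field_simps)
  then have 1: "cmod (inverse a - inverse b) = cmod (a - b) / (cmod a * cmod b)"
    by (simp add: norm_divide norm_mult norm_minus_commute)
  have "(1 + (cmod (inverse a))\<^sup>2) * (1 + (cmod (inverse b))\<^sup>2)
      = ((1 + (cmod a)\<^sup>2) * (1 + (cmod b)\<^sup>2)) / (cmod a * cmod b)\<^sup>2"
    using assms by (simp add: norm_inverse power_mult_distrib) (simp add: field_simps)
  then have 2: "sqrt ((1 + (cmod (inverse a))\<^sup>2) * (1 + (cmod (inverse b))\<^sup>2))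
      = sqrt ((1 + (cmod a)\<^sup>2) * (1 + (cmod b)\<^sup>2)) / (cmod a * cmod b)"
    by (simp add: real_sqrt_divide)
  show ?thesis unfolding chordal.simps 1 2 using assms by simp
qed

lemma upper_box_dim_chordal_le_two:
  "upper_box_dim (\<lambda>a b. chordal (Some a) (Some b)) E \<le> 2"
proof (rule upper_box_dim_le_two)
  fix \<delta> :: real assume \<delta>: "0 < \<delta>" "\<delta> < 1"
  \<comment> \<open>The scale \<delta> / 2 compensates the factor 2 of
    \<open>chordal_le_dist\<close>; 324 is 9 squared times 4, from \<open>grid_cover\<close> with R
    = 1.\<close>
  obtain F where F0: "fine_cover dist (cball 0 1 :: complex set) (\<delta> / 2) F"
    and F4: "real (card F) \<le> 324 / \<delta>\<^sup>2"
    using grid_cover[of "\<delta> / 2" 1] \<delta> by (auto simp: power_divide)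
  note F = fine_coverD[OF F0]
  define F' where "F' = (\<lambda>A. {z. cmod z \<ge> 1 \<and> inverse z \<in> A}) ` F"
  have "finite F'" using F(1) by (simp add: F'_def)
  moreover have "real (card F') \<le> 324 / \<delta>\<^sup>2"
    using F(1) card_image_le[OF F(1), of "\<lambda>A. {z. cmod z \<ge> 1 \<and> inverse z \<in> A}"] F4
    unfolding F'_def by linarith
  ultimately have F': "finite F'" "real (card F') \<le> 324 / \<delta>\<^sup>2" by auto
  have cov: "E \<subseteq> \<Union>(F \<union> F')"
  proof
    fix z
    show "z \<in> \<Union>(F \<union> F')"
    proof (cases "cmod z \<ge> 1")
      case True
      then have "inverse z \<in> cball 0 1" by (simp add: norm_inverse inverse_le_1_iff)
      then have "inverse z \<in> \<Union>F" using F(2) by (rule rev_subsetD)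
      then obtain A where "A \<in> F" "inverse z \<in> A" by (rule UnionE)
      with True have "z \<in> {z. cmod z \<ge> 1 \<and> inverse z \<in> A}" "{z. cmod z \<ge> 1 \<and> inverse z \<in> A} \<in> F'"
        by (auto simp: F'_def)
      then show ?thesis by (intro UnionI[of _ "F \<union> F'"]) auto
    next
      case False
      then have "z \<in> cball 0 1" by simp
      then have "z \<in> \<Union>F" using F(2) by (rule rev_subsetD)
      then show ?thesis by auto
    qed
  qed
  have diam: "chordal (Some x) (Some y) \<le> \<delta>" if A: "A \<in> F \<union> F'" "x \<in> A" "y \<in> A" for A x y
  proof (cases "A \<in> F")
    case True
    then show ?thesis using F(3)[of A x y] A chordal_le_dist[of x y] by linarith
  next
    case False
    then obtain B where B: "B \<in> F" "A = {z. cmod z \<ge> 1 \<and> inverse z \<in> B}"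
      using A(1) unfolding F'_def by auto
    then have xy: "x \<noteq> 0" "y \<noteq> 0" "inverse x \<in> B" "inverse y \<in> B" using A by auto
    then show ?thesis
      using chordal_inverse[of x y] chordal_le_dist[of "inverse x" "inverse y"] F(3)[OF B(1) xy(3,4)]
      by linarith
  qed
  have card: "real (card (F \<union> F')) \<le> 648 / \<delta>\<^sup>2"
    using card_Un_le[of F F'] F4 F'(2) by linarith
  have "finite (F \<union> F')" using F(1) F'(1) by simp
  note fc = fine_coverI[OF this cov diam]
  show "\<exists>F. fine_cover (\<lambda>a b. chordal (Some a) (Some b)) E \<delta> F \<and> real (card F) \<le> 648 / \<delta>\<^sup>2"
    by (rule exI[of _ "F \<union> F'"]) (rule conjI[OF fc card])
qed

text \<open>The map \<open>g\<close> may depend on the finite set and on the scale, because passing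
  to a dense subset requires approximations finer than \<delta>. The constant \<open>c\<close> is
  paid for by using e / 2 in place of e at small scales; \<open>d' x x \<le> 0\<close> makes
  \<open>g\<close> injective on separated sets.\<close>

lemma full_dim_transfer:
  assumes "full_dim d A" "c > 0" "\<And>x. d' x x \<le> 0"
    and g: "\<And>S \<delta>. finite S \<Longrightarrow> S \<subseteq> A \<Longrightarrow> \<delta> > 0 \<Longrightarrow> \<forall>x\<in>S. \<forall>y\<in>S. x \<noteq> y \<longrightarrow> \<delta> < d x y \<Longrightarrow>
       \<exists>g. g ` S \<subseteq> B \<and> (\<forall>x\<in>S. \<forall>y\<in>S. x \<noteq> y \<longrightarrow> c * \<delta> < d' (g x) (g y))"
  shows "full_dim d' B"
  unfolding full_dim_def
proof (intro allI impI)
  fix e b :: real assume e: "e > 0" and b: "b > 0"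
  have "\<forall>\<^sub>F \<delta> in at_right 0. (c * \<delta>) powr (e - 2) \<le> \<delta> powr (e / 2 - 2)"
    using \<open>c > 0\<close> e by real_asymp
  then obtain s where s: "s > 0" "\<And>\<delta>. 0 < \<delta> \<Longrightarrow> \<delta> < s \<Longrightarrow> (c * \<delta>) powr (e - 2) \<le> \<delta> powr (e / 2 - 2)"
    unfolding eventually_at_right_field by auto
  have e2: "e / 2 > 0" and bs: "min s (b / c) > 0" using e b s(1) \<open>c > 0\<close> by auto
  obtain \<delta> S where \<delta>: "0 < \<delta>" "\<delta> < min s (b / c)" "finite S" "S \<subseteq> A"
    "\<forall>x\<in>S. \<forall>y\<in>S. x \<noteq> y \<longrightarrow> \<delta> < d x y" "\<delta> powr (e / 2 - 2) \<le> real (card S)"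
    by (rule full_dimE[OF assms(1) e2 bs])
  obtain g where "g ` S \<subseteq> B \<and> (\<forall>x\<in>S. \<forall>y\<in>S. x \<noteq> y \<longrightarrow> c * \<delta> < d' (g x) (g y))"
    using g[OF \<delta>(3,4,1,5)] ..
  then have gS: "g ` S \<subseteq> B" and sep: "\<And>x y. x \<in> S \<Longrightarrow> y \<in> S \<Longrightarrow> x \<noteq> y \<Longrightarrow> c * \<delta> < d' (g x) (g y)"
    by simp_all
  have c\<delta>: "c * \<delta> > 0" using \<delta>(1) \<open>c > 0\<close> by simp
  have "inj_on g S"
  proof (rule inj_onI, rule ccontr)
    fix x y assume "x \<in> S" "y \<in> S" "g x = g y" "x \<noteq> y"
    then show False using sep[of x y] assms(3)[of "g y"] c\<delta> by simp
  qed
  then have "card (g ` S) = card S" by (rule card_image)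
  moreover have "(c * \<delta>) powr (e - 2) \<le> real (card S)"
    using s(2)[of \<delta>] \<delta>(1,2,6) by simp
  ultimately have card: "(c * \<delta>) powr (e - 2) \<le> real (card (g ` S))" by simp
  have lt: "c * \<delta> < b" using \<delta>(2) \<open>c > 0\<close> by (simp add: field_simps)
  have sep': "\<forall>x\<in>g ` S. \<forall>y\<in>g ` S. x \<noteq> y \<longrightarrow> c * \<delta> < d' x y"
    using sep by (auto simp del: image_subset_iff)
  show "\<exists>\<delta>>0. \<delta> < b \<and> (\<exists>S. finite S \<and> S \<subseteq> B \<and> (\<forall>x\<in>S. \<forall>y\<in>S. x \<noteq> y \<longrightarrow> \<delta> < d' x y) \<and>
           \<delta> powr (e - 2) \<le> real (card S))"
    using c\<delta> lt finite_imageI[OF \<delta>(3)] gS sep' card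
    by (intro exI[of _ "c * \<delta>"] exI[of _ "g ` S"] conjI)
qed

lemma full_dim_image:
  assumes "full_dim d A" "c > 0" "\<And>x. d' x x \<le> 0" "g ` A \<subseteq> B"
    and "\<And>x y. x \<in> A \<Longrightarrow> y \<in> A \<Longrightarrow> c * d x y \<le> d' (g x) (g y)"
  shows "full_dim d' B"
proof (rule full_dim_transfer[OF assms(1,2,3)])
  fix S \<delta> assume S: "S \<subseteq> A" and \<delta>: "\<forall>x\<in>S. \<forall>y\<in>S. x \<noteq> y \<longrightarrow> \<delta> < d x y"
  show "\<exists>g. g ` S \<subseteq> B \<and> (\<forall>x\<in>S. \<forall>y\<in>S. x \<noteq> y \<longrightarrow> c * \<delta> < d' (g x) (g y))"
  proof (intro exI[of _ g] conjI ballI impI)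
    show "g ` S \<subseteq> B" using image_mono[OF S] assms(4) by (rule subset_trans)
    fix x y assume xy: "x \<in> S" "y \<in> S" "x \<noteq> y"
    then have "c * \<delta> < c * d x y" using \<delta> \<open>c > 0\<close> by simp
    also have "\<dots> \<le> d' (g x) (g y)" using assms(5)[OF subsetD[OF S xy(1)] subsetD[OF S xy(2)]] .
    finally show "c * \<delta> < d' (g x) (g y)" .
  qed
qed

lemma full_dim_closure:
  fixes A E :: "'a::metric_space set"
  assumes "full_dim dist E" "E \<subseteq> closure A"
  shows "full_dim dist A"
proof (rule full_dim_transfer[OF assms(1)])
  fix S :: "'a set" and \<delta> :: real
  assume S: "S \<subseteq> E" and pos: "\<delta> > 0" and \<delta>: "\<forall>x\<in>S. \<forall>y\<in>S. x \<noteq> y \<longrightarrow> \<delta> < dist x y"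
  have "\<exists>y\<in>A. dist y x < \<delta> / 4" if "x \<in> S" for x
    using subsetD[OF assms(2) subsetD[OF S that], unfolded closure_approachable, THEN spec, of "\<delta> / 4"] pos
    by simp
  then obtain g where g: "\<And>x. x \<in> S \<Longrightarrow> g x \<in> A \<and> dist (g x) x < \<delta> / 4"
    by metis
  show "\<exists>g. g ` S \<subseteq> A \<and> (\<forall>x\<in>S. \<forall>y\<in>S. x \<noteq> y \<longrightarrow> 1/2 * \<delta> < dist (g x) (g y))"
  proof (intro exI[of _ g] conjI ballI impI)
    show "g ` S \<subseteq> A" using g by auto
    fix x y assume xy: "x \<in> S" "y \<in> S" "x \<noteq> y"
    then have "\<delta> < dist x y" using \<delta> by simp
    moreover have "dist x y \<le> dist (g x) x + dist (g x) (g y) + dist (g y) y"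
      by (metis dist_commute dist_triangle dist_triangle_le add_le_cancel_right)
    ultimately show "1/2 * \<delta> < dist (g x) (g y)" using g[OF xy(1)] g[OF xy(2)] by linarith
  qed
qed auto

text \<open>If the closure of some piece contains a relatively open part of \<open>X\<close>, that
  piece has full dimension by \<open>full_dim_closure\<close>. If no closure does, their complements
  are open and dense in \<open>X\<close>, and Baire's theorem gives a point of \<open>X\<close>
  outside all pieces.\<close>

lemma packing_dim_ge_two:
  fixes X J :: "complex set"
  assumes "closed X" "X \<noteq> {}" "X \<subseteq> J"
    and full: "\<And>D. open D \<Longrightarrow> D \<inter> X \<noteq> {} \<Longrightarrow> full_dim dist (D \<inter> X)"
  shows "2 \<le> packing_dim J"
  unfolding packing_dim_def
proof (rule INF_greatest)
  fix A :: "nat \<Rightarrow> complex set" assume "A \<in> {A. J \<subseteq> \<Union>(range A)}"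
  then have A: "J \<subseteq> \<Union>(range A)" by (simp only: mem_Collect_eq)
  have "\<exists>i. full_dim dist (A i)"
  proof (rule ccontr)
    assume no: "\<nexists>i. full_dim dist (A i)"
    have "X \<subseteq> closure (\<Inter>(range (\<lambda>i. X - closure (A i))))"
    proof (rule Baire[OF assms(1)])
      fix T assume "T \<in> range (\<lambda>i. X - closure (A i))"
      then obtain i where T: "T = X - closure (A i)" by auto
      have "T = X \<inter> - closure (A i)" using T by auto
      then have "openin (top_of_set X) T" by (metis closed_closure open_Compl openin_open_Int)
      moreover have "X \<subseteq> closure T"
      proof
        fix x assume "x \<in> X"
        show "x \<in> closure T"
          unfolding closure_iff_nhds_not_empty
        proof (intro allI impI)
          fix V U assume U: "U \<subseteq> V" "open U" "x \<in> U"
          then have "full_dim dist (U \<inter> X)" using full \<open>x \<in> X\<close> by auto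
          then have "\<not> U \<inter> X \<subseteq> closure (A i)" using no full_dim_closure by metis
          then show "T \<inter> V \<noteq> {}" using U(1) unfolding T by auto
        qed
      qed
      ultimately show "openin (top_of_set X) T \<and> X \<subseteq> closure T" ..
    qed auto
    then have "\<Inter>(range (\<lambda>i. X - closure (A i))) \<noteq> {}"
      using \<open>X \<noteq> {}\<close> by (metis closure_empty subset_empty)
    then obtain x where x: "x \<in> X" "\<And>i. x \<notin> closure (A i)" by auto
    have "x \<in> \<Union>(range A)" by (rule subsetD[OF A subsetD[OF assms(3) x(1)]])
    then obtain i where "x \<in> A i" by auto
    then show False using x(2)[of i] subsetD[OF closure_subset] by metis
  qed
  then obtain i where "full_dim dist (A i)" ..
  then have "2 \<le> upper_box_dim dist (A i)" by (rule full_dim_imp_upper_box_dim_ge)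
  also have "\<dots> \<le> (SUP i. upper_box_dim dist (A i))" by (rule SUP_upper) simp
  finally show "2 \<le> (SUP i. upper_box_dim dist (A i))" .
qed

section \<open>Distortion of univalent functions\<close>

text \<open>The branch of \<open>sqrt (1 - g / c)\<close>, for \<open>c\<close> a value omitted by \<open>g\<close>, omits \<open>0\<close> and the negative
  of its value at the centre, so Schottky's theorem bounds it.\<close>
lemma univalent_growth_unit:
  fixes g :: "complex \<Rightarrow> complex"
  assumes hol: "g holomorphic_on S" and "open S" and inj: "inj_on g S" and sub: "cball 0 1 \<subseteq> S"
    and g0: "g 0 = 0" and dg: "deriv g 0 = 1" and z: "cmod z \<le> 1/2"
  shows "cmod (g z) \<le> 2 * (1 + (exp (pi * exp (pi * 16)))\<^sup>2)"
proof -
  obtain k where k: "k holomorphic_on (g ` S)" "\<And>z. z \<in> S \<Longrightarrow> deriv g z * deriv k (g z) = 1"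
    "\<And>z. z \<in> S \<Longrightarrow> k (g z) = z"
    using holomorphic_has_inverse[OF hol \<open>open S\<close> inj] by metis
  have "0 \<in> S" using sub by auto
  with k(2)[of 0] g0 dg have dk: "deriv k 0 = 1" by simp
  \<comment> \<open>Otherwise the inverse \<open>k\<close> would map the disc of radius 2 into the
    unit disc, and Cauchy's estimate at radius 3/2 would give derivative at most 2/3 at 0, where it
    is 1.\<close>
  have "\<exists>c. cmod c < 2 \<and> c \<notin> g ` cball 0 1"
  proof (rule ccontr)
    assume no: "\<nexists>c. cmod c < 2 \<and> c \<notin> g ` cball 0 1"
    have sub2: "ball 0 2 \<subseteq> g ` cball 0 1"
    proof
      fix c :: complex assume "c \<in> ball 0 2"
      then show "c \<in> g ` cball 0 1" using no by (auto simp del: image_iff)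
    qed
    then have "ball 0 2 \<subseteq> g ` S" using image_mono[OF sub] by (rule subset_trans)
    then have hk: "k holomorphic_on ball 0 2" using k(1) holomorphic_on_subset by blast
    have nk: "cmod (k x) \<le> 1" if "x \<in> ball 0 2" for x
    proof -
      obtain y where "y \<in> cball 0 1" "x = g y" using subsetD[OF sub2 \<open>x \<in> ball 0 2\<close>] by (rule imageE)
      then show ?thesis using k(3)[of y] sub by auto
    qed
    have "cmod ((deriv ^^ 1) k 0) \<le> fact 1 * 1 / (3/2) ^ 1"
    proof (rule Cauchy_inequality)
      show "k holomorphic_on ball 0 (3/2)" by (rule holomorphic_on_subset[OF hk]) auto
      show "continuous_on (cball 0 (3/2)) k"
        by (rule holomorphic_on_imp_continuous_on, rule holomorphic_on_subset[OF hk]) auto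
    qed (use nk in auto)
    then show False using dk by simp
  qed
  then obtain c where c: "cmod c < 2" "c \<notin> g ` cball 0 1" by metis
  have c0: "c \<noteq> 0" using c(2) g0 by (metis centre_in_cball image_eqI zero_le_one)
  have "(\<lambda>z. 1 - g z / c) holomorphic_on cball 0 1"
    using holomorphic_on_subset[OF hol sub] c0 by (intro holomorphic_intros) auto
  moreover have "contractible (cball (0::complex) 1)" by (simp add: convex_imp_contractible)
  moreover have "1 - g z / c \<noteq> 0" if "z \<in> cball 0 1" for z
    using c(2) c0 that by (auto simp: field_simps)
  ultimately obtain q where q: "q holomorphic_on cball 0 1" "\<And>z. z \<in> cball 0 1 \<Longrightarrow> 1 - g z / c = (q z)\<^sup>2"
    using contractible_imp_holomorphic_sqrt by (metis (no_types, lifting))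
  have q0: "(q 0)\<^sup>2 = 1" using q(2)[of 0] g0 by simp
  then have nq0: "cmod (q 0) = 1" by (metis norm_one norm_power power_eq_1_iff zero_neq_numeral power2_eq_1_iff norm_minus_cancel)
  then have q00: "q 0 \<noteq> 0" by auto
  \<comment> \<open>The value 1 is omitted as well: \<open>q w = - q 0\<close> would give
    \<open>g w = g 0\<close>, hence w = 0 by injectivity, where \<open>q 0\<close> is nonzero. The
    numbers in Schottky's bound add up to 2 + 2 + 12 = 16.\<close>
  have "cmod (- q z / q 0) \<le> exp (pi * exp (pi * (2 + 2 * 1 + 12 * (1/2) / (1 - 1/2))))"
  proof (rule Schottky[where f = "\<lambda>z. - q z / q 0"])
    show "(\<lambda>z. - q z / q 0) holomorphic_on cball 0 1"
      using q(1) q00 by (intro holomorphic_intros) auto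
    show "cmod (- q 0 / q 0) \<le> 1" using q00 by simp
    show "\<not> (- q w / q 0 = 0 \<or> - q w / q 0 = 1)" if w: "w \<in> cball 0 1" for w
    proof
      assume "- q w / q 0 = 0 \<or> - q w / q 0 = 1"
      then show False
      proof
        assume "- q w / q 0 = 0"
        then have "1 - g w / c = 0" using q(2)[OF w] q00 by simp
        then have "g w = c" using c0 by (simp add: field_simps)
        then show False using c(2) w by blast
      next
        assume "- q w / q 0 = 1"
        then have "- q w = q 0" using q00 by (simp add: field_simps)
        then have qw: "q w = - q 0" by (metis minus_minus)
        then have "1 - g w / c = 1" using q(2)[OF w] q0 by simp
        then have "g w = g 0" using c0 g0 by simp
        then have "w = 0" using inj w \<open>0 \<in> S\<close> sub by (meson inj_onD subsetD)
        then show False using qw q00 by simp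
      qed
    qed
  qed (use z in auto)
  then have "cmod (q z) \<le> exp (pi * exp (pi * 16))" using nq0 by (simp add: norm_divide)
  then have "(cmod (q z))\<^sup>2 \<le> (exp (pi * exp (pi * 16)))\<^sup>2" by (intro power_mono) auto
  moreover have "cmod (1 - (q z)\<^sup>2) \<le> 1 + (cmod (q z))\<^sup>2"
    by (metis norm_one norm_power norm_triangle_ineq4)
  ultimately have le: "cmod (1 - (q z)\<^sup>2) \<le> 1 + (exp (pi * exp (pi * 16)))\<^sup>2" by linarith
  have "g z = c * (1 - (q z)\<^sup>2)"
    using q(2)[of z] z c0 by (simp add: field_simps)
  then have "cmod (g z) = cmod c * cmod (1 - (q z)\<^sup>2)" by (simp add: norm_mult)
  also have "\<dots> \<le> 2 * (1 + (exp (pi * exp (pi * 16)))\<^sup>2)"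
    by (rule mult_mono) (use c(1) le in auto)
  finally show ?thesis .
qed

lemma univalent_growth:
  fixes g :: "complex \<Rightarrow> complex"
  assumes hol: "g holomorphic_on S" and "open S" and inj: "inj_on g S" and sub: "cball v r \<subseteq> S"
    and "r > 0" and w: "cmod (w - v) \<le> r / 2"
  shows "cmod (g w - g v) \<le> 2 * (1 + (exp (pi * exp (pi * 16)))\<^sup>2) * r * cmod (deriv g v)"
proof -
  have vS: "v \<in> S" using sub \<open>r > 0\<close> by auto
  have dv: "deriv g v \<noteq> 0"
    using holomorphic_injective_imp_regular[OF hol \<open>open S\<close> inj vS] .
  define G where "G = (\<lambda>z. (g (v + of_real r * z) - g v) / (of_real r * deriv g v))"
  define T where "T = (\<lambda>z. v + of_real r * z) -` S"
  have "open T" unfolding T_def by (intro open_vimage \<open>open S\<close> continuous_intros)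
  have r0: "complex_of_real r \<noteq> 0" using \<open>r > 0\<close> by simp
  have "(g \<circ> (\<lambda>z. v + of_real r * z)) holomorphic_on T"
    by (intro holomorphic_on_compose_gen[OF _ hol] holomorphic_intros) (auto simp: T_def)
  then have hG: "G holomorphic_on T"
    unfolding G_def o_def using r0 dv by (intro holomorphic_intros) auto
  have iG: "inj_on G T"
  proof (rule inj_onI)
    fix x y assume xy: "x \<in> T" "y \<in> T" "G x = G y"
    then have "g (v + of_real r * x) = g (v + of_real r * y)"
      using r0 dv by (simp add: G_def)
    then show "x = y" using inj_onD[OF inj] xy r0 unfolding T_def by fastforce
  qed
  have cb: "cball 0 1 \<subseteq> T"
  proof
    fix z :: complex assume "z \<in> cball 0 1"
    then have "v + of_real r * z \<in> cball v r" using \<open>r > 0\<close> by (simp add: dist_norm norm_mult mult_left_le)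
    then show "z \<in> T" using sub by (auto simp: T_def)
  qed
  have G0: "G 0 = 0" by (simp add: G_def)
  have "(g has_field_derivative deriv g v) (at v)"
    using hol \<open>open S\<close> vS holomorphic_derivI by blast
  then have "(g has_field_derivative deriv g v) (at (v + of_real r * 0))" by simp
  then have "(G has_field_derivative (deriv g v * of_real r) / (of_real r * deriv g v)) (at 0)"
    unfolding G_def by (auto intro!: derivative_eq_intros DERIV_chain2[where f = g])
  then have dG: "deriv G 0 = 1" using r0 dv by (simp add: DERIV_imp_deriv)
  have zz: "cmod ((w - v) / of_real r) \<le> 1/2"
    using w \<open>r > 0\<close> by (simp add: norm_divide field_simps)
  have "cmod (G ((w - v) / of_real r)) \<le> 2 * (1 + (exp (pi * exp (pi * 16)))\<^sup>2)"
    by (rule univalent_growth_unit[OF hG \<open>open T\<close> iG cb G0 dG zz])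
  then show ?thesis
    using r0 dv \<open>r > 0\<close> by (simp add: G_def norm_divide norm_mult field_simps)
qed

definition univalent_const :: real where
  "univalent_const = 64 * (1 + (exp (pi * exp (pi * 16)))\<^sup>2)"

lemma univalent_const_ge: "univalent_const \<ge> 1"
  unfolding univalent_const_def by simp

text \<open>This is Cauchy's estimate for the second derivative on a disc of radius r / 4, which
  stays where \<open>univalent_growth\<close> applies. The factors 2! and 4^2 and the 2 of the
  growth bound multiply to the 64 in \<open>univalent_const\<close>.\<close>

lemma univalent_deriv2:
  fixes g :: "complex \<Rightarrow> complex"
  assumes hol: "g holomorphic_on S" and "open S" and inj: "inj_on g S" and sub: "cball v r \<subseteq> S"
    and "r > 0" and w: "cmod (w - v) \<le> r / 4"
  shows "cmod (deriv (deriv g) w) \<le> univalent_const * cmod (deriv g v) / r"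
proof -
  define B :: real where "B = 2 * (1 + (exp (pi * exp (pi * 16)))\<^sup>2)"
  have near: "cmod (x - v) \<le> r / 2" if "x \<in> cball w (r / 4)" for x
  proof -
    have "cmod (x - v) \<le> cmod (x - w) + cmod (w - v)" by (metis norm_triangle_sub add.commute diff_add_cancel norm_triangle_ineq diff_add_eq)
    then show ?thesis using that w by (simp add: dist_norm norm_minus_commute)
  qed
  have cb: "cball w (r / 4) \<subseteq> S"
  proof
    fix x assume "x \<in> cball w (r / 4)"
    then have "x \<in> cball v r" using near[of x] \<open>r > 0\<close> by (simp add: dist_norm norm_minus_commute)
    then show "x \<in> S" using sub by blast
  qed
  have hol': "(\<lambda>x. g x - g v) holomorphic_on cball w (r / 4)"
    by (intro holomorphic_intros holomorphic_on_subset[OF hol cb])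
  have "cmod ((deriv ^^ 2) (\<lambda>x. g x - g v) w) \<le> fact 2 * (B * r * cmod (deriv g v)) / (r / 4) ^ 2"
  proof (rule Cauchy_inequality)
    show "(\<lambda>x. g x - g v) holomorphic_on ball w (r / 4)"
      by (rule holomorphic_on_subset[OF hol']) auto
    show "continuous_on (cball w (r / 4)) (\<lambda>x. g x - g v)"
      by (rule holomorphic_on_imp_continuous_on[OF hol'])
    fix x assume "cmod (w - x) = r / 4"
    then show "cmod (g x - g v) \<le> B * r * cmod (deriv g v)"
      using univalent_growth[OF hol \<open>open S\<close> inj sub \<open>r > 0\<close> near[of x]]
      unfolding B_def by (simp add: dist_norm)
  qed (use \<open>r > 0\<close> in simp)
  moreover have "(deriv ^^ 2) (\<lambda>x. g x - g v) w = deriv (deriv g) w"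
  proof -
    have wS: "w \<in> S" using cb \<open>r > 0\<close> by auto
    have "deriv (\<lambda>x. g x - g v) x = deriv g x" if "x \<in> S" for x
      using holomorphic_derivI[OF hol \<open>open S\<close> that]
      by (intro DERIV_imp_deriv) (auto intro!: derivative_eq_intros)
    then have "\<forall>\<^sub>F x in nhds w. deriv (\<lambda>x. g x - g v) x = deriv g x"
      using \<open>open S\<close> wS by (auto simp: eventually_nhds)
    then show ?thesis
      by (simp add: numeral_2_eq_2 deriv_cong_ev)
  qed
  moreover have "fact 2 * (B * r * cmod (deriv g v)) / (r / 4) ^ 2 = 32 * B * cmod (deriv g v) / r"
    using \<open>r > 0\<close> by (simp add: power2_eq_square field_simps)
  ultimately show ?thesis by (simp add: B_def univalent_const_def)
qed

text \<open>Integrating the second derivative shows that \<open>deriv g\<close> deviates from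
  \<open>deriv g v\<close> by at most half of its modulus. So \<open>g\<close> minus its linear part
  is Lipschitz with half the slope, and \<open>g\<close> is bi-Lipschitz. The bound is stated with
  an abstract \<open>K\<close> so as to cover both univalent maps at a definite relative radius and
  arbitrary regular points.\<close>

lemma univalent_distortion:
  fixes g :: "complex \<Rightarrow> complex"
  assumes hol: "g holomorphic_on S" and "open S" and cb: "cball v \<rho> \<subseteq> S" and "\<rho> > 0"
    and d2: "\<And>w. w \<in> cball v \<rho> \<Longrightarrow> cmod (deriv (deriv g) w) \<le> K * cmod (deriv g v)" and K: "K * \<rho> \<le> 1/2"
  shows "\<And>w. w \<in> cball v \<rho> \<Longrightarrow> cmod (deriv g w - deriv g v) \<le> cmod (deriv g v) / 2"
    and "\<And>p q. p \<in> cball v \<rho> \<Longrightarrow> q \<in> cball v \<rho> \<Longrightarrow> cmod (deriv g v) / 2 * dist p q \<le> dist (g p) (g q)"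
    and "\<And>p q. p \<in> cball v \<rho> \<Longrightarrow> q \<in> cball v \<rho> \<Longrightarrow> dist (g p) (g q) \<le> 3/2 * cmod (deriv g v) * dist p q"
proof -
  have dv: "v \<in> cball v \<rho>" using \<open>\<rho> > 0\<close> by simp
  have d: "(g has_field_derivative deriv g w) (at w within X)" if "w \<in> cball v \<rho>" for w X
    using holomorphic_derivI[OF hol \<open>open S\<close> subsetD[OF cb that]] by (rule has_field_derivative_at_within)
  have dd: "(deriv g has_field_derivative deriv (deriv g) w) (at w within X)" if "w \<in> cball v \<rho>" for w X
    using holomorphic_derivI[OF holomorphic_deriv[OF hol \<open>open S\<close>] \<open>open S\<close> subsetD[OF cb that]]
    by (rule has_field_derivative_at_within)
  show 1: "cmod (deriv g w - deriv g v) \<le> cmod (deriv g v) / 2" if w: "w \<in> cball v \<rho>" for w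
  proof -
    have "cmod (deriv g w - deriv g v) \<le> (K * cmod (deriv g v)) * cmod (w - v)"
      by (rule field_differentiable_bound[OF convex_cball dd d2 w dv])
    also have "\<dots> \<le> (K * cmod (deriv g v)) * \<rho>"
    proof (rule mult_left_mono)
      show "cmod (w - v) \<le> \<rho>" using w by (simp add: dist_norm norm_minus_commute)
      show "0 \<le> K * cmod (deriv g v)" using d2[OF dv] norm_ge_zero order_trans by blast
    qed
    also have "\<dots> = cmod (deriv g v) * (K * \<rho>)" by simp
    also have "\<dots> \<le> cmod (deriv g v) * (1/2)" by (rule mult_left_mono[OF K]) simp
    finally show ?thesis by simp
  qed
  have 2: "cmod ((g p - deriv g v * p) - (g q - deriv g v * q)) \<le> cmod (deriv g v) / 2 * cmod (p - q)"
    if p: "p \<in> cball v \<rho>" and q: "q \<in> cball v \<rho>" for p q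
  proof (rule field_differentiable_bound[OF convex_cball _ 1 p q])
    fix z assume "z \<in> cball v \<rho>"
    then show "((\<lambda>a. g a - deriv g v * a) has_field_derivative deriv g z - deriv g v) (at z within cball v \<rho>)"
      by (auto intro!: derivative_eq_intros d)
  qed
  have 3: "(g p - deriv g v * p) - (g q - deriv g v * q) = (g p - g q) - deriv g v * (p - q)" for p q
    by (simp add: algebra_simps)
  show "cmod (deriv g v) / 2 * dist p q \<le> dist (g p) (g q)" if "p \<in> cball v \<rho>" "q \<in> cball v \<rho>" for p q
    using 2[OF that] norm_triangle_ineq3[of "g p - g q" "deriv g v * (p - q)"]
    unfolding 3 by (simp add: dist_norm norm_mult)
  show "dist (g p) (g q) \<le> 3/2 * cmod (deriv g v) * dist p q" if "p \<in> cball v \<rho>" "q \<in> cball v \<rho>" for p q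
    using 2[OF that] norm_triangle_ineq3[of "g p - g q" "deriv g v * (p - q)"]
    unfolding 3 by (simp add: dist_norm norm_mult)
qed

lemma holomorphic_expanding_near:
  fixes g :: "complex \<Rightarrow> complex"
  assumes hol: "g holomorphic_on S" and "open S" "v \<in> S" and d: "deriv g v \<noteq> 0"
  obtains \<rho> c where "\<rho> > 0" "c > 0" "cball v \<rho> \<subseteq> S"
    "\<And>p q. p \<in> cball v \<rho> \<Longrightarrow> q \<in> cball v \<rho> \<Longrightarrow> c * dist p q \<le> dist (g p) (g q)"
proof -
  obtain r where r: "r > 0" "cball v r \<subseteq> S"
    using \<open>open S\<close> \<open>v \<in> S\<close> open_contains_cball by blast
  have h2: "deriv (deriv g) holomorphic_on S"
    by (intro holomorphic_deriv hol \<open>open S\<close>)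
  have "continuous_on (cball v r) (deriv (deriv g))"
    by (rule holomorphic_on_imp_continuous_on[OF holomorphic_on_subset[OF h2 r(2)]])
  then have "bounded (deriv (deriv g) ` cball v r)"
    by (intro compact_imp_bounded compact_continuous_image) auto
  then obtain M where M: "M > 0" "\<And>w. w \<in> cball v r \<Longrightarrow> cmod (deriv (deriv g) w) \<le> M"
    unfolding bounded_pos by auto
  define K where "K = M / cmod (deriv g v)"
  have K: "K > 0" using M d by (simp add: K_def)
  define \<rho> where "\<rho> = min r (1 / (2 * K))"
  have \<rho>: "\<rho> > 0" "K * \<rho> \<le> 1/2" "cball v \<rho> \<subseteq> cball v r"
  proof -
    show "\<rho> > 0" using r(1) K by (simp add: \<rho>_def)
    have "K * \<rho> \<le> K * (1 / (2 * K))" using K by (intro mult_left_mono) (auto simp: \<rho>_def)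
    then show "K * \<rho> \<le> 1/2" using K by simp
    show "cball v \<rho> \<subseteq> cball v r" by (rule subset_cball) (simp add: \<rho>_def)
  qed
  have sub: "cball v \<rho> \<subseteq> S" using \<rho>(3) r(2) by (rule subset_trans)
  have d2: "cmod (deriv (deriv g) w) \<le> K * cmod (deriv g v)" if "w \<in> cball v \<rho>" for w
    using M(2)[OF subsetD[OF \<rho>(3) that]] d by (simp add: K_def)
  show ?thesis
  proof (rule that[OF \<rho>(1) _ sub])
    show "cmod (deriv g v) / 2 > 0" using d by simp
  qed (rule univalent_distortion(2)[OF hol \<open>open S\<close> sub \<rho>(1) d2 \<rho>(2)])
qed

section \<open>Logarithmic tracts\<close>

text \<open>\<open>exp \<circ> lam\<close> is an inverse branch of \<open>f\<close> in the coordinate \<open>log f\<close>; assumption \<open>proper\<close> says that the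
  tract reaches no finite boundary point while \<open>\<bar>f\<bar>\<close> stays away from its boundary value.\<close>
locale log_tract =
  fixes f lam :: "complex \<Rightarrow> complex" and a :: real
  assumes hol: "lam holomorphic_on {w. a < Re w}"
    and inj_exp: "inj_on (\<lambda>w. exp (lam w)) {w. a < Re w}"
    and f_exp_lam: "\<And>w. a < Re w \<Longrightarrow> f (exp (lam w)) = exp w"
    and no_pole: "\<And>w. a < Re w \<Longrightarrow> \<not> is_pole f (exp (lam w))"
    and mero: "meromorphic_plane f"
    and proper: "\<And>x M. a < x \<Longrightarrow> bounded {w. x \<le> Re w \<and> Re (lam w) \<le> M}"
begin

abbreviation "H \<equiv> {w. a < Re w}"

text \<open>This is the relative radius of the discs of bounded distortion: with
  \<open>deriv2_bound\<close>, the product required by \<open>univalent_distortion\<close> becomes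
  2/100. The generous 100 also makes \<open>lam\<close> map such a disc into a unit disc, since 3/2
  * 12 pi / 100 < 1.\<close>

definition eta :: real where "eta = 1 / (100 * univalent_const)"

lemma eta: "0 < eta" "eta \<le> 1/100"
  using univalent_const_ge by (auto simp: eta_def divide_simps)

lemma open_H: "open H"
  by (rule open_halfspace_Re_gt)

lemma convex_H: "convex H"
  by (rule convex_halfspace_Re_gt)

lemma inj_lam: "inj_on lam H"
  using inj_exp by (auto simp: inj_on_def)

lemma has_deriv: "a < Re w \<Longrightarrow> (lam has_field_derivative deriv lam w) (at w)"
  using holomorphic_derivI[OF hol open_H] by simp

lemma deriv_nz: "a < Re w \<Longrightarrow> deriv lam w \<noteq> 0"
  using holomorphic_injective_imp_regular[OF hol open_H inj_lam] by simp

lemma cball_subset_H: "\<rho> < Re w - a \<Longrightarrow> cball w \<rho> \<subseteq> H"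
proof
  fix z assume "\<rho> < Re w - a" "z \<in> cball w \<rho>"
  moreover have "Re w - Re z \<le> cmod (w - z)" using complex_Re_le_cmod[of "w - z"] by simp
  ultimately show "z \<in> H" by (simp add: dist_norm)
qed

text \<open>The image of \<open>lam\<close> contains no two points that differ by \<open>2\<pi>\<i>\<close>, hence no disc of radius
  greater than \<open>\<pi>\<close>.\<close>
lemma deriv_upper:
  assumes "a < Re w"
  shows "cmod (deriv lam w) \<le> 12 * pi / (Re w - a)"
proof (rule ccontr)
  define r where "r = Re w - a"
  have r: "r > 0" using assms by (simp add: r_def)
  assume "\<not> cmod (deriv lam w) \<le> 12 * pi / (Re w - a)"
  then have big: "pi < r * cmod (deriv lam w) / 12"
    using r by (simp add: r_def field_simps)
  have sub: "ball w r \<subseteq> H"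
  proof
    fix z assume "z \<in> ball w r"
    moreover have "Re w - Re z \<le> cmod (w - z)" using complex_Re_le_cmod[of "w - z"] by simp
    ultimately show "z \<in> H" by (simp add: dist_norm r_def)
  qed
  obtain b where b: "ball b (r * cmod (deriv lam w) / 12) \<subseteq> lam ` ball w r"
    using Bloch[OF holomorphic_on_subset[OF hol sub] r order_refl] .
  have "b + \<i> * pi \<in> ball b (r * cmod (deriv lam w) / 12)" "b - \<i> * pi \<in> ball b (r * cmod (deriv lam w) / 12)"
    using big by (auto simp: dist_norm norm_mult)
  then have "b + \<i> * pi \<in> lam ` ball w r" "b - \<i> * pi \<in> lam ` ball w r" using b by blast+
  then obtain z1 z2 where z: "z1 \<in> ball w r" "z2 \<in> ball w r" "b + \<i> * pi = lam z1" "b - \<i> * pi = lam z2"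
    by (elim imageE)
  have "lam z1 = lam z2 + 2 * of_real pi * \<i>" unfolding z(3,4)[symmetric] by simp
  then have "exp (lam z1) = exp (lam z2)" by (simp add: exp_add)
  then have "z1 = z2" using inj_exp z(1,2) sub by (meson inj_onD subsetD)
  then have "b + \<i> * pi = b - \<i> * pi" using z(3,4) by simp
  then show False by (simp add: complex_eq_iff)
qed

lemma deriv2_bound:
  assumes "a < Re v" "w \<in> cball v ((Re v - a) / 8)"
  shows "cmod (deriv (deriv lam) w) \<le> 2 * univalent_const * cmod (deriv lam v) / (Re v - a)"
proof -
  have "cmod (deriv (deriv lam) w) \<le> univalent_const * cmod (deriv lam v) / ((Re v - a) / 2)"
    by (rule univalent_deriv2[OF hol open_H inj_lam cball_subset_H])
      (use assms in \<open>auto simp: dist_norm norm_minus_commute\<close>)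
  then show ?thesis by (simp add: field_simps)
qed

lemma
  assumes v: "a < Re v"
  shows deriv_near: "\<And>w. w \<in> cball v (eta * (Re v - a)) \<Longrightarrow> cmod (deriv lam w - deriv lam v) \<le> cmod (deriv lam v) / 2"
    and expand_near: "\<And>p q. p \<in> cball v (eta * (Re v - a)) \<Longrightarrow> q \<in> cball v (eta * (Re v - a)) \<Longrightarrow>
      cmod (deriv lam v) / 2 * dist p q \<le> dist (lam p) (lam q)"
    and lipschitz_near: "\<And>p q. p \<in> cball v (eta * (Re v - a)) \<Longrightarrow> q \<in> cball v (eta * (Re v - a)) \<Longrightarrow>
      dist (lam p) (lam q) \<le> 3/2 * cmod (deriv lam v) * dist p q"
proof -
  let ?\<rho> = "eta * (Re v - a)"
  have "?\<rho> \<le> 1/100 * (Re v - a)" using eta v by (intro mult_right_mono) auto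
  then have small: "?\<rho> < Re v - a" "?\<rho> \<le> (Re v - a) / 8" using v by auto
  have pos: "?\<rho> > 0" using eta v by simp
  have d2: "cmod (deriv (deriv lam) w) \<le> (2 * univalent_const / (Re v - a)) * cmod (deriv lam v)"
    if "w \<in> cball v ?\<rho>" for w
    using deriv2_bound[OF v subsetD[OF subset_cball[OF small(2)] that]] by simp
  have K: "(2 * univalent_const / (Re v - a)) * ?\<rho> \<le> 1/2"
    using univalent_const_ge v by (simp add: eta_def)
  note D = univalent_distortion[OF hol open_H cball_subset_H[OF small(1)] pos d2 K]
  show "\<And>w. w \<in> cball v ?\<rho> \<Longrightarrow> cmod (deriv lam w - deriv lam v) \<le> cmod (deriv lam v) / 2"
    by (rule D(1))
  show "\<And>p q. p \<in> cball v ?\<rho> \<Longrightarrow> q \<in> cball v ?\<rho> \<Longrightarrow> cmod (deriv lam v) / 2 * dist p q \<le> dist (lam p) (lam q)"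
    by (rule D(2))
  show "\<And>p q. p \<in> cball v ?\<rho> \<Longrightarrow> q \<in> cball v ?\<rho> \<Longrightarrow> dist (lam p) (lam q) \<le> 3/2 * cmod (deriv lam v) * dist p q"
    by (rule D(3))
qed

lemma Re_lam_has_deriv:
  assumes "a < t"
  shows "((\<lambda>t. Re (lam (of_real t))) has_real_derivative Re (deriv lam (of_real t))) (at t)"
proof -
  have "((\<lambda>t. lam (of_real t)) has_vector_derivative deriv lam (of_real t)) (at t)"
    using has_deriv[of "of_real t"] assms by (intro has_vector_derivative_real_field) auto
  then have "((\<lambda>t. Re (lam (of_real t))) has_vector_derivative Re (deriv lam (of_real t))) (at t)"
    by (rule bounded_linear.has_vector_derivative[OF bounded_linear_Re])
  then show ?thesis by (simp add: has_real_derivative_iff_has_vector_derivative)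
qed

text \<open>Integrating \<open>deriv_upper\<close> along the real axis limits the growth of
  \<open>Re lam\<close> there to 12 pi log t.\<close>

lemma Re_lam_le_ln:
  assumes "a < s" "s \<le> t"
  shows "Re (lam (of_real t)) - 12 * pi * ln (t - a) \<le> Re (lam (of_real s)) - 12 * pi * ln (s - a)"
proof (rule DERIV_nonpos_imp_nonincreasing[OF assms(2)])
  fix x assume x: "s \<le> x" "x \<le> t"
  have "((\<lambda>t. Re (lam (of_real t)) - 12 * pi * ln (t - a)) has_real_derivative
      Re (deriv lam (of_real x)) - 12 * pi * (1 / (x - a))) (at x)"
    by (rule DERIV_diff[OF Re_lam_has_deriv]) (use assms x in \<open>auto intro!: derivative_eq_intros\<close>)
  moreover have "Re (deriv lam (of_real x)) \<le> 12 * pi * (1 / (x - a))"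
    using deriv_upper[of "of_real x"] complex_Re_le_cmod[of "deriv lam (of_real x)"] assms x by simp
  ultimately show "\<exists>y. ((\<lambda>t. Re (lam (of_real t)) - 12 * pi * ln (t - a)) has_real_derivative y) (at x) \<and> y \<le> 0"
    by (intro exI conjI) auto
qed

text \<open>By \<open>deriv2_bound\<close> the logarithmic derivative of \<open>deriv lam\<close>
  has modulus at most 2 * univalent_const / (Re w - a). Integrating the real part of a holomorphic
  logarithm \<open>h\<close> of \<open>deriv lam\<close> shows that the derivative decays at most
  polynomially.\<close>

lemma deriv_lower:
  assumes "a < s" "s \<le> t"
  shows "cmod (deriv lam (of_real s)) * (s - a) powr (2 * univalent_const)
       \<le> cmod (deriv lam (of_real t)) * (t - a) powr (2 * univalent_const)"
proof -
  let ?C = "2 * univalent_const"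
  obtain h where h: "h holomorphic_on H" "\<And>w. w \<in> H \<Longrightarrow> deriv lam w = exp (h w)"
    using contractible_imp_holomorphic_log[OF holomorphic_deriv[OF hol open_H] convex_imp_contractible[OF convex_H]]
      deriv_nz by (metis mem_Collect_eq)
  have dh: "(h has_field_derivative deriv h w) (at w)" if "a < Re w" for w
    using holomorphic_derivI[OF h(1) open_H] that by simp
  have d2: "deriv (deriv lam) w = deriv lam w * deriv h w" if w: "a < Re w" for w
  proof -
    have "((\<lambda>w. exp (h w)) has_field_derivative exp (h w) * deriv h w) (at w)"
      using dh[OF w] by (auto intro!: derivative_eq_intros)
    then have "(deriv lam has_field_derivative exp (h w) * deriv h w) (at w)"
      by (rule has_field_derivative_transform_within_open[OF _ open_H]) (use h(2) w in auto)
    then show ?thesis using h(2)[of w] w by (simp add: DERIV_imp_deriv)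
  qed
  have bd: "cmod (deriv h w) \<le> ?C / (Re w - a)" if w: "a < Re w" for w
  proof -
    have "cmod (deriv lam w) * cmod (deriv h w) \<le> cmod (deriv lam w) * (?C / (Re w - a))"
      using deriv2_bound[OF w, of w] w d2[OF w] by (simp add: norm_mult mult_ac)
    then show ?thesis by (rule mult_left_le_imp_le) (use deriv_nz[OF w] in simp)
  qed
  have "Re (h (of_real s)) + ?C * ln (s - a) \<le> Re (h (of_real t)) + ?C * ln (t - a)"
  proof (rule DERIV_nonneg_imp_nondecreasing[OF assms(2)])
    fix x assume x: "s \<le> x" "x \<le> t"
    then have ax: "a < x" using assms by simp
    have "((\<lambda>t. h (of_real t)) has_vector_derivative deriv h (of_real x)) (at x)"
      using dh[of "of_real x"] ax by (intro has_vector_derivative_real_field) auto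
    then have "((\<lambda>t. Re (h (of_real t))) has_real_derivative Re (deriv h (of_real x))) (at x)"
      using bounded_linear.has_vector_derivative[OF bounded_linear_Re]
      by (simp add: has_real_derivative_iff_has_vector_derivative)
    then have "((\<lambda>t. Re (h (of_real t)) + ?C * ln (t - a)) has_real_derivative
        Re (deriv h (of_real x)) + ?C * (1 / (x - a))) (at x)"
      by (rule DERIV_add) (use ax in \<open>auto intro!: derivative_eq_intros\<close>)
    moreover have "- Re (deriv h (of_real x)) \<le> ?C * (1 / (x - a))"
      using bd[of "of_real x"] abs_Re_le_cmod[of "deriv h (of_real x)"] ax by simp
    ultimately show "\<exists>y. ((\<lambda>t. Re (h (of_real t)) + ?C * ln (t - a)) has_real_derivative y) (at x) \<and> 0 \<le> y"
      by (intro exI conjI) auto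
  qed
  then have "exp (Re (h (of_real s)) + ?C * ln (s - a)) \<le> exp (Re (h (of_real t)) + ?C * ln (t - a))"
    by simp
  then show ?thesis using h(2)[of "of_real s"] h(2)[of "of_real t"] assms
    by (simp add: exp_add norm_exp_eq_Re powr_def)
qed

lemma Re_lam_at_top: "filterlim (\<lambda>t. Re (lam (of_real t))) at_top at_top"
  unfolding filterlim_at_top
proof
  fix M
  obtain R where R: "\<And>w. a + 1 \<le> Re w \<Longrightarrow> Re (lam w) \<le> M \<Longrightarrow> cmod w \<le> R"
    using proper[of "a + 1" M] unfolding bounded_iff by auto
  show "\<forall>\<^sub>F t in at_top. M \<le> Re (lam (of_real t))"
    using eventually_ge_at_top[of "a + 1"] eventually_gt_at_top[of R]
  proof eventually_elim
    case (elim t)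
    then show ?case using R[of "of_real t"] by (cases "Re (lam (of_real t)) \<le> M") auto
  qed
qed

end

section \<open>Escaping orbits lie in the Julia set\<close>

text \<open>Inverse stereographic projection.\<close>
fun sphere_point :: "complex option \<Rightarrow> complex \<times> real" where
  "sphere_point None = (0, 1)"
| "sphere_point (Some z) =
     (of_real (2 / (1 + (cmod z)\<^sup>2)) * z, ((cmod z)\<^sup>2 - 1) / (1 + (cmod z)\<^sup>2))"

lemma dist_Pair_power2: "(dist (x, s) (y, t))\<^sup>2 = (cmod (x - y))\<^sup>2 + (s - t)\<^sup>2" for s t :: real
  unfolding dist_Pair_Pair by (simp add: dist_norm)

text \<open>As a Euclidean distance between points of the sphere, \<open>chordal\<close> satisfies
  the triangle inequality, which its formula with square roots hides.\<close>

lemma chordal_eq_dist: "chordal x y = dist (sphere_point x) (sphere_point y)"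
proof -
  have none: "chordal (Some z) None = dist (sphere_point (Some z)) (sphere_point None)" for z
  proof -
    define A where "A = (cmod z)\<^sup>2"
    have A: "A \<ge> 0" by (simp add: A_def)
    have "(dist (sphere_point (Some z)) (sphere_point None))\<^sup>2
        = (cmod (of_real (2 / (1 + A)) * z))\<^sup>2 + ((A - 1) / (1 + A) - 1)\<^sup>2"
      unfolding sphere_point.simps dist_Pair_power2 A_def diff_zero ..
    also have "(cmod (of_real (2 / (1 + A)) * z))\<^sup>2 = 4 * A / (1 + A)\<^sup>2"
      unfolding norm_mult norm_of_real power_mult_distrib power2_abs by (simp add: A_def power_divide)
    also have "4 * A / (1 + A)\<^sup>2 + ((A - 1) / (1 + A) - 1)\<^sup>2 = 4 / (1 + A)"
    proof -
      \<comment> \<open>Naming the inverse turns the claim into a polynomial identity modulo (1 + A)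
        p = 1.\<close>
      define p where "p = inverse (1 + A)"
      have p: "(1 + A) * p = 1" using A by (simp add: p_def)
      have inv: "inverse ((1 + A)\<^sup>2) = p\<^sup>2" by (simp add: p_def power_inverse)
      show ?thesis unfolding divide_inverse inv p_def[symmetric] using p by algebra
    qed
    also have "\<dots> = (chordal (Some z) None)\<^sup>2" using A by (simp add: power_divide A_def)
    finally show ?thesis
      by (simp add: power2_eq_iff_nonneg)
  qed
  have some: "chordal (Some a) (Some b) = dist (sphere_point (Some a)) (sphere_point (Some b))" for a b
  proof -
    define A B where "A = (cmod a)\<^sup>2" and "B = (cmod b)\<^sup>2"
    have AB: "A \<ge> 0" "B \<ge> 0" by (simp_all add: A_def B_def)
    define P where "P = Re a * Re b + Im a * Im b"
    have Ae: "A = (Re a)\<^sup>2 + (Im a)\<^sup>2" and Be: "B = (Re b)\<^sup>2 + (Im b)\<^sup>2"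
      by (simp_all add: A_def B_def cmod_power2)
    have 1: "(cmod (a - b))\<^sup>2 = A + B - 2 * P"
      unfolding cmod_power2 Ae Be P_def by (simp add: power2_eq_square algebra_simps)
    have gen: "(cmod (of_real p * a - of_real q * b))\<^sup>2 = p\<^sup>2 * A + q\<^sup>2 * B - 2 * p * q * P" for p q
      unfolding cmod_power2 Ae Be P_def by (simp add: power2_eq_square algebra_simps)
    have "(dist (sphere_point (Some a)) (sphere_point (Some b)))\<^sup>2
        = (cmod (of_real (2 / (1 + A)) * a - of_real (2 / (1 + B)) * b))\<^sup>2
          + ((A - 1) / (1 + A) - (B - 1) / (1 + B))\<^sup>2"
      unfolding sphere_point.simps dist_Pair_power2 A_def B_def ..
    also have "\<dots> = 4 * (A + B - 2 * P) / ((1 + A) * (1 + B))"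
    proof -
      define x y where "x = 1 + A" and "y = 1 + B"
      have xy: "x > 0" "y > 0" "A = x - 1" "B = y - 1" using AB by (simp_all add: x_def y_def)
      define p q where "p = inverse x" and "q = inverse y"
      have pq: "x * p = 1" "y * q = 1" using xy(1,2) by (simp_all add: p_def q_def)
      have inv: "inverse (x * y) = p * q"
        by (simp add: p_def q_def)
      show ?thesis
        unfolding gen unfolding x_def[symmetric] y_def[symmetric] divide_inverse inv p_def[symmetric] q_def[symmetric]
        unfolding xy(3,4) using pq by algebra
    qed
    also have "\<dots> = (chordal (Some a) (Some b))\<^sup>2"
      using AB by (simp add: power_divide power_mult_distrib 1 A_def[symmetric] B_def[symmetric])
    finally show ?thesis by (simp add: power2_eq_iff_nonneg)
  qed
  show ?thesis
  proof (cases x; cases y)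
    fix b assume "x = None" "y = Some b"
    then show ?thesis using none[of b] by (simp only: dist_commute chordal.simps)
  qed (simp_all only: none some chordal.simps dist_self)
qed

lemma chordal_triangle: "chordal x z \<le> chordal x y + chordal y z"
  unfolding chordal_eq_dist by (rule dist_triangle)

lemma chordal_commute: "chordal x y = chordal y x"
  unfolding chordal_eq_dist by (rule dist_commute)

text \<open>A logarithm of \<open>G\<close> maps the disc into the right half-plane, so the
  Schwarz-Pick inequality bounds its derivative by a multiple of its real part, which at the centre
  is ln |G z|.\<close>

lemma deriv_bound_outside_unit_disc:
  fixes G :: "complex \<Rightarrow> complex"
  assumes hol: "G holomorphic_on ball z \<rho>" and "\<rho> > 0" and big: "\<And>w. w \<in> ball z \<rho> \<Longrightarrow> 1 < cmod (G w)"
  shows "cmod (deriv G z) \<le> 8 * cmod (G z) * ln (cmod (G z)) / \<rho>"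
proof -
  have "G w \<noteq> 0" if "w \<in> ball z \<rho>" for w using big[OF that] by auto
  then obtain h where h: "h holomorphic_on ball z \<rho>" "\<And>w. w \<in> ball z \<rho> \<Longrightarrow> G w = exp (h w)"
    using contractible_imp_holomorphic_log[OF hol] convex_imp_contractible[OF convex_ball] by metis
  have z: "z \<in> ball z \<rho>" using \<open>\<rho> > 0\<close> by simp
  have Re_h: "Re (h w) > 0" if "w \<in> ball z \<rho>" for w
    using big[OF that] h(2)[OF that] by simp
  define R where "R = Re (h z)"
  have R: "R > 0" "R = ln (cmod (G z))"
    using Re_h[OF z] h(2)[OF z] by (simp_all add: R_def)
  \<comment> \<open>A Moebius map bounded on the half-plane: |k| is at most 1 / R since both
    summands have nonnegative real part and the second contributes R. Cauchy's estimate for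
    \<open>k\<close> then replaces the sharp Schwarz-Pick constant 2 by 8.\<close>
  define k where "k = (\<lambda>w. 1 / (h w + cnj (h z)))"
  have Re_ge: "R \<le> cmod (h w + cnj (h z))" if "w \<in> ball z \<rho>" for w
  proof -
    have "R \<le> Re (h w + cnj (h z))" using Re_h[OF that] by (simp add: R_def)
    also have "\<dots> \<le> cmod (h w + cnj (h z))" by (rule complex_Re_le_cmod)
    finally show ?thesis .
  qed
  then have nz: "h w + cnj (h z) \<noteq> 0" if "w \<in> ball z \<rho>" for w
    using that R(1) by fastforce
  have holk: "k holomorphic_on ball z \<rho>"
    unfolding k_def using h(1) nz by (intro holomorphic_intros) auto
  have sub: "cball z (\<rho> / 2) \<subseteq> ball z \<rho>" using \<open>\<rho> > 0\<close> by auto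
  have "cmod ((deriv ^^ 1) k z) \<le> fact 1 * (1 / R) / (\<rho> / 2) ^ 1"
  proof (rule Cauchy_inequality)
    show "k holomorphic_on ball z (\<rho> / 2)" by (rule holomorphic_on_subset[OF holk]) (use sub in auto)
    show "continuous_on (cball z (\<rho> / 2)) k"
      by (rule holomorphic_on_imp_continuous_on[OF holomorphic_on_subset[OF holk sub]])
    fix x assume "cmod (z - x) = \<rho> / 2"
    then have "x \<in> ball z \<rho>" using \<open>\<rho> > 0\<close> by (simp add: dist_norm)
    then have "R \<le> cmod (h x + cnj (h z))" by (rule Re_ge)
    then show "cmod (k x) \<le> 1 / R" using R(1) unfolding k_def norm_divide norm_one
      by (intro divide_left_mono mult_pos_pos) auto
  qed (use \<open>\<rho> > 0\<close> in simp)
  moreover have "deriv k z = - deriv h z / (2 * of_real R)\<^sup>2"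
  proof -
    have "(h has_field_derivative deriv h z) (at z)"
      using holomorphic_derivI[OF h(1) open_ball z] .
    then have "(k has_field_derivative - deriv h z / (h z + cnj (h z))\<^sup>2) (at z)"
      unfolding k_def using nz[OF z]
      by (auto intro!: derivative_eq_intros simp: power2_eq_square)
    moreover have "h z + cnj (h z) = 2 * of_real R" by (simp add: R_def complex_eq_iff)
    ultimately show ?thesis by (simp add: DERIV_imp_deriv)
  qed
  ultimately have "cmod (deriv h z) / (2 * R)\<^sup>2 \<le> 2 / (R * \<rho>)"
    using R(1) by (simp add: norm_divide norm_mult norm_power)
  then have dh: "cmod (deriv h z) \<le> 8 * R / \<rho>"
    using R(1) \<open>\<rho> > 0\<close> by (simp add: field_simps power2_eq_square)
  have "(h has_field_derivative deriv h z) (at z)"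
    using holomorphic_derivI[OF h(1) open_ball z] .
  then have "((\<lambda>w. exp (h w)) has_field_derivative exp (h z) * deriv h z) (at z)"
    by (auto intro!: derivative_eq_intros)
  then have "(G has_field_derivative exp (h z) * deriv h z) (at z)"
    by (rule has_field_derivative_transform_within_open[OF _ open_ball z]) (use h(2) in simp)
  then have "deriv G z = G z * deriv h z" using h(2)[OF z] by (simp add: DERIV_imp_deriv)
  then have "cmod (deriv G z) = cmod (G z) * cmod (deriv h z)" by (simp add: norm_mult)
  also have "\<dots> \<le> cmod (G z) * (8 * R / \<rho>)" by (rule mult_left_mono[OF dh]) simp
  also have "\<dots> = 8 * cmod (G z) * ln (cmod (G z)) / \<rho>" by (simp add: R(2))
  finally show ?thesis .
qed

section \<open>Iterates and their derivatives along an orbit in the tract\<close>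

lemma iter_Suc: "iter f (Suc n) z = fext f (iter f n z)"
  by (simp add: iter_def)

lemma meromorphic_plane_analytic:
  assumes "meromorphic_plane f" "\<not> is_pole f z"
  shows "f analytic_on {z}"
proof -
  have "isCont f z" "f meromorphic_on {z}"
    using assms meromorphic_on_subset[of f UNIV "{z}"] by (auto simp: meromorphic_plane_def)
  then show ?thesis using meromorphic_at_isCont_imp_analytic by blast
qed

lemma iter_holomorphic:
  assumes f: "meromorphic_plane f" and U: "\<And>n w. w \<in> U \<Longrightarrow> iter f n w \<noteq> None"
  shows "(\<lambda>w. the (iter f n w)) holomorphic_on U"
proof (induction n)
  case 0
  show ?case by (simp add: iter_def)
next
  case (Suc n)
  have np: "\<not> is_pole f (the (iter f n w)) \<and> the (iter f (Suc n) w) = f (the (iter f n w))" if "w \<in> U" for w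
    using U[OF that, of n] U[OF that, of "Suc n"]
    by (auto simp: iter_Suc fext_def split: option.splits if_splits)
  have "f holomorphic_on {z. \<not> is_pole f z}"
    using meromorphic_plane_analytic[OF f]
    by (intro analytic_imp_holomorphic) (subst analytic_on_analytic_at, auto)
  then have "f \<circ> (\<lambda>w. the (iter f n w)) holomorphic_on U"
    using Suc.IH np by (intro holomorphic_on_compose_gen) auto
  then show ?case
    by (rule holomorphic_transform) (use np in simp)
qed

context log_tract
begin

text \<open>\<open>u n\<close> is a logarithm of the \<open>n\<close>-th iterate of \<open>exp (u 0)\<close>.\<close>
definition orbit :: "(nat \<Rightarrow> complex) \<Rightarrow> bool" where
  "orbit u \<longleftrightarrow> (\<forall>n. a < Re (u (Suc n)) \<and> exp (lam (u (Suc n))) = exp (u n)) \<and>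
     filterlim (\<lambda>n. Re (u n)) at_top sequentially"

text \<open>The half-plane condition starts at index 1, so \<open>u 0\<close> matters only through
  its exponential. This allows \<open>lam w\<close> to be prepended to an orbit even when it lies
  outside the half-plane, and every orbit to be shifted by multiples of 2 pi i.\<close>

definition L :: "complex set" where
  "L = {w. \<exists>u. orbit u \<and> u 0 = w}"

lemma iter_orbit:
  assumes "orbit u"
  shows "iter f n (exp (u 0)) = Some (exp (u n))"
proof (induction n)
  case 0
  then show ?case by (simp add: iter_def)
next
  case (Suc n)
  have u: "a < Re (u (Suc n))" "exp (lam (u (Suc n))) = exp (u n)"
    using assms by (auto simp: orbit_def)
  have "\<not> is_pole f (exp (u n))" "f (exp (u n)) = exp (u (Suc n))"
    using no_pole[OF u(1)] f_exp_lam[OF u(1)] u(2) by auto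
  then show ?case using Suc by (simp add: iter_Suc fext_def)
qed

lemma orbit_escaping:
  assumes "orbit u"
  shows "exp (u 0) \<in> escaping f"
proof -
  have "filterlim (\<lambda>n. exp (Re (u n))) at_top sequentially"
    using assms filterlim_compose[OF exp_at_top] by (auto simp: orbit_def)
  then have "filterlim (\<lambda>n. exp (u n)) at_infinity sequentially"
    by (simp add: filterlim_at_infinity_conv_norm_at_top)
  then show ?thesis by (simp add: escaping_def iter_orbit[OF assms])
qed

text \<open>Differentiating \<open>f (exp (lam w)) = exp w\<close> at w = \<open>u (Suc n)\<close>
  gives the derivative of \<open>f\<close> at \<open>exp (u n)\<close> as exp w / (exp (u n) * deriv
  lam w). In the chain rule the exponentials telescope.\<close>

lemma deriv_along_orbit:
  assumes u: "orbit u" and "open U" and zU: "exp (u 0) \<in> U" and U: "\<And>n w. w \<in> U \<Longrightarrow> iter f n w \<noteq> None"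
  shows "((\<lambda>w. the (iter f n w)) has_field_derivative
     exp (u n) / (exp (u 0) * (\<Prod>k<n. deriv lam (u (Suc k))))) (at (exp (u 0)))"
proof (induction n)
  case 0
  show ?case by (simp add: iter_def)
next
  case (Suc n)
  define w where "w = u (Suc n)"
  have w: "a < Re w" "exp (lam w) = exp (u n)"
    using u by (auto simp: orbit_def w_def)
  have np: "\<not> is_pole f (exp (u n))" using no_pole[OF w(1)] w(2) by simp
  then have "f field_differentiable at (exp (u n))"
    using meromorphic_plane_analytic[OF mero] analytic_on_imp_differentiable_at by blast
  then have df: "(f has_field_derivative deriv f (exp (u n))) (at (exp (u n)))"
    by (rule field_differentiable_derivI)
  have "((\<lambda>w. exp (lam w)) has_field_derivative exp (lam w) * deriv lam w) (at w)"
    using has_deriv[OF w(1)] by (auto intro!: derivative_eq_intros)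
  then have "((\<lambda>w. f (exp (lam w))) has_field_derivative deriv f (exp (u n)) * (exp (lam w) * deriv lam w)) (at w)"
    using DERIV_chain2[of f "deriv f (exp (u n))" "\<lambda>w. exp (lam w)" w "exp (lam w) * deriv lam w" UNIV] df w(2)
    by simp
  moreover have "((\<lambda>w. f (exp (lam w))) has_field_derivative exp w) (at w)"
    by (rule has_field_derivative_transform_within_open[OF DERIV_exp open_H]) (use w(1) f_exp_lam in auto)
  ultimately have "deriv f (exp (u n)) * (exp (u n) * deriv lam w) = exp w"
    using w(2) DERIV_unique by force
  then have eq: "deriv f (exp (u n)) = exp w / (exp (u n) * deriv lam w)"
    using deriv_nz[OF w(1)] by (simp add: field_simps)
  have it: "the (iter f n (exp (u 0))) = exp (u n)" using iter_orbit[OF u] by simp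
  have step: "the (iter f (Suc n) x) = f (the (iter f n x))" if "x \<in> U" for x
    using U[OF that, of n] U[OF that, of "Suc n"]
    by (auto simp: iter_Suc fext_def split: option.splits if_splits)
  have "((\<lambda>x. f (the (iter f n x))) has_field_derivative
      deriv f (exp (u n)) * (exp (u n) / (exp (u 0) * (\<Prod>k<n. deriv lam (u (Suc k)))))) (at (exp (u 0)))"
    by (rule DERIV_chain2[OF _ Suc.IH]) (use df it in simp)
  then have "((\<lambda>x. the (iter f (Suc n) x)) has_field_derivative
      deriv f (exp (u n)) * (exp (u n) / (exp (u 0) * (\<Prod>k<n. deriv lam (u (Suc k)))))) (at (exp (u 0)))"
    by (rule has_field_derivative_transform_within_open[OF _ \<open>open U\<close> zU]) (use step in simp)
  then show ?case unfolding eq by (simp add: w_def field_simps)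
qed

text \<open>If the iterates formed a normal family near \<open>exp (u 0)\<close>, they would all be large there and
  Schwarz--Pick would contradict the growth of their derivatives along the orbit.\<close>
lemma orbit_julia:
  assumes u: "orbit u"
  shows "exp (u 0) \<in> julia f"
proof (rule ccontr)
  let ?z = "exp (u 0)"
  let ?G = "\<lambda>n w. the (iter f n w)"
  define P where "P = (\<lambda>n. \<Prod>k<n. cmod (deriv lam (u (Suc k))))"
  have ua: "a < Re (u (Suc n))" for n using u by (simp add: orbit_def)
  have uinf: "filterlim (\<lambda>n. Re (u n)) at_top sequentially" using u by (simp add: orbit_def)
  have Ppos: "P n > 0" for n
    unfolding P_def using deriv_nz[OF ua] by (intro prod_pos) auto
  assume "?z \<notin> julia f"
  then have "?z \<in> fatou f" by (simp add: julia_def)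
  then obtain U where U: "open U" "?z \<in> U" "\<And>n w. w \<in> U \<Longrightarrow> iter f n w \<noteq> None" "normal_seq U (iter f)"
    by (auto simp: fatou_def)
  obtain s g where s: "strict_mono s" and
    conv: "\<And>K. compact K \<Longrightarrow> K \<subseteq> U \<Longrightarrow> \<forall>e>0. \<forall>\<^sub>F n in sequentially. \<forall>w\<in>K. chordal (iter f (s n) w) (g w) < e"
  proof -
    have "\<exists>s g. strict_mono s \<and> (\<forall>K. compact K \<and> K \<subseteq> U \<longrightarrow>
      (\<forall>e>0. \<forall>\<^sub>F n in sequentially. \<forall>w\<in>K. chordal (iter f (id (s n)) w) (g w) < e))"
      by (rule U(4)[unfolded normal_seq_def, THEN spec, THEN mp, OF strict_mono_id])
    then obtain s g where sg: "strict_mono s" "\<forall>K. compact K \<and> K \<subseteq> U \<longrightarrow>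
      (\<forall>e>0. \<forall>\<^sub>F n in sequentially. \<forall>w\<in>K. chordal (iter f (s n) w) (g w) < e)"
      unfolding id_apply by (elim exE conjE)
    show ?thesis by (rule that[OF sg(1) sg(2)[THEN spec, THEN mp, OF conjI]])
  qed
  obtain r where r: "r > 0" "cball ?z r \<subseteq> U"
    using U(1,2) open_contains_cball by blast
  have sinf: "filterlim s at_top sequentially" using s by (rule filterlim_subseq)
  have hol: "?G n holomorphic_on U" for n
    by (rule iter_holomorphic[OF mero U(3)])
  have some: "iter f n w = Some (?G n w)" if "w \<in> U" for n w using U(3)[OF that] by simp
  have G0: "?G n ?z = exp (u n)" for n using iter_orbit[OF u] by simp
  have "\<forall>\<^sub>F n in sequentially. \<forall>w\<in>cball ?z r. chordal (iter f (s n) w) (g w) < 1/4"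
    by (rule conv[OF compact_cball r(2), THEN spec, THEN mp]) simp
  \<comment> \<open>The limit \<open>g\<close> serves only for comparison: beyond \<open>N\<close>
    every iterate along \<open>s\<close> is within 1/4 + 1/4 of the iterate with index
    \<open>s N\<close>, which near \<open>?z\<close> is within 1/4 of infinity. A total below 3/4
    excludes modulus at most 1, where the chordal distance to infinity is at least 1.\<close>
  then obtain N1 where N1: "\<And>n w. N1 \<le> n \<Longrightarrow> w \<in> cball ?z r \<Longrightarrow> chordal (iter f (s n) w) (g w) < 1/4"
    unfolding eventually_sequentially by blast
  have "\<forall>\<^sub>F n in sequentially. 3 \<le> Re (u (s n))"
    using filterlim_compose[OF uinf sinf] unfolding filterlim_at_top by blast
  then obtain N2 where N2: "\<And>n. N2 \<le> n \<Longrightarrow> 3 \<le> Re (u (s n))"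
    unfolding eventually_sequentially by blast
  define N where "N = max N1 N2"
  have "8 < exp (3::real)"
    using exp_lower_Taylor_quadratic[of "3::real"] by simp
  then have "8 < exp (Re (u (s N)))" using N2[of N] by (smt (verit) N_def exp_le_cancel_iff max.cobounded2)
  then have "8 < cmod (?G (s N) ?z)" by (simp add: G0)
  moreover have "continuous_on U (\<lambda>w. cmod (?G (s N) w))"
    using hol by (intro continuous_intros holomorphic_on_imp_continuous_on)
  then have "open (U \<inter> (\<lambda>w. cmod (?G (s N) w)) -` {8<..})"
    using U(1) by (rule continuous_open_preimage) simp
  moreover have "U \<inter> (\<lambda>w. cmod (?G (s N) w)) -` {8<..} = {w \<in> U. 8 < cmod (?G (s N) w)}"
    by auto
  ultimately obtain \<rho>0 where \<rho>0: "\<rho>0 > 0" "ball ?z \<rho>0 \<subseteq> {w \<in> U. 8 < cmod (?G (s N) w)}"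
    using U(2) unfolding open_contains_ball by blast
  define \<rho> where "\<rho> = min \<rho>0 r"
  have \<rho>: "\<rho> > 0" using \<rho>0 r by (simp add: \<rho>_def)
  have big: "1 < cmod (?G (s n) w)" if n: "N \<le> n" and w: "w \<in> ball ?z \<rho>" for n w
  proof -
    have w1: "w \<in> cball ?z r" "w \<in> U" "8 < cmod (?G (s N) w)"
      using w r(2) \<rho>0(2) by (auto simp: \<rho>_def)
    have "chordal (iter f (s N) w) None = 2 / sqrt (1 + (cmod (?G (s N) w))\<^sup>2)"
      by (subst some[OF w1(2)]) simp
    also have "\<dots> \<le> 2 / 8"
    proof (rule divide_left_mono)
      have "8 \<le> sqrt ((cmod (?G (s N) w))\<^sup>2)" using w1(3) by simp
      also have "\<dots> \<le> sqrt (1 + (cmod (?G (s N) w))\<^sup>2)" by (intro real_sqrt_le_mono) simp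
      finally show "8 \<le> sqrt (1 + (cmod (?G (s N) w))\<^sup>2)" .
      then show "0 < sqrt (1 + (cmod (?G (s N) w))\<^sup>2) * 8" by linarith
    qed simp
    finally have c1: "chordal (iter f (s N) w) None \<le> 1/4" by simp
    have c2: "chordal (g w) (iter f (s N) w) < 1/4"
      using N1[of N w] w1(1) by (simp add: N_def chordal_commute)
    have c3: "chordal (iter f (s n) w) (g w) < 1/4" using N1[of n w] n w1(1) by (simp add: N_def)
    have "chordal (iter f (s n) w) None \<le> chordal (iter f (s n) w) (g w) + (chordal (g w) (iter f (s N) w) + chordal (iter f (s N) w) None)"
      using chordal_triangle[of "iter f (s n) w" None "g w"] chordal_triangle[of "g w" None "iter f (s N) w"] by linarith
    then have "chordal (iter f (s n) w) None < 3/4" using c1 c2 c3 by linarith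
    moreover have "chordal (iter f (s n) w) None = 2 / sqrt (1 + (cmod (?G (s n) w))\<^sup>2)"
      by (subst some[OF w1(2)]) simp
    ultimately have c4: "2 / sqrt (1 + (cmod (?G (s n) w))\<^sup>2) < 3/4" by simp
    show ?thesis
    proof (rule ccontr)
      assume "\<not> 1 < cmod (?G (s n) w)"
      then have "(cmod (?G (s n) w))\<^sup>2 \<le> 1" by (simp add: power_le_one)
      then have "sqrt (1 + (cmod (?G (s n) w))\<^sup>2) \<le> sqrt 4" by (intro real_sqrt_le_mono) simp
      then have "2 / 2 \<le> 2 / sqrt (1 + (cmod (?G (s n) w))\<^sup>2)"
        by (intro divide_left_mono) (auto intro: add_pos_nonneg)
      with c4 show False by simp
    qed
  qed
  \<comment> \<open>The logarithm in the Schwarz-Pick bound equals \<open>Re (u m)\<close>. The last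
    factor of the product \<open>P m\<close> is at most 36 pi / Re (u m) and absorbs it. What
    remains is 1 \<le> \<open>D * P (m - 1)\<close>, impossible for large m because \<open>P\<close>
    tends to 0.\<close>
  define D where "D = 24 * 12 * pi * cmod ?z / \<rho>"
  have D: "D > 0" using \<rho> by (simp add: D_def)
  have key: "1 \<le> D * P (s n - 1)" if n: "N \<le> n" and sn: "s n \<ge> 1" and Re: "Re (u (s n)) \<ge> 2 * \<bar>a\<bar>" for n
  proof -
    define m where "m = s n"
    obtain m' where m': "m = Suc m'" using sn by (cases m) (auto simp: m_def)
    have sub: "ball ?z \<rho> \<subseteq> U" using r(2) by (auto simp: \<rho>_def)
    have Re3: "3 \<le> Re (u m)" using N2[of n] n by (simp add: N_def m_def)
    have "cmod (deriv (?G m) ?z) \<le> 8 * cmod (?G m ?z) * ln (cmod (?G m ?z)) / \<rho>"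
      by (rule deriv_bound_outside_unit_disc[OF holomorphic_on_subset[OF hol sub] \<rho>])
        (use big[OF n] in \<open>simp add: m_def\<close>)
    also have "\<dots> = 8 * exp (Re (u m)) * Re (u m) / \<rho>" by (simp add: G0)
    also have "cmod (deriv (?G m) ?z) = exp (Re (u m)) / (cmod ?z * P m)"
      using DERIV_imp_deriv[OF deriv_along_orbit[OF u U(1,2,3), of m]]
      by (simp add: norm_divide norm_mult P_def prod_norm)
    finally have "exp (Re (u m)) * 1 \<le> exp (Re (u m)) * (8 * Re (u m) / \<rho> * (cmod ?z * P m))"
      using Ppos[of m] by (simp add: divide_le_eq mult_ac)
    then have 1: "1 \<le> 8 * Re (u m) / \<rho> * (cmod ?z * P m)"
      by (rule mult_left_le_imp_le) simp
    have "P m = P m' * cmod (deriv lam (u m))" by (simp add: P_def m')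
    also have "\<dots> \<le> P m' * (12 * pi / (Re (u m) - a))"
      using deriv_upper[OF ua[of m']] Ppos[of m'] by (intro mult_left_mono) (auto simp: m')
    also have "\<dots> \<le> P m' * (12 * pi / (Re (u m) / 3))"
    proof (intro mult_left_mono divide_left_mono)
      show "Re (u m) / 3 \<le> Re (u m) - a" using Re Re3 by (simp add: m_def)
      show "0 < (Re (u m) - a) * (Re (u m) / 3)" using ua[of m'] Re3 by (simp add: m')
    qed (use Ppos[of m'] in auto)
    finally have 2: "P m \<le> P m' * (12 * pi / (Re (u m) / 3))" .
    have "8 * Re (u m) / \<rho> * (cmod ?z * P m) \<le> 8 * Re (u m) / \<rho> * (cmod ?z * (P m' * (12 * pi / (Re (u m) / 3))))"
      using 2 Re3 \<rho> by (intro mult_left_mono) auto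
    also have "\<dots> = D * P m'" using Re3 \<rho> by (simp add: D_def)
    finally show ?thesis using 1 by (simp add: m_def[symmetric] m')
  qed
  have "P \<longlonglongrightarrow> 0"
  proof -
    have "\<forall>\<^sub>F n in sequentially. 24 * pi + a \<le> Re (u n)"
      using uinf unfolding filterlim_at_top by blast
    then obtain n0 where n0: "\<And>n. n0 \<le> n \<Longrightarrow> 24 * pi + a \<le> Re (u n)"
      unfolding eventually_sequentially by blast
    have "summable P"
    proof (rule summable_ratio_test)
      fix n assume "n0 \<le> n"
      then have "24 * pi \<le> Re (u (Suc n)) - a" using n0[of "Suc n"] by simp
      then have "12 * pi / (Re (u (Suc n)) - a) \<le> 12 * pi / (24 * pi)"
        using ua[of n] by (intro divide_left_mono) auto
      then have "cmod (deriv lam (u (Suc n))) \<le> 1/2"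
        using deriv_upper[OF ua[of n]] by simp
      then have "P n * cmod (deriv lam (u (Suc n))) \<le> P n * (1/2)"
        using Ppos[of n] by (intro mult_left_mono) auto
      then show "norm (P (Suc n)) \<le> 1/2 * norm (P n)"
        using Ppos[of n] Ppos[of "Suc n"] by (simp add: P_def)
    qed simp
    then show ?thesis by (rule summable_LIMSEQ_zero)
  qed
  moreover have "filterlim (\<lambda>n. s n - 1) at_top sequentially"
    using filterlim_compose[OF filterlim_minus_const_nat_at_top sinf] .
  ultimately have "(\<lambda>n. P (s n - 1)) \<longlonglongrightarrow> 0"
    by (rule filterlim_compose)
  then have "(\<lambda>n. D * P (s n - 1)) \<longlonglongrightarrow> D * 0"
    by (rule tendsto_mult_left)
  then have "\<forall>\<^sub>F n in sequentially. D * P (s n - 1) < 1"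
    by (rule order_tendstoD) simp
  moreover have "\<forall>\<^sub>F n in sequentially. 2 * \<bar>a\<bar> \<le> Re (u (s n))"
    using filterlim_compose[OF uinf sinf] unfolding filterlim_at_top by blast
  moreover have "\<forall>\<^sub>F n in sequentially. 1 \<le> s n"
    using sinf unfolding filterlim_at_top by blast
  ultimately have "\<forall>\<^sub>F n in sequentially. False"
    using eventually_ge_at_top[of N]
  proof eventually_elim
    case (elim n)
    then show False using key[of n] by simp
  qed
  then show False by simp
qed

end

section \<open>Dimension of the escaping set in a tract\<close>

lemma im_shift: "\<exists>k::int. \<bar>Im (v - 2 * of_real pi * \<i> * of_int k)\<bar> \<le> pi"
proof
  have "\<bar>Im v / (2 * pi) - of_int (round (Im v / (2 * pi)))\<bar> \<le> 1 / 2"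
    by (metis abs_minus_commute of_int_round_abs_le)
  then have "2 * pi * \<bar>Im v / (2 * pi) - of_int (round (Im v / (2 * pi)))\<bar> \<le> 2 * pi * (1 / 2)"
    by (intro mult_left_mono) auto
  also have "2 * pi * \<bar>Im v / (2 * pi) - of_int (round (Im v / (2 * pi)))\<bar>
      = \<bar>2 * pi * (Im v / (2 * pi) - of_int (round (Im v / (2 * pi))))\<bar>"
    by (simp add: abs_mult)
  finally show "\<bar>Im (v - 2 * of_real pi * \<i> * of_int (round (Im v / (2 * pi))))\<bar> \<le> pi"
    by (simp add: algebra_simps)
qed

lemma exp_shift: "exp (v + 2 * of_real pi * \<i> * of_int k) = exp v"
  using exp_eq[of "v + 2 * of_real pi * \<i> * of_int k" v] by (auto simp: algebra_simps intro!: exI[of _ k])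

context log_tract
begin

section \<open>Invariance of \<open>L\<close>\<close>

lemma L_exp_cong:
  assumes "w \<in> L" "exp w' = exp w"
  shows "w' \<in> L"
proof -
  obtain u where u: "orbit u" "u 0 = w" using assms(1) by (auto simp: L_def)
  define u' where "u' = case_nat w' (\<lambda>n. u (Suc n))"
  have "a < Re (u' (Suc n)) \<and> exp (lam (u' (Suc n))) = exp (u' n)" for n
    using u assms(2) by (cases n) (auto simp: u'_def orbit_def)
  moreover have "filterlim (\<lambda>n. Re (u' (Suc n))) at_top sequentially"
    using u(1) by (simp add: u'_def orbit_def filterlim_sequentially_Suc[of "\<lambda>n. Re (u n)"])
  then have "filterlim (\<lambda>n. Re (u' n)) at_top sequentially"
    by (rule filterlim_sequentially_Suc[THEN iffD1])
  ultimately have "orbit u'" by (simp add: orbit_def)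
  then show ?thesis by (auto simp: L_def u'_def)
qed

lemma L_shift: "w \<in> L \<Longrightarrow> w + 2 * of_real pi * \<i> * of_int k \<in> L"
  using L_exp_cong exp_shift by blast

lemma L_lam:
  assumes "w \<in> L" "a < Re w"
  shows "lam w \<in> L"
proof -
  obtain u where u: "orbit u" "u 0 = w" using assms(1) by (auto simp: L_def)
  define u' where "u' = case_nat (lam w) u"
  have "a < Re (u' (Suc n)) \<and> exp (lam (u' (Suc n))) = exp (u' n)" for n
    using u assms(2) by (cases n) (auto simp: u'_def orbit_def)
  moreover have "filterlim (\<lambda>n. Re (u' (Suc n))) at_top sequentially"
    using u(1) by (simp add: u'_def orbit_def)
  then have "filterlim (\<lambda>n. Re (u' n)) at_top sequentially"
    by (rule filterlim_sequentially_Suc[THEN iffD1])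
  ultimately have "orbit u'" by (simp add: orbit_def)
  then show ?thesis by (auto simp: L_def u'_def)
qed

lemma orbit_in_L:
  assumes "orbit u"
  shows "u n \<in> L"
proof -
  have "filterlim (\<lambda>m. m + n) at_top sequentially" by (rule filterlim_add_const_nat_at_top)
  then have "orbit (\<lambda>m. u (m + n))"
    using assms filterlim_compose[of "\<lambda>n. Re (u n)" at_top sequentially "\<lambda>m. m + n"]
    by (auto simp: orbit_def)
  then show ?thesis by (auto simp: L_def)
qed

lemma far_right:
  obtains X where "X > a" "X \<ge> 1" "\<And>w. X \<le> Re w \<Longrightarrow> 20 \<le> eta * (Re w - a)"
    "\<And>w. X \<le> Re w \<Longrightarrow> cmod (deriv lam w) \<le> 1/8"
proof
  \<comment> \<open>20 exceeds all radii, such as 2 pi and 7, of the discs on which bounded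
    distortion is used later. The bound 1/8, from 12 pi / (96 pi), makes \<open>lam\<close> contract
    such discs by 3/2 * 1/8 < 1/2.\<close>
  define X where "X = \<bar>a\<bar> + 20 / eta + 96 * pi + 1"
  have "20 / eta > 0" using eta by simp
  then show X: "X > a" "X \<ge> 1" using pi_gt_zero unfolding X_def by linarith+
  fix w assume w: "X \<le> Re w"
  have "20 / eta \<le> Re w - a" using w pi_gt_zero unfolding X_def by linarith
  then show "20 \<le> eta * (Re w - a)" using eta by (simp add: field_simps)
  have "96 * pi \<le> Re w - a" using w \<open>20 / eta > 0\<close> unfolding X_def by linarith
  have "12 * pi / (Re w - a) \<le> 12 * pi / (96 * pi)"
    using \<open>96 * pi \<le> Re w - a\<close> by (intro divide_left_mono mult_pos_pos) (use pi_gt_zero in linarith)+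
  also have "\<dots> = 1/8" by simp
  finally show "cmod (deriv lam w) \<le> 1/8"
    using deriv_upper[of w] w X(1) by linarith
qed

text \<open>On the real axis these are \<open>deriv_lower\<close> and \<open>Re_lam_le_ln\<close>. A
  point of the strip lies in the distortion disc about its real part, which costs a factor 2 in the
  derivative and at most 1 in \<open>Re lam\<close>. A strip of height 2 pi is enough because
  \<open>L\<close> is periodic.\<close>

lemma lam_strip:
  obtains c B T where "c > 0" "B > 0" "T > a" "T \<ge> 1"
    "\<And>w. T \<le> Re w \<Longrightarrow> \<bar>Im w\<bar> \<le> pi \<Longrightarrow> c * Re w powr (- 2 * univalent_const) \<le> cmod (deriv lam w)"
    "\<And>w. T \<le> Re w \<Longrightarrow> \<bar>Im w\<bar> \<le> pi \<Longrightarrow> Re (lam w) \<le> B * ln (Re w)"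
proof -
  obtain X where X: "X > a" "X \<ge> 1" "\<And>w. X \<le> Re w \<Longrightarrow> 20 \<le> eta * (Re w - a)"
    "\<And>w. X \<le> Re w \<Longrightarrow> cmod (deriv lam w) \<le> 1/8"
  proof (rule far_right)
    fix X assume h: "X > a" "X \<ge> 1" "\<And>w. X \<le> Re w \<Longrightarrow> 20 \<le> eta * (Re w - a)"
      "\<And>w. X \<le> Re w \<Longrightarrow> cmod (deriv lam w) \<le> 1/8"
    show ?thesis by (rule that[OF h])
  qed
  define A0 where "A0 = Re (lam (of_real X)) - 12 * pi * ln (X - a)"
  define c0 where "c0 = cmod (deriv lam (of_real X)) * (X - a) powr (2 * univalent_const)"
  have c0: "c0 > 0" unfolding c0_def using deriv_nz[of "of_real X"] X(1) by simp
  have "\<forall>\<^sub>F t in at_top. A0 + 1 + 12 * pi * ln (t - a) \<le> (12 * pi + 1) * ln t"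
    by real_asymp
  then obtain T1 where T1: "\<And>t. T1 \<le> t \<Longrightarrow> A0 + 1 + 12 * pi * ln (t - a) \<le> (12 * pi + 1) * ln t"
    unfolding eventually_at_top_linorder by auto
  define T where "T = max (max X T1) (\<bar>a\<bar> + 1)"
  have near: "w \<in> cball (of_real (Re w)) (eta * (Re w - a))" if "X \<le> Re w" "\<bar>Im w\<bar> \<le> pi" for w
  proof -
    have "w - of_real (Re w) = \<i> * of_real (Im w)" by (simp add: complex_eq_iff)
    then have "cmod (w - of_real (Re w)) = \<bar>Im w\<bar>" by (simp add: norm_mult)
    also have "\<dots> \<le> 20" using that(2) pi_less_4 by linarith
    also have "\<dots> \<le> eta * (Re w - a)" using X(3) that(1) .
    finally show ?thesis by (simp add: dist_norm norm_minus_commute)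
  qed
  show ?thesis
  proof (rule that[of "c0 / 2 * 2 powr (- 2 * univalent_const)" "12 * pi + 1" T])
    fix w assume w: "T \<le> Re w" "\<bar>Im w\<bar> \<le> pi"
    define t where "t = Re w"
    have t: "X \<le> t" "T1 \<le> t" "\<bar>a\<bar> + 1 \<le> t" "a < t" using w(1) X(1) by (auto simp: T_def t_def)
    have a_t: "a < Re (of_real t :: complex)" using t(4) by simp
    have wt: "w \<in> cball (of_real t) (eta * (Re (of_real t :: complex) - a))" and tt: "of_real t \<in> cball (of_real t) (eta * (Re (of_real t :: complex) - a))"
      using near[of w] w(2) t eta by (auto simp: t_def)
    have "c0 \<le> cmod (deriv lam (of_real t)) * (t - a) powr (2 * univalent_const)"
      unfolding c0_def by (rule deriv_lower[OF X(1) t(1)])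
    then have "c0 * (t - a) powr (- (2 * univalent_const)) \<le> cmod (deriv lam (of_real t))"
      using t(4) by (simp add: powr_minus field_simps)
    moreover have "c0 * (2 * t) powr (- (2 * univalent_const)) \<le> c0 * (t - a) powr (- (2 * univalent_const))"
      using t c0 univalent_const_ge by (intro mult_left_mono powr_mono2') auto
    ultimately have 1: "c0 * (2 * t) powr (- (2 * univalent_const)) \<le> cmod (deriv lam (of_real t))" by linarith
    have "cmod (deriv lam w - deriv lam (of_real t)) \<le> cmod (deriv lam (of_real t)) / 2"
      by (rule deriv_near[OF a_t wt])
    then have "cmod (deriv lam (of_real t)) / 2 \<le> cmod (deriv lam w)"
      using norm_triangle_ineq2[of "deriv lam (of_real t)" "deriv lam w"] by (simp add: norm_minus_commute)
    with 1 show "c0 / 2 * 2 powr (- 2 * univalent_const) * Re w powr (- 2 * univalent_const) \<le> cmod (deriv lam w)"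
      using t by (simp add: powr_mult t_def[symmetric])
    have "dist (lam w) (lam (of_real t)) \<le> 3/2 * cmod (deriv lam (of_real t)) * dist w (of_real t)"
      by (rule lipschitz_near[OF a_t wt tt])
    also have "\<dots> \<le> 3/2 * (1/8) * 4"
    proof (intro mult_mono)
      show "cmod (deriv lam (of_real t)) \<le> 1/8" using X(4)[of "of_real t"] t(1) by simp
      have "w - of_real t = \<i> * of_real (Im w)" by (simp add: complex_eq_iff t_def)
      then show "dist w (of_real t) \<le> 4" using w(2) pi_less_4 by (simp add: dist_norm norm_mult)
    qed auto
    finally have "\<bar>Re (lam w) - Re (lam (of_real t))\<bar> \<le> 1"
      using abs_Re_le_cmod[of "lam w - lam (of_real t)"] by (simp add: dist_norm)
    moreover have "Re (lam (of_real t)) - 12 * pi * ln (t - a) \<le> A0"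
      unfolding A0_def by (rule Re_lam_le_ln[OF X(1) t(1)])
    ultimately show "Re (lam w) \<le> (12 * pi + 1) * ln (Re w)"
      using T1[OF t(2)] by (simp add: t_def)
  qed (use c0 X pi_gt_zero in \<open>auto simp: T_def intro: add_pos_pos\<close>)
qed

text \<open>The derivative decays at most with exponent 2 * univalent_const in the strip. The
  additional 1 leaves a factor 1 / Re w that beats the constants and the power of log (Re w) coming
  from \<open>Re (lam w)\<close>.\<close>

definition K :: real where "K = 2 * univalent_const + 1"

text \<open>The last estimate is the telescoping device for \<open>pull_back\<close>: one
  application of \<open>lam\<close> multiplies separations by at least
  \<open>cmod (deriv lam w) / 2\<close>, and that factor is at least the quotient of the potentials
  at \<open>w\<close> and at \<open>lam w\<close>.\<close>

lemma constants:
  obtains X where "X > a" "X \<ge> 1"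
    "\<And>w. X \<le> Re w \<Longrightarrow> 20 \<le> eta * (Re w - a)"
    "\<And>w. X \<le> Re w \<Longrightarrow> cmod (deriv lam w) \<le> 1/8"
    "\<And>w. X \<le> Re w \<Longrightarrow> \<bar>Im w\<bar> \<le> pi \<Longrightarrow> Re (lam w) \<le> Re w - 1"
    "\<And>w. X \<le> Re w \<Longrightarrow> \<bar>Im w\<bar> \<le> pi \<Longrightarrow> X \<le> Re (lam w) \<Longrightarrow>
        Re w powr (- K) \<le> cmod (deriv lam w) / 2 * Re (lam w) powr (- K)"
proof -
  obtain X1 where X1: "X1 > a" "X1 \<ge> 1" "\<And>w. X1 \<le> Re w \<Longrightarrow> 20 \<le> eta * (Re w - a)"
    "\<And>w. X1 \<le> Re w \<Longrightarrow> cmod (deriv lam w) \<le> 1/8"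
  proof (rule far_right)
    fix X1 assume h: "X1 > a" "X1 \<ge> 1" "\<And>w. X1 \<le> Re w \<Longrightarrow> 20 \<le> eta * (Re w - a)"
      "\<And>w. X1 \<le> Re w \<Longrightarrow> cmod (deriv lam w) \<le> 1/8"
    show ?thesis by (rule that[OF h])
  qed
  obtain c B T where T: "c > 0" "B > 0" "T > a" "T \<ge> 1"
    "\<And>w. T \<le> Re w \<Longrightarrow> \<bar>Im w\<bar> \<le> pi \<Longrightarrow> c * Re w powr (- 2 * univalent_const) \<le> cmod (deriv lam w)"
    "\<And>w. T \<le> Re w \<Longrightarrow> \<bar>Im w\<bar> \<le> pi \<Longrightarrow> Re (lam w) \<le> B * ln (Re w)"
  proof (rule lam_strip)
    fix c B T assume h: "c > 0" "B > 0" "T > a" "T \<ge> 1"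
      "\<And>w. T \<le> Re w \<Longrightarrow> \<bar>Im w\<bar> \<le> pi \<Longrightarrow> c * Re w powr (- 2 * univalent_const) \<le> cmod (deriv lam w)"
      "\<And>w. T \<le> Re w \<Longrightarrow> \<bar>Im w\<bar> \<le> pi \<Longrightarrow> Re (lam w) \<le> B * ln (Re w)"
    show ?thesis by (rule that[OF h])
  qed
  have "\<forall>\<^sub>F t in at_top. B * ln t \<le> t - 1" using \<open>B > 0\<close> by real_asymp
  moreover have "\<forall>\<^sub>F t in at_top. 2 * t powr (- 1) * (B * ln t) powr K \<le> c"
    using \<open>B > 0\<close> \<open>c > 0\<close> by real_asymp
  ultimately have "\<forall>\<^sub>F t in at_top. B * ln t \<le> t - 1 \<and> 2 * t powr (- 1) * (B * ln t) powr K \<le> c"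
    by (rule eventually_conj)
  then obtain T2 where T2: "\<And>t. T2 \<le> t \<Longrightarrow> B * ln t \<le> t - 1"
      "\<And>t. T2 \<le> t \<Longrightarrow> 2 * t powr (- 1) * (B * ln t) powr K \<le> c"
    unfolding eventually_at_top_linorder by auto
  define X where "X = max (max X1 T) (max T2 2)"
  show ?thesis
  proof (rule that[of X])
    show "X > a" "X \<ge> 1" using X1 by (auto simp: X_def)
    show "20 \<le> eta * (Re w - a)" "cmod (deriv lam w) \<le> 1/8" if "X \<le> Re w" for w
      using X1(3,4)[of w] that by (auto simp: X_def)
    show "Re (lam w) \<le> Re w - 1" if "X \<le> Re w" "\<bar>Im w\<bar> \<le> pi" for w
      using T(6)[of w] T2(1)[of "Re w"] that by (auto simp: X_def)
    show "Re w powr (- K) \<le> cmod (deriv lam w) / 2 * Re (lam w) powr (- K)"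
      if w: "X \<le> Re w" "\<bar>Im w\<bar> \<le> pi" "X \<le> Re (lam w)" for w
    proof -
      define t where "t = Re w"
      define y where "y = Re (lam w)"
      have t: "T \<le> t" "T2 \<le> t" "2 \<le> t" "2 \<le> y" using w by (auto simp: t_def y_def X_def)
      have K0: "K \<ge> 0" using univalent_const_ge by (simp add: K_def)
      have yB: "y \<le> B * ln t" using T(6)[of w] t w(2) by (simp add: t_def y_def)
      have "2 * t powr (- 1) * y powr K \<le> 2 * t powr (- 1) * (B * ln t) powr K"
        using t yB K0 by (intro mult_left_mono powr_mono2) auto
      also have "\<dots> \<le> c" using T2(2)[OF t(2)] .
      finally have "2 * t powr (- 1) * y powr K \<le> c" .
      then have "t powr (- 2 * univalent_const) * (2 * t powr (- 1) * y powr K) \<le> t powr (- 2 * univalent_const) * c"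
        by (intro mult_left_mono) auto
      also have "\<dots> \<le> cmod (deriv lam w)"
        using T(5)[of w] t w(2) by (simp add: t_def mult.commute)
      also have "t powr (- 2 * univalent_const) * (2 * t powr (- 1) * y powr K) = 2 * t powr (- K) * y powr K"
      proof -
        have K: "- 2 * univalent_const + - 1 = - K" by (simp add: K_def)
        show ?thesis
          using powr_add[of t "- 2 * univalent_const" "- 1"] unfolding K by (simp only: mult_ac)
      qed
      finally have "2 * t powr (- K) * y powr K * y powr (- K) \<le> cmod (deriv lam w) * y powr (- K)"
        by (rule mult_right_mono) simp
      moreover have "y powr K * y powr (- K) = 1" using t by (simp add: powr_minus)
      ultimately show ?thesis by (simp add: t_def y_def mult.assoc)
    qed
  qed
qed

text \<open>Follow the inverse branches that stay close to the real axis, along a sequence \<open>xs\<close> with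
  \<open>Re (lam (xs (Suc n))) = xs n\<close>.\<close>
lemma L_near_real:
  obtains X1 where "\<And>x. X1 \<le> x \<Longrightarrow> \<exists>p\<in>L. cmod (p - of_real x) \<le> 2 * pi"
proof -
  obtain X where X: "X > a" "X \<ge> 1"
    "\<And>w. X \<le> Re w \<Longrightarrow> 20 \<le> eta * (Re w - a)"
    "\<And>w. X \<le> Re w \<Longrightarrow> cmod (deriv lam w) \<le> 1/8"
    "\<And>w. X \<le> Re w \<Longrightarrow> \<bar>Im w\<bar> \<le> pi \<Longrightarrow> Re (lam w) \<le> Re w - 1"
  proof (rule constants)
    fix X assume h: "X > a" "X \<ge> 1"
      "\<And>w. X \<le> Re w \<Longrightarrow> 20 \<le> eta * (Re w - a)"
      "\<And>w. X \<le> Re w \<Longrightarrow> cmod (deriv lam w) \<le> 1/8"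
      "\<And>w. X \<le> Re w \<Longrightarrow> \<bar>Im w\<bar> \<le> pi \<Longrightarrow> Re (lam w) \<le> Re w - 1"
    show ?thesis by (rule that[OF h])
  qed
  define T where "T = X + 10"
  define X1 where "X1 = max T (Re (lam (of_real T)))"
  \<comment> \<open>Existence is the intermediate value theorem. The gain of 1, which drives
    \<open>xs\<close> to infinity, is the estimate \<open>Re (lam w) \<le> Re w - 1\<close>.\<close>
  have "\<exists>t. x + 1 \<le> t \<and> Re (lam (of_real t)) = x" if x: "X1 \<le> x" for x
  proof -
    have "\<forall>\<^sub>F t in at_top. x \<le> Re (lam (of_real t)) \<and> T \<le> t"
      using Re_lam_at_top eventually_ge_at_top[of T] unfolding filterlim_at_top
      by (intro eventually_conj) auto
    then obtain t2 where t2: "x \<le> Re (lam (of_real t2))" "T \<le> t2"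
      unfolding eventually_at_top_linorder by blast
    have "\<exists>t\<ge>T. t \<le> t2 \<and> Re (lam (of_real t)) = x"
    proof (rule IVT)
      show "Re (lam (of_real T)) \<le> x" using x by (simp add: X1_def)
      show "\<forall>t. T \<le> t \<and> t \<le> t2 \<longrightarrow> isCont (\<lambda>t. Re (lam (of_real t))) t"
        using Re_lam_has_deriv DERIV_isCont X(1) by (metis T_def add_increasing2 le_less_trans less_le_trans zero_le_numeral order_refl)
    qed (use t2 in auto)
    then obtain t where t: "T \<le> t" "Re (lam (of_real t)) = x" by blast
    moreover have "Re (lam (of_real t)) \<le> Re (of_real t :: complex) - 1"
      using t(1) pi_gt_zero by (intro X(5)) (auto simp: T_def)
    ultimately show ?thesis by (intro exI[of _ t]) auto
  qed
  then obtain S where S: "\<And>x. X1 \<le> x \<Longrightarrow> x + 1 \<le> S x \<and> Re (lam (of_real (S x))) = x"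
    by metis
  show ?thesis
  proof (rule that)
    fix x assume x: "X1 \<le> x"
    define xs where "xs n = (S ^^ n) x" for n
    have xs_ge: "x + real n \<le> xs n" for n
    proof (induction n)
      case (Suc n)
      then have "xs n + 1 \<le> xs (Suc n)" using S[of "xs n"] x by (simp add: xs_def)
      then show ?case using Suc by simp
    qed (simp add: xs_def)
    have xsX: "X1 \<le> xs n" for n using xs_ge[of n] x by simp
    have xsT: "X + 10 \<le> xs n" for n using xsX[of n] by (simp add: X1_def T_def)
    have Re_xs: "Re (lam (of_real (xs (Suc n)))) = xs n" for n
      using S[OF xsX[of n]] by (simp add: xs_def)
    have "\<forall>n. \<exists>k::int. \<bar>Im (lam (of_real (xs (Suc n))) - 2 * of_real pi * \<i> * of_int k)\<bar> \<le> pi"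
      using im_shift by blast
    then obtain k :: "nat \<Rightarrow> int"
      where k: "\<And>n. \<bar>Im (lam (of_real (xs (Suc n))) - 2 * of_real pi * \<i> * of_int (k n))\<bar> \<le> pi"
      by metis
    define \<mu> where "\<mu> n w = lam w - 2 * of_real pi * \<i> * of_int (k n)" for n w
    have \<mu>_xs: "dist (\<mu> n (of_real (xs (Suc n)))) (of_real (xs n)) \<le> pi" for n
    proof -
      have "\<mu> n (of_real (xs (Suc n))) - of_real (xs n) = \<i> * of_real (Im (\<mu> n (of_real (xs (Suc n)))))"
        using Re_xs[of n] by (simp add: complex_eq_iff \<mu>_def)
      then have "dist (\<mu> n (of_real (xs (Suc n)))) (of_real (xs n)) = \<bar>Im (\<mu> n (of_real (xs (Suc n))))\<bar>"
        by (simp only: dist_norm norm_mult norm_of_real norm_ii mult_1)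
      then show ?thesis using k[of n] by (simp only: \<mu>_def)
    qed
    \<comment> \<open>The radius 2 pi makes \<mu> n map \<open>D (Suc n)\<close> into
      \<open>D n\<close>: the image of the centre is off by at most pi, and the contraction by 1/2
      adds at most another pi.\<close>
    define D where "D n = cball (complex_of_real (xs n)) (2 * pi)" for n
    have D_sub: "w \<in> cball (of_real (xs n)) (eta * (Re (of_real (xs n) :: complex) - a))" if "w \<in> D n" for w n
    proof -
      have "2 * pi \<le> 20" using pi_less_4 by simp
      also have "\<dots> \<le> eta * (Re (of_real (xs n) :: complex) - a)"
        using xsT[of n] by (intro X(3)) simp
      finally show ?thesis using that by (simp add: D_def)
    qed
    have contr: "dist (\<mu> n p) (\<mu> n q) \<le> 1/2 * dist p q" if "p \<in> D (Suc n)" "q \<in> D (Suc n)" for p q n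
    proof -
      have a': "a < Re (of_real (xs (Suc n)) :: complex)" using xsT[of "Suc n"] X(1) by simp
      have "dist (lam p) (lam q) \<le> 3/2 * cmod (deriv lam (of_real (xs (Suc n)))) * dist p q"
        by (rule lipschitz_near[OF a' D_sub[OF that(1)] D_sub[OF that(2)]])
      also have "\<dots> \<le> 3/2 * (1/8) * dist p q"
        using X(4)[of "of_real (xs (Suc n))"] xsT[of "Suc n"]
        by (intro mult_right_mono mult_left_mono) auto
      also have "\<dots> \<le> 1/2 * dist p q" by simp
      finally show ?thesis by (simp add: \<mu>_def dist_norm)
    qed
    have cent: "of_real (xs n) \<in> D n" for n by (simp add: D_def)
    \<comment> \<open>\<open>y j n\<close> starts at the real point \<open>xs (n + j)\<close> and
      applies the branches with indices n + j - 1 down to n. Letting j grow yields, for all n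
      simultaneously, points that the branches map to each other exactly.\<close>
    define y where "y = rec_nat (\<lambda>n. complex_of_real (xs n)) (\<lambda>_ Y n. \<mu> n (Y (Suc n)))"
    have y0: "y 0 n = of_real (xs n)" and yS: "y (Suc j) n = \<mu> n (y j (Suc n))" for j n
      by (simp_all add: y_def)
    have yD: "y j n \<in> D n" for j n
    proof (induction j arbitrary: n)
      case 0
      then show ?case using cent by (simp add: y0)
    next
      case (Suc j)
      have "dist (\<mu> n (y j (Suc n))) (\<mu> n (of_real (xs (Suc n)))) \<le> 1/2 * dist (y j (Suc n)) (of_real (xs (Suc n)))"
        by (rule contr[OF Suc.IH cent])
      also have "\<dots> \<le> pi" using Suc.IH[of "Suc n"] by (simp add: D_def dist_commute)
      finally have "dist (\<mu> n (y j (Suc n))) (of_real (xs n)) \<le> pi + pi"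
        using \<mu>_xs[of n] dist_triangle[of "\<mu> n (y j (Suc n))" "of_real (xs n)" "\<mu> n (of_real (xs (Suc n)))"]
        by linarith
      then show ?case by (simp add: D_def yS dist_commute)
    qed
    have y_diff: "dist (y (Suc j) n) (y j n) \<le> pi * (1/2) ^ j" for j n
    proof (induction j arbitrary: n)
      case 0
      show ?case using \<mu>_xs[of n] by (simp add: yS y0)
    next
      case (Suc j)
      have "dist (y (Suc (Suc j)) n) (y (Suc j) n) = dist (\<mu> n (y (Suc j) (Suc n))) (\<mu> n (y j (Suc n)))"
        by (simp only: yS)
      also have "\<dots> \<le> 1/2 * dist (y (Suc j) (Suc n)) (y j (Suc n))" by (rule contr[OF yD yD])
      also have "\<dots> \<le> 1/2 * (pi * (1/2) ^ j)" using Suc.IH[of "Suc n"] by (intro mult_left_mono) auto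
      finally show ?case by simp
    qed
    have "\<exists>l. (\<lambda>j. y j n) \<longlonglongrightarrow> l" for n
    proof -
      have "summable (\<lambda>j. y (Suc j) n - y j n)"
      proof (rule summable_comparison_test')
        show "summable (\<lambda>j. pi * (1/2) ^ j)" by (intro summable_mult summable_geometric) simp
        show "norm (y (Suc j) n - y j n) \<le> pi * (1/2) ^ j" if "j \<ge> 0" for j
          using y_diff[of j n] by (simp add: dist_norm)
      qed
      then have "(\<lambda>m. \<Sum>j<m. y (Suc j) n - y j n) \<longlonglongrightarrow> (\<Sum>j. y (Suc j) n - y j n)"
        by (rule summable_LIMSEQ)
      then have "(\<lambda>m. y m n - y 0 n) \<longlonglongrightarrow> (\<Sum>j. y (Suc j) n - y j n)"
        unfolding sum_lessThan_telescope[of "\<lambda>j. y j n"] .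
      then have "(\<lambda>m. y m n - y 0 n + y 0 n) \<longlonglongrightarrow> (\<Sum>j. y (Suc j) n - y j n) + y 0 n"
        by (intro tendsto_add tendsto_const)
      then show ?thesis by auto
    qed
    then obtain u where u: "\<And>n. (\<lambda>j. y j n) \<longlonglongrightarrow> u n" by metis
    have uD: "u n \<in> D n" for n
      by (rule closed_sequentially[OF _ _ u[of n]]) (use yD in \<open>auto simp: D_def\<close>)
    have Re_u: "xs n - 2 * pi \<le> Re (u n)" for n
      using uD[of n] complex_Re_le_cmod[of "of_real (xs n) - u n"] by (simp add: D_def dist_norm)
    have ua: "a < Re (u n)" for n
      using Re_u[of n] xsT[of n] pi_less_4 X(1) by linarith
    have u_eq: "u n = \<mu> n (u (Suc n))" for n
    proof (rule LIMSEQ_unique)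
      show "(\<lambda>j. y (Suc j) n) \<longlonglongrightarrow> u n" by (rule LIMSEQ_Suc[OF u])
      have "isCont lam (u (Suc n))" using has_deriv[OF ua[of "Suc n"]] by (rule DERIV_isCont)
      then have "(\<lambda>j. lam (y j (Suc n))) \<longlonglongrightarrow> lam (u (Suc n))"
        by (rule isCont_tendsto_compose[OF _ u])
      then show "(\<lambda>j. y (Suc j) n) \<longlonglongrightarrow> \<mu> n (u (Suc n))"
        unfolding yS \<mu>_def by (intro tendsto_diff tendsto_const)
    qed
    have "exp (lam (u (Suc n))) = exp (u n)" for n
      using exp_shift[of "u n" "k n"] unfolding u_eq[of n] by (simp add: \<mu>_def)
    moreover have "filterlim (\<lambda>n. Re (u n)) at_top sequentially"
    proof (rule filterlim_at_top_mono)
      show "filterlim (\<lambda>n. x - 2 * pi + real n) at_top sequentially"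
        by (intro filterlim_tendsto_add_at_top[OF tendsto_const] filterlim_real_sequentially)
      show "\<forall>\<^sub>F n in sequentially. x - 2 * pi + real n \<le> Re (u n)"
        using Re_u xs_ge by (intro always_eventually allI) (smt (verit))
    qed
    ultimately have "orbit u" using ua by (simp add: orbit_def)
    then have "u 0 \<in> L" by (rule orbit_in_L)
    moreover have "cmod (u 0 - of_real x) \<le> 2 * pi"
      using uD[of 0] by (simp add: D_def xs_def dist_norm norm_minus_commute)
    ultimately show "\<exists>p\<in>L. cmod (p - of_real x) \<le> 2 * pi" by blast
  qed
qed

section \<open>Separated subsets of \<open>L\<close> in unit discs and their pull-back\<close>

definition separated_near :: "complex \<Rightarrow> nat \<Rightarrow> real \<Rightarrow> bool" where
  "separated_near v n \<delta> \<longleftrightarrow> (\<exists>S. finite S \<and> S \<subseteq> L \<inter> cball v 1 \<and> card S = n \<and>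
     (\<forall>x\<in>S. \<forall>y\<in>S. x \<noteq> y \<longrightarrow> \<delta> \<le> dist x y))"

lemma separated_near_mono: "separated_near v n \<delta> \<Longrightarrow> \<delta>' \<le> \<delta> \<Longrightarrow> separated_near v n \<delta>'"
  unfolding separated_near_def by (elim ex_forward conj_forward) (auto intro: order_trans)

lemma separated_near_image:
  assumes S: "separated_near v n \<delta>" and "\<delta> > 0" "c > 0"
    and im: "\<And>p. p \<in> L \<Longrightarrow> p \<in> cball v 1 \<Longrightarrow> h p \<in> L \<inter> cball v' 1"
    and ex: "\<And>p q. p \<in> cball v 1 \<Longrightarrow> q \<in> cball v 1 \<Longrightarrow> c * dist p q \<le> dist (h p) (h q)"
  shows "separated_near v' n (c * \<delta>)"
proof -
  obtain S where S: "finite S" "S \<subseteq> L \<inter> cball v 1" "card S = n"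
    "\<And>x y. x \<in> S \<Longrightarrow> y \<in> S \<Longrightarrow> x \<noteq> y \<Longrightarrow> \<delta> \<le> dist x y"
    using S unfolding separated_near_def by metis
  have sep: "c * \<delta> \<le> dist (h x) (h y)" if "x \<in> S" "y \<in> S" "x \<noteq> y" for x y
  proof -
    have "c * \<delta> \<le> c * dist x y" using S(4)[OF that] \<open>c > 0\<close> by simp
    also have "\<dots> \<le> dist (h x) (h y)" using that S(2) by (intro ex) auto
    finally show ?thesis .
  qed
  have "inj_on h S"
  proof (rule inj_onI, rule ccontr)
    fix x y assume xy: "x \<in> S" "y \<in> S" "h x = h y" "x \<noteq> y"
    have "c * \<delta> > 0" using \<open>c > 0\<close> \<open>\<delta> > 0\<close> by simp
    then show False using sep[OF xy(1,2,4)] xy(3) by simp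
  qed
  then have "card (h ` S) = n" using S(3) by (simp add: card_image)
  moreover have "h ` S \<subseteq> L \<inter> cball v' 1" using im S(2) by blast
  moreover have "\<forall>x\<in>h ` S. \<forall>y\<in>h ` S. x \<noteq> y \<longrightarrow> c * \<delta> \<le> dist x y" using sep by auto
  ultimately show ?thesis unfolding separated_near_def using S(1) by (intro exI[of _ "h ` S"]) simp
qed

lemma separated_near_shift:
  assumes "separated_near v n \<delta>" "\<delta> > 0"
  shows "separated_near (v + 2 * of_real pi * \<i> * of_int k) n \<delta>"
proof -
  have "separated_near (v + 2 * of_real pi * \<i> * of_int k) n (1 * \<delta>)"
  proof (rule separated_near_image[OF assms])
    fix p assume "p \<in> L" "p \<in> cball v 1"
    then show "p + 2 * of_real pi * \<i> * of_int k \<in> L \<inter> cball (v + 2 * of_real pi * \<i> * of_int k) 1"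
      using L_shift by (auto simp: dist_norm)
  qed (auto simp: dist_norm)
  then show ?thesis by simp
qed

text \<open>Far to the right \<open>lam\<close> maps the unit disc about \<open>v\<close> into the
  unit disc about \<open>lam v\<close>. So the cardinality survives every pull-back, and only the
  separation is scaled.\<close>

lemma separated_near_lam:
  assumes S: "separated_near v n \<delta>" "\<delta> > 0"
    and v: "a < Re v" "1 \<le> eta * (Re v - a)" "cmod (deriv lam v) \<le> 1/8"
  shows "separated_near (lam v) n (cmod (deriv lam v) / 2 * \<delta>)"
proof (rule separated_near_image[OF S])
  show "0 < cmod (deriv lam v) / 2" using deriv_nz[OF v(1)] by simp
  have sub: "p \<in> cball v (eta * (Re v - a))" if "p \<in> cball v 1" for p using that v(2) by simp
  have "eta * (Re v - a) \<le> 1/100 * (Re v - a)" using eta v(1) by (intro mult_right_mono) auto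
  with v(2) have "1 \<le> 1/100 * (Re v - a)" by (rule order_trans)
  then have "cball v 1 \<subseteq> H" by (intro cball_subset_H) simp
  show "lam p \<in> L \<inter> cball (lam v) 1" if "p \<in> L" "p \<in> cball v 1" for p
  proof
    show "lam p \<in> L" using that \<open>cball v 1 \<subseteq> H\<close> by (intro L_lam) auto
    have "dist (lam v) (lam p) \<le> 3/2 * cmod (deriv lam v) * dist v p"
      by (rule lipschitz_near[OF v(1) sub sub]) (use that in auto)
    also have "\<dots> \<le> 3/2 * (1/8) * 1" using that v(3) by (intro mult_mono) auto
    finally show "lam p \<in> cball (lam v) 1" by simp
  qed
  show "cmod (deriv lam v) / 2 * dist p q \<le> dist (lam p) (lam q)" if "p \<in> cball v 1" "q \<in> cball v 1" for p q
    by (rule expand_near[OF v(1) sub[OF that(1)] sub[OF that(2)]])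
qed

text \<open>The vertical translates of \<open>v\<close> are unbounded but keep their real part, so
  \<open>proper\<close> prevents \<open>Re lam\<close> from staying below \<open>x\<close> on all of
  them.\<close>

lemma Re_lam_unbounded_up:
  assumes "a < Re v"
  obtains k where "x \<le> Re (lam (v + 2 * of_real pi * \<i> * of_nat k))"
proof -
  obtain R where R: "\<And>w. Re v \<le> Re w \<Longrightarrow> Re (lam w) \<le> x \<Longrightarrow> cmod w \<le> R"
    using proper[OF assms, of x] unfolding bounded_iff by auto
  obtain k :: nat where k: "R + cmod v < real k" using reals_Archimedean2 by blast
  define w where "w = v + 2 * of_real pi * \<i> * of_nat k"
  have "real k \<le> 2 * pi * real k" using pi_ge_two by (simp add: mult_le_cancel_right1)
  also have "\<dots> = cmod (2 * of_real pi * \<i> * of_nat k)" by (simp add: norm_mult)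
  also have "\<dots> \<le> cmod w + cmod v" using norm_triangle_ineq4[of w v] by (simp add: w_def)
  finally have "R < cmod w" using k by linarith
  then have "\<not> Re (lam w) \<le> x" using R[of w] by (auto simp: w_def)
  then show ?thesis using that[of k] by (simp add: w_def)
qed

text \<open>Pull a separated set back along inverse branches until its real part is close to \<open>x\<close>. While
  \<open>Re (lam v) \<ge> x\<close> the loss is absorbed by the decrease from \<open>Re v\<close> to \<open>Re (lam v)\<close>; the last step
  applies \<open>lam\<close> to a vertical translate of \<open>v\<close>, at a cost that is bounded by compactness.\<close>
lemma pull_back:
  assumes X: "X > a" "X \<ge> 1"
    "\<And>w. X \<le> Re w \<Longrightarrow> 20 \<le> eta * (Re w - a)"
    "\<And>w. X \<le> Re w \<Longrightarrow> cmod (deriv lam w) \<le> 1/8"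
    "\<And>w. X \<le> Re w \<Longrightarrow> \<bar>Im w\<bar> \<le> pi \<Longrightarrow> Re (lam w) \<le> Re w - 1"
    "\<And>w. X \<le> Re w \<Longrightarrow> \<bar>Im w\<bar> \<le> pi \<Longrightarrow> X \<le> Re (lam w) \<Longrightarrow>
        Re w powr (- K) \<le> cmod (deriv lam w) / 2 * Re (lam w) powr (- K)"
    and x: "X \<le> x"
  obtains c where "c > 0"
    "\<And>v n \<delta>. X \<le> Re v \<Longrightarrow> \<delta> > 0 \<Longrightarrow> separated_near v n \<delta> \<Longrightarrow>
       \<exists>w. x \<le> Re w \<and> Re w \<le> x + 2 \<and> separated_near w n (c * Re v powr (- K) * \<delta>)"
proof -
  have K0: "K \<ge> 0" using univalent_const_ge by (simp add: K_def)
  \<comment> \<open>The point used in the last step always lies in this compact set, which depends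
    on \<open>x\<close> alone. The minimum of the derivative on it therefore gives a constant
    independent of \<open>v\<close>, \<open>n\<close> and \<delta>.\<close>
  define V where "V = {w. X \<le> Re w \<and> Re (lam w) \<le> x + 2}"
  have "closed V"
  proof -
    have "continuous_on {w. X \<le> Re w} lam"
      by (rule continuous_on_subset[OF holomorphic_on_imp_continuous_on[OF hol]]) (use X(1) in auto)
    then have "continuous_on {w. X \<le> Re w} (\<lambda>w. Re (lam w))" by (intro continuous_intros)
    then have "closed ({w. X \<le> Re w} \<inter> (\<lambda>w. Re (lam w)) -` {..x + 2})"
      by (rule continuous_closed_preimage) (auto simp: closed_halfspace_Re_ge)
    moreover have "{w. X \<le> Re w} \<inter> (\<lambda>w. Re (lam w)) -` {..x + 2} = V" by (auto simp: V_def)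
    ultimately show ?thesis by simp
  qed
  moreover have "bounded V" unfolding V_def by (rule proper[OF X(1)])
  ultimately have "compact V" using compact_eq_bounded_closed by blast
  have "\<exists>m>0. \<forall>w\<in>V. m \<le> cmod (deriv lam w)"
  proof (cases "V = {}")
    case True
    then show ?thesis by (auto intro: exI[of _ 1])
  next
    case False
    have "continuous_on H (deriv lam)"
      using holomorphic_deriv[OF hol open_H] by (rule holomorphic_on_imp_continuous_on)
    then have "continuous_on V (\<lambda>w. cmod (deriv lam w))"
      by (intro continuous_intros) (rule continuous_on_subset, use X(1) in \<open>auto simp: V_def\<close>)
    from continuous_attains_inf[OF \<open>compact V\<close> False this]
    obtain w0 where w0: "w0 \<in> V" "\<forall>w\<in>V. cmod (deriv lam w0) \<le> cmod (deriv lam w)" by blast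
    moreover have "cmod (deriv lam w0) > 0" using deriv_nz[of w0] w0(1) X(1) by (auto simp: V_def)
    ultimately show ?thesis by blast
  qed
  then obtain m where m: "m > 0" "\<And>w. w \<in> V \<Longrightarrow> m \<le> cmod (deriv lam w)" by blast
  define c where "c = m / 2"
  have c: "c > 0" using m by (simp add: c_def)
  have lamX: "separated_near (lam v) n (cmod (deriv lam v) / 2 * \<delta>)"
    if "separated_near v n \<delta>" "\<delta> > 0" "X \<le> Re v" for v n \<delta>
    using that X(1) X(3)[OF that(3)] X(4)[OF that(3)] by (intro separated_near_lam) auto
  \<comment> \<open>The induction is on an integer bound for the real part, which drops by at least
    1 with each application of \<open>lam\<close> in the strip.\<close>
  have main: "\<exists>w. x \<le> Re w \<and> Re w \<le> x + 2 \<and> separated_near w n (c * Re v powr (- K) * \<delta>)"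
    if "X \<le> Re v" "Re v \<le> real N" "\<delta> > 0" "separated_near v n \<delta>" for v n \<delta> N
    using that
  proof (induction N arbitrary: v \<delta>)
    case 0
    then show ?case using X(2) by simp
  next
    case (Suc N)
    obtain k where k: "\<bar>Im (v - 2 * of_real pi * \<i> * of_int k)\<bar> \<le> pi" using im_shift by blast
    define v' where "v' = v + 2 * of_real pi * \<i> * of_int (- k)"
    have v': "Re v' = Re v" "\<bar>Im v'\<bar> \<le> pi" using k by (simp_all add: v'_def)
    have sep: "separated_near v' n \<delta>" unfolding v'_def by (rule separated_near_shift[OF Suc.prems(4,3)])
    have Xv': "X \<le> Re v'" using Suc.prems(1) v' by simp
    show ?case
    proof (cases "x \<le> Re (lam v')")
      case True
      then have X1: "X \<le> Re (lam v')" using x by simp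
      have "Re (lam v') \<le> real N" using X(5)[OF Xv' v'(2)] Suc.prems(2) v' by simp
      moreover have "cmod (deriv lam v') / 2 * \<delta> > 0" using deriv_nz[of v'] Xv' X(1) Suc.prems(3) by simp
      ultimately obtain w where w: "x \<le> Re w" "Re w \<le> x + 2"
        "separated_near w n (c * Re (lam v') powr (- K) * (cmod (deriv lam v') / 2 * \<delta>))"
        using Suc.IH[OF X1 _ _ lamX[OF sep Suc.prems(3) Xv']] by blast
      have "c * \<delta> * Re v powr (- K) \<le> c * \<delta> * (cmod (deriv lam v') / 2 * Re (lam v') powr (- K))"
        using X(6)[OF Xv' v'(2) X1] c Suc.prems(3) unfolding v'(1) by (intro mult_left_mono) auto
      then have "c * Re v powr (- K) * \<delta> \<le> c * Re (lam v') powr (- K) * (cmod (deriv lam v') / 2 * \<delta>)"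
        by (simp add: mult_ac)
      with w show ?thesis using separated_near_mono by blast
    next
      case False
      let ?t = "\<lambda>k. v' + 2 * of_real pi * \<i> * of_nat k"
      have "a < Re v'" using Xv' X(1) by simp
      then obtain k0 where k0: "x \<le> Re (lam (?t k0))" using Re_lam_unbounded_up[of v' x] by metis
      \<comment> \<open>At the first translate where \<open>Re lam\<close> reaches \<open>x\<close>
        it cannot overshoot: consecutive translates are 2 pi apart, and \<open>lam\<close> moves by
        at most 3/2 between them.\<close>
      define k1 where "k1 = (LEAST k. x \<le> Re (lam (?t k)))"
      have k1: "x \<le> Re (lam (?t k1))" unfolding k1_def by (rule LeastI[of "\<lambda>k. x \<le> Re (lam (?t k))", OF k0])
      have "k1 \<noteq> 0" using k1 False by (intro notI) simp
      then obtain k2 where k2: "k1 = Suc k2" by (cases k1) auto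
      have "\<not> x \<le> Re (lam (?t k2))" using not_less_Least[of k2 "\<lambda>k. x \<le> Re (lam (?t k))"] k2 by (simp add: k1_def[symmetric])
      then have below: "Re (lam (?t k2)) < x" by simp
      have Xk: "X \<le> Re (?t k)" for k using Xv' by simp
      define p where "p = ?t k1"
      define q where "q = ?t k2"
      have pq: "p - q = 2 * of_real pi * \<i>" unfolding p_def q_def k2 by (simp add: algebra_simps)
      have Xp: "X \<le> Re p" using Xk by (simp only: p_def)
      have dist_pq: "dist p q = 2 * pi" unfolding dist_norm pq by (simp add: norm_mult)
      have qp: "q \<in> cball p (eta * (Re p - a))" "p \<in> cball p (eta * (Re p - a))"
        using dist_pq X(3)[OF Xp] pi_less_4 by auto
      have "dist (lam p) (lam q) \<le> 3/2 * cmod (deriv lam p) * dist p q"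
        by (rule lipschitz_near[OF _ qp(2,1)]) (use Xp X(1) in simp)
      also have "\<dots> \<le> 3/2 * (1/8) * dist p q" using X(4)[OF Xp] by (intro mult_mono) auto
      also have "\<dots> \<le> 3/2" using dist_pq pi_less_4 by simp
      finally have "\<bar>Re (lam p) - Re (lam q)\<bar> \<le> 3/2"
        using abs_Re_le_cmod[of "lam p - lam q"] by (simp add: dist_norm)
      moreover have "Re (lam q) < x" using below by (simp only: q_def)
      ultimately have upper: "Re (lam p) \<le> x + 2" by linarith
      have pV: "p \<in> V" using Xp upper by (simp add: V_def)
      have "separated_near p n \<delta>"
        unfolding p_def using separated_near_shift[OF sep Suc.prems(3), of "int k1"] by simp
      then have "separated_near (lam p) n (cmod (deriv lam p) / 2 * \<delta>)"
        by (rule lamX[OF _ Suc.prems(3) Xp])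
      moreover have "c * Re v powr (- K) * \<delta> \<le> cmod (deriv lam p) / 2 * \<delta>"
      proof (rule mult_right_mono)
        have "1 powr K \<le> Re v powr K" using Suc.prems(1) X(2) K0 by (intro powr_mono2) auto
        then have "Re v powr (- K) \<le> 1" by (simp add: powr_minus inverse_le_1_iff)
        then have "c * Re v powr (- K) \<le> c * 1" using c by (intro mult_left_mono) auto
        then show "c * Re v powr (- K) \<le> cmod (deriv lam p) / 2" using m(2)[OF pV] by (simp add: c_def)
      qed (use Suc.prems(3) in simp)
      ultimately have "separated_near (lam p) n (c * Re v powr (- K) * \<delta>)" by (rule separated_near_mono)
      then show ?thesis using k1 upper by (intro exI[of _ "lam p"]) (simp add: p_def)
    qed
  qed
  show ?thesis
  proof (rule that[OF c])
    fix v n \<delta> assume v: "X \<le> Re v" "(\<delta>::real) > 0" "separated_near v n \<delta>"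
    obtain N where "Re v \<le> real N" using real_arch_simple by blast
    then show "\<exists>w. x \<le> Re w \<and> Re w \<le> x + 2 \<and> separated_near w n (c * Re v powr (- K) * \<delta>)"
      using main v by blast
  qed
qed

text \<open>Otherwise the derivative would be dominated by an integrable power of t and
  \<open>Re lam\<close> would stay bounded on the real axis, contrary to
  \<open>Re_lam_at_top\<close>. The function t powr (- e) / e is a primitive of - t powr (- 1 -
  e).\<close>

lemma deriv_often_large:
  assumes e: "e > 0"
  shows "\<exists>t\<ge>T. t powr (- 1 - e) \<le> cmod (deriv lam (of_real t))"
proof (rule ccontr)
  assume no: "\<not> ?thesis"
  define S where "S = max (max T 1) (a + 1)"
  have small: "cmod (deriv lam (of_real t)) < t powr (- 1 - e)" if "S \<le> t" for t
    using no that unfolding S_def by (metis linorder_not_le max.bounded_iff)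
  have bound: "Re (lam (of_real t)) \<le> Re (lam (of_real S)) + S powr (- e) / e" if t: "S \<le> t" for t
  proof -
    have "Re (lam (of_real t)) + t powr (- e) / e \<le> Re (lam (of_real S)) + S powr (- e) / e"
    proof (rule DERIV_nonpos_imp_nonincreasing[OF t])
      fix x assume x: "S \<le> x" "x \<le> t"
      then have x0: "x > 0" "a < x" by (auto simp: S_def)
      have "((\<lambda>x. x powr (- e) / e) has_real_derivative - (x powr (- 1 - e))) (at x)"
      proof -
        have "((\<lambda>x. x powr (- e)) has_real_derivative - e * x powr (- e - 1)) (at x)"
          by (rule has_real_derivative_powr[OF x0(1)])
        then have "((\<lambda>x. x powr (- e) / e) has_real_derivative (- e * x powr (- e - 1)) / e) (at x)"
          by (rule DERIV_cdivide)
        moreover have "(- e * x powr (- e - 1)) / e = - (x powr (- e - 1))" using e by simp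
        moreover have "- e - 1 = - 1 - e" by simp
        ultimately show ?thesis by (simp only:)
      qed
      from DERIV_add[OF Re_lam_has_deriv[OF x0(2)] this]
      have "((\<lambda>t. Re (lam (of_real t)) + t powr (- e) / e) has_real_derivative
          Re (deriv lam (of_real x)) + - (x powr (- 1 - e))) (at x)" .
      moreover have "Re (deriv lam (of_real x)) + - (x powr (- 1 - e)) \<le> 0"
        using small[OF x(1)] complex_Re_le_cmod[of "deriv lam (of_real x)"] by linarith
      ultimately show "\<exists>y. ((\<lambda>t. Re (lam (of_real t)) + t powr (- e) / e) has_real_derivative y) (at x) \<and> y \<le> 0"
        by blast
    qed
    moreover have "t powr (- e) / e \<ge> 0" using e by simp
    ultimately show ?thesis by linarith
  qed
  have "\<forall>\<^sub>F t in at_top. Re (lam (of_real S)) + S powr (- e) / e + 1 \<le> Re (lam (of_real t)) \<and> S \<le> t"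
    using Re_lam_at_top eventually_ge_at_top[of S] unfolding filterlim_at_top
    by (intro eventually_conj) auto
  then obtain t where "Re (lam (of_real S)) + S powr (- e) / e + 1 \<le> Re (lam (of_real t))" "S \<le> t"
    unfolding eventually_at_top_linorder by blast
  with bound[of t] show False by linarith
qed

text \<open>Points of \<open>L\<close> near t + 20 i, each within 8 of its target, are at least 4
  apart horizontally. Their translates by 8 pi j, available by periodicity, give the other
  direction. The grid reaches no farther than (8 + 20 n) + (8 + 32 n), which is below 60 (n +
  1).\<close>

lemma grid_in_L:
  obtains T where "T > a" "\<And>t n. T \<le> t \<Longrightarrow> 60 * (real n + 1) \<le> eta * (t - a) \<Longrightarrow>
    \<exists>S. finite S \<and> S \<subseteq> L \<inter> cball (of_real t) (eta * (t - a)) \<and> card S = n\<^sup>2 \<and> (\<forall>x\<in>S. \<forall>y\<in>S. x \<noteq> y \<longrightarrow> 4 \<le> dist x y)"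
proof -
  obtain X1 where X1: "\<And>x. X1 \<le> x \<Longrightarrow> \<exists>p\<in>L. cmod (p - of_real x) \<le> 2 * pi"
  proof (rule L_near_real)
    fix X1 assume h: "\<And>x. X1 \<le> x \<Longrightarrow> \<exists>p\<in>L. cmod (p - of_real x) \<le> 2 * pi"
    show ?thesis by (rule that[OF h])
  qed
  have pi4: "2 * pi \<le> 8" "pi \<ge> 3" using pi_less_4 pi_approx by auto
  show ?thesis
  proof (rule that[of "max X1 (a + 1)"])
    fix t n assume t: "max X1 (a + 1) \<le> t" and n: "60 * (real n + 1) \<le> eta * (t - a)"
    have "\<forall>i::nat. \<exists>p\<in>L. cmod (p - of_real (t + 20 * real i)) \<le> 2 * pi"
      using t by (intro allI X1) auto
    then obtain P where P: "\<And>i::nat. P i \<in> L" "\<And>i. cmod (P i - of_real (t + 20 * real i)) \<le> 2 * pi" by metis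
    define g where "g = (\<lambda>(i, j). P i + 2 * of_real pi * \<i> * of_int (4 * int j))"
    define S where "S = g ` ({..<n} \<times> {..<n})"
    have ReP: "\<bar>Re (P i) - (t + 20 * real i)\<bar> \<le> 8" "\<bar>Im (P i)\<bar> \<le> 2 * pi" for i
      using P(2)[of i] abs_Re_le_cmod[of "P i - of_real (t + 20 * real i)"]
        abs_Im_le_cmod[of "P i - of_real (t + 20 * real i)"] pi4 by auto
    have Re_g: "Re (g (i, j)) = Re (P i)" and Im_g: "Im (g (i, j)) = Im (P i) + 8 * pi * real j" for i j
      by (simp_all add: g_def)
    have sep: "4 \<le> dist (g (i, j)) (g (i', j'))" if "(i, j) \<noteq> (i', j')" for i j i' j'
    proof (cases "i = i'")
      case True
      then have "j \<noteq> j'" using that by simp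
      then have "1 \<le> \<bar>real j - real j'\<bar>" by linarith
      then have "8 * pi * 1 \<le> 8 * pi * \<bar>real j - real j'\<bar>" by (intro mult_left_mono) auto
      also have "\<dots> = \<bar>8 * pi * (real j - real j')\<bar>" by (simp add: abs_mult)
      also have "\<dots> = \<bar>Im (g (i, j) - g (i', j'))\<bar>" using True by (simp add: Im_g algebra_simps)
      also have "\<dots> \<le> dist (g (i, j)) (g (i', j'))" unfolding dist_norm by (rule abs_Im_le_cmod)
      finally show ?thesis using pi4 by linarith
    next
      case False
      then have "1 \<le> \<bar>real i - real i'\<bar>" by linarith
      then have "20 \<le> \<bar>20 * real i - 20 * real i'\<bar>" by linarith
      then have "4 \<le> \<bar>Re (g (i, j) - g (i', j'))\<bar>" using ReP(1)[of i] ReP(1)[of i'] by (simp add: Re_g)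
      also have "\<dots> \<le> dist (g (i, j)) (g (i', j'))" unfolding dist_norm by (rule abs_Re_le_cmod)
      finally show ?thesis .
    qed
    have "inj_on g ({..<n} \<times> {..<n})"
    proof (rule inj_onI, rule ccontr)
      fix x y assume "g x = g y" "x \<noteq> y"
      then show False using sep[of "fst x" "snd x" "fst y" "snd y"] by simp
    qed
    then have "card S = n\<^sup>2" by (simp add: S_def card_image card_cartesian_product power2_eq_square)
    moreover have "finite S" by (simp add: S_def)
    moreover have "\<forall>x\<in>S. \<forall>y\<in>S. x \<noteq> y \<longrightarrow> 4 \<le> dist x y"
    proof (intro ballI impI)
      fix x y assume "x \<in> S" "y \<in> S" "x \<noteq> y"
      then obtain i j i' j' where "x = g (i, j)" "y = g (i', j')" by (auto simp: S_def)
      with \<open>x \<noteq> y\<close> show "4 \<le> dist x y" using sep[of i j i' j'] by blast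
    qed
    moreover have "S \<subseteq> L \<inter> cball (of_real t) (eta * (t - a))"
    proof
      fix p assume "p \<in> S"
      then obtain i j where ij: "i < n" "j < n" "p = g (i, j)" by (auto simp: S_def)
      have "p \<in> L" unfolding ij(3) g_def prod.case by (rule L_shift[OF P(1)])
      have "8 * pi * real j \<le> 32 * real j" using pi4 by (intro mult_right_mono) auto
      moreover have "0 \<le> 8 * pi * real j" by simp
      moreover have "Im (p - of_real t) = Im (P i) + 8 * pi * real j" by (simp add: ij(3) Im_g)
      ultimately have "\<bar>Im (p - of_real t)\<bar> \<le> 8 + 32 * real n" using ij(2) ReP(2)[of i] pi4 by linarith
      moreover have "\<bar>Re (p - of_real t)\<bar> \<le> 8 + 20 * real n" using ij(1) ReP(1)[of i] unfolding ij(3) by (simp add: Re_g)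
      ultimately have "cmod (p - of_real t) \<le> (8 + 20 * real n) + (8 + 32 * real n)"
        by (intro order_trans[OF cmod_le add_mono])
      then have "cmod (p - of_real t) \<le> 60 * (real n + 1)" by simp
      then have "p \<in> cball (of_real t) (eta * (t - a))" using n by (simp add: dist_norm norm_minus_commute)
      with \<open>p \<in> L\<close> show "p \<in> L \<inter> cball (of_real t) (eta * (t - a))" ..
    qed
    ultimately show "\<exists>S. finite S \<and> S \<subseteq> L \<inter> cball (of_real t) (eta * (t - a)) \<and> card S = n\<^sup>2 \<and> (\<forall>x\<in>S. \<forall>y\<in>S. x \<noteq> y \<longrightarrow> 4 \<le> dist x y)"
      by (intro exI[of _ S] conjI)
  qed simp
qed

text \<open>The grid lies in a distortion disc whose radius is proportional to t, so
  \<open>lam\<close> multiplies all distances by at least half of the derivative at t. By the choice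
  of \<open>eta\<close> the whole image still fits into a unit disc.\<close>

lemma separated_near_lam_grid:
  obtains T where "T > a" "\<And>t n. T \<le> t \<Longrightarrow> 60 * (real n + 1) \<le> eta * (t - a) \<Longrightarrow>
    separated_near (lam (of_real t)) (n\<^sup>2) (cmod (deriv lam (of_real t)))"
proof -
  obtain T where T: "T > a" "\<And>t n. T \<le> t \<Longrightarrow> 60 * (real n + 1) \<le> eta * (t - a) \<Longrightarrow>
    \<exists>S. finite S \<and> S \<subseteq> L \<inter> cball (of_real t) (eta * (t - a)) \<and> card S = n\<^sup>2 \<and> (\<forall>x\<in>S. \<forall>y\<in>S. x \<noteq> y \<longrightarrow> 4 \<le> dist x y)"
  proof (rule grid_in_L)
    fix T assume h: "T > a" "\<And>t n. T \<le> t \<Longrightarrow> 60 * (real n + 1) \<le> eta * (t - a) \<Longrightarrow>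
      \<exists>S. finite S \<and> S \<subseteq> L \<inter> cball (of_real t) (eta * (t - a)) \<and> card S = n\<^sup>2 \<and> (\<forall>x\<in>S. \<forall>y\<in>S. x \<noteq> y \<longrightarrow> 4 \<le> dist x y)"
    show ?thesis by (rule that[OF h])
  qed
  show ?thesis
  proof (rule that[OF T(1)])
    fix t n assume t: "T \<le> t" and n: "60 * (real n + 1) \<le> eta * (t - a)"
    let ?v = "complex_of_real t"
    have a: "a < Re ?v" using T(1) t by simp
    obtain S where S: "finite S" "S \<subseteq> L \<inter> cball ?v (eta * (t - a))" "card S = n\<^sup>2"
      "\<forall>x\<in>S. \<forall>y\<in>S. x \<noteq> y \<longrightarrow> 4 \<le> dist x y" using T(2)[OF t n] by (elim exE conjE)
    have inb: "p \<in> cball ?v (eta * (Re ?v - a))" if "p \<in> S" for p using subsetD[OF S(2) that] by simp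
    have small: "eta * (t - a) < t - a"
    proof -
      have "eta * (t - a) \<le> 1/100 * (t - a)" using eta a by (intro mult_right_mono) auto
      then show ?thesis using a by simp
    qed
    have ra: "a < Re p" if "p \<in> S" for p
      using subsetD[OF cball_subset_H[of "eta * (t - a)" ?v] , of p] small inb[OF that] by simp
    have dpos: "cmod (deriv lam ?v) > 0" using deriv_nz[OF a] by simp
    have sep: "2 * cmod (deriv lam ?v) \<le> dist (lam p) (lam q)" if "p \<in> S" "q \<in> S" "p \<noteq> q" for p q
    proof -
      have "cmod (deriv lam ?v) / 2 * 4 \<le> cmod (deriv lam ?v) / 2 * dist p q"
        using S(4) that by (intro mult_left_mono) auto
      also have "\<dots> \<le> dist (lam p) (lam q)" by (rule expand_near[OF a inb[OF that(1)] inb[OF that(2)]])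
      finally show ?thesis by simp
    qed
    have "inj_on lam S" using inj_lam by (rule inj_on_subset) (use ra in auto)
    then have "card (lam ` S) = n\<^sup>2" using S(3) by (simp add: card_image)
    moreover have "lam ` S \<subseteq> L \<inter> cball (lam ?v) 1"
    proof
      fix z assume "z \<in> lam ` S"
      then obtain p where p: "p \<in> S" "z = lam p" by blast
      have "z \<in> L" unfolding p(2) using S(2) p(1) ra by (intro L_lam) auto
      have "dist (lam ?v) (lam p) \<le> 3/2 * cmod (deriv lam ?v) * dist ?v p"
        by (rule lipschitz_near[OF a _ inb[OF p(1)]]) (use a eta in simp)
      also have "\<dots> \<le> 3/2 * (12 * pi / (t - a)) * (1/100 * (t - a))"
      proof (intro mult_mono)
        show "cmod (deriv lam ?v) \<le> 12 * pi / (t - a)" using deriv_upper[OF a] by simp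
        have "dist ?v p \<le> eta * (t - a)" using inb[OF p(1)] by simp
        also have "\<dots> \<le> 1/100 * (t - a)" using eta a by (intro mult_right_mono) auto
        finally show "dist ?v p \<le> 1/100 * (t - a)" .
      qed (use a in auto)
      also have "\<dots> = 18/100 * pi" using a by simp
      also have "\<dots> \<le> 1" using pi_less_4 by simp
      finally have "z \<in> cball (lam ?v) 1" by (simp add: p(2))
      with \<open>z \<in> L\<close> show "z \<in> L \<inter> cball (lam ?v) 1" ..
    qed
    moreover have "\<forall>x\<in>lam ` S. \<forall>y\<in>lam ` S. x \<noteq> y \<longrightarrow> cmod (deriv lam ?v) \<le> dist x y"
    proof (intro ballI impI)
      fix x y assume "x \<in> lam ` S" "y \<in> lam ` S" "x \<noteq> y"
      then obtain p q where "p \<in> S" "q \<in> S" "x = lam p" "y = lam q" "p \<noteq> q" by blast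
      then have "2 * cmod (deriv lam ?v) \<le> dist x y" using sep[of p q] by simp
      then show "cmod (deriv lam ?v) \<le> dist x y" using dpos by linarith
    qed
    ultimately show "separated_near (lam ?v) (n\<^sup>2) (cmod (deriv lam ?v))"
      unfolding separated_near_def using S(1) by (intro exI[of _ "lam ` S"]) simp
  qed
qed

end

section \<open>Full dimension near every point of \<open>L\<close>\<close>

lemma full_dim_local_image:
  fixes h :: "complex \<Rightarrow> complex"
  assumes A: "\<And>r. r > 0 \<Longrightarrow> full_dim dist (A \<inter> cball v r)"
    and h: "h holomorphic_on S" "open S" "v \<in> S" "deriv h v \<noteq> 0"
    and im: "\<And>p. p \<in> A \<Longrightarrow> p \<in> S \<Longrightarrow> h p \<in> B" and "r > 0"
  shows "full_dim dist (B \<inter> cball (h v) r)"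
proof -
  obtain \<rho> c where \<rho>: "\<rho> > 0" "c > 0" "cball v \<rho> \<subseteq> S"
    and ex: "\<And>p q. p \<in> cball v \<rho> \<Longrightarrow> q \<in> cball v \<rho> \<Longrightarrow> c * dist p q \<le> dist (h p) (h q)"
  proof (rule holomorphic_expanding_near[OF h])
    fix \<rho> c assume h: "\<rho> > 0" "c > 0" "cball v \<rho> \<subseteq> S"
      "\<And>p q. p \<in> cball v \<rho> \<Longrightarrow> q \<in> cball v \<rho> \<Longrightarrow> c * dist p q \<le> dist (h p) (h q)"
    show ?thesis by (rule that[OF h])
  qed
  have "isCont h v"
    using holomorphic_on_imp_continuous_on[OF h(1)] h(2,3) continuous_on_eq_continuous_at by blast
  then obtain d where d: "d > 0" "\<And>p. dist p v < d \<Longrightarrow> dist (h p) (h v) < r"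
    using \<open>r > 0\<close> unfolding continuous_at_eps_delta by metis
  define r' where "r' = min \<rho> (d / 2)"
  have r': "r' > 0" "cball v r' \<subseteq> cball v \<rho>" using \<rho> d(1) by (auto simp: r'_def)
  have rd: "dist p v < d" if "p \<in> cball v r'" for p
    using that d(1) by (auto simp: r'_def dist_commute)
  show ?thesis
  proof (rule full_dim_image[OF A[OF r'(1)] \<rho>(2)])
    show "h ` (A \<inter> cball v r') \<subseteq> B \<inter> cball (h v) r"
    proof
      fix z assume "z \<in> h ` (A \<inter> cball v r')"
      then obtain p where p: "p \<in> A" "p \<in> cball v r'" "z = h p" by blast
      have "p \<in> S" using p(2) r'(2) \<rho>(3) by blast
      then have "z \<in> B" using im p by simp
      moreover have "z \<in> cball (h v) r" using d(2)[OF rd[OF p(2)]] p(3) by (simp add: dist_commute)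
      ultimately show "z \<in> B \<inter> cball (h v) r" ..
    qed
    show "c * dist x y \<le> dist (h x) (h y)" if "x \<in> A \<inter> cball v r'" "y \<in> A \<inter> cball v r'" for x y
      using that r'(2) by (intro ex) auto
  qed simp
qed

lemma chordal_ge_dist:
  assumes "cmod p \<le> R" "cmod q \<le> R"
  shows "2 / (1 + R\<^sup>2) * dist p q \<le> chordal (Some p) (Some q)"
proof -
  have "(1 + (cmod p)\<^sup>2) * (1 + (cmod q)\<^sup>2) \<le> (1 + R\<^sup>2) * (1 + R\<^sup>2)"
    using assms by (intro mult_mono add_left_mono power_mono) auto
  then have "sqrt ((1 + (cmod p)\<^sup>2) * (1 + (cmod q)\<^sup>2)) \<le> sqrt ((1 + R\<^sup>2) * (1 + R\<^sup>2))"
    by (rule real_sqrt_le_mono)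
  also have "\<dots> = 1 + R\<^sup>2" by simp
  finally have le: "sqrt ((1 + (cmod p)\<^sup>2) * (1 + (cmod q)\<^sup>2)) \<le> 1 + R\<^sup>2" .
  have pos: "0 < sqrt ((1 + (cmod p)\<^sup>2) * (1 + (cmod q)\<^sup>2))"
    by (simp add: add_pos_nonneg)
  have "2 * cmod (p - q) / (1 + R\<^sup>2) \<le> 2 * cmod (p - q) / sqrt ((1 + (cmod p)\<^sup>2) * (1 + (cmod q)\<^sup>2))"
    using le pos by (intro divide_left_mono mult_pos_pos) (auto simp: add_pos_nonneg)
  then show ?thesis by (simp add: dist_norm)
qed

lemma closed_julia: "closed (julia f)"
proof -
  have "open (fatou f)"
    unfolding open_subopen[of "fatou f"]
  proof
    fix z assume "z \<in> fatou f"
    then obtain U where "open U" "z \<in> U" "\<forall>n. \<forall>w\<in>U. iter f n w \<noteq> None" "normal_seq U (iter f)"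
      by (auto simp: fatou_def)
    then have "open U \<and> z \<in> U \<and> U \<subseteq> fatou f" unfolding fatou_def by blast
    then show "\<exists>T. open T \<and> z \<in> T \<and> T \<subseteq> fatou f" by blast
  qed
  then have "closed (- fatou f)" by (rule closed_Compl)
  then show ?thesis by (simp add: julia_def Compl_eq_Diff_UNIV)
qed

context log_tract
begin

lemma full_dim_L_far:
  obtains X where "X > a" "\<And>w. X \<le> Re w \<Longrightarrow> 20 \<le> eta * (Re w - a)"
    "\<And>w. X \<le> Re w \<Longrightarrow> cmod (deriv lam w) \<le> 1/8"
    "\<And>w. X \<le> Re w \<Longrightarrow> full_dim dist (L \<inter> cball w 7)"
proof -
  obtain X where X: "X > a" "X \<ge> 1"
    "\<And>w. X \<le> Re w \<Longrightarrow> 20 \<le> eta * (Re w - a)"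
    "\<And>w. X \<le> Re w \<Longrightarrow> cmod (deriv lam w) \<le> 1/8"
    "\<And>w. X \<le> Re w \<Longrightarrow> \<bar>Im w\<bar> \<le> pi \<Longrightarrow> Re (lam w) \<le> Re w - 1"
    "\<And>w. X \<le> Re w \<Longrightarrow> \<bar>Im w\<bar> \<le> pi \<Longrightarrow> X \<le> Re (lam w) \<Longrightarrow>
        Re w powr (- K) \<le> cmod (deriv lam w) / 2 * Re (lam w) powr (- K)"
  proof (rule constants)
    fix X assume h: "X > a" "X \<ge> 1"
      "\<And>w. X \<le> Re w \<Longrightarrow> 20 \<le> eta * (Re w - a)"
      "\<And>w. X \<le> Re w \<Longrightarrow> cmod (deriv lam w) \<le> 1/8"
      "\<And>w. X \<le> Re w \<Longrightarrow> \<bar>Im w\<bar> \<le> pi \<Longrightarrow> Re (lam w) \<le> Re w - 1"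
      "\<And>w. X \<le> Re w \<Longrightarrow> \<bar>Im w\<bar> \<le> pi \<Longrightarrow> X \<le> Re (lam w) \<Longrightarrow>
      Re w powr (- K) \<le> cmod (deriv lam w) / 2 * Re (lam w) powr (- K)"
    show ?thesis by (rule that[OF h])
  qed
  show ?thesis
  proof (rule that[OF X(1,3,4)])
    fix w0 assume w0: "X \<le> Re w0"
    obtain c where c: "c > 0"
      "\<And>v n \<delta>. X \<le> Re v \<Longrightarrow> \<delta> > 0 \<Longrightarrow> separated_near v n \<delta> \<Longrightarrow>
         \<exists>w. Re w0 \<le> Re w \<and> Re w \<le> Re w0 + 2 \<and> separated_near w n (c * Re v powr (- K) * \<delta>)"
    proof (rule pull_back[OF X w0])
      fix c assume h: "c > 0"
        "\<And>v n \<delta>. X \<le> Re v \<Longrightarrow> \<delta> > 0 \<Longrightarrow> separated_near v n \<delta> \<Longrightarrow>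
        \<exists>w. Re w0 \<le> Re w \<and> Re w \<le> Re w0 + 2 \<and> separated_near w n (c * Re v powr (- K) * \<delta>)"
      show ?thesis by (rule that[OF h])
    qed
    obtain T1 where T1: "T1 > a" "\<And>t n. T1 \<le> t \<Longrightarrow> 60 * (real n + 1) \<le> eta * (t - a) \<Longrightarrow>
      separated_near (lam (of_real t)) (n\<^sup>2) (cmod (deriv lam (of_real t)))"
    proof (rule separated_near_lam_grid)
      fix T1 assume h: "T1 > a" "\<And>t n. T1 \<le> t \<Longrightarrow> 60 * (real n + 1) \<le> eta * (t - a) \<Longrightarrow>
        separated_near (lam (of_real t)) (n\<^sup>2) (cmod (deriv lam (of_real t)))"
      show ?thesis by (rule that[OF h])
    qed
    obtain B T2 where T2: "B > 0" "T2 \<ge> 1"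
      "\<And>w. T2 \<le> Re w \<Longrightarrow> \<bar>Im w\<bar> \<le> pi \<Longrightarrow> Re (lam w) \<le> B * ln (Re w)"
    proof (rule lam_strip)
      fix B T2 assume h: "B > 0" "T2 \<ge> 1"
        "\<And>w. T2 \<le> Re w \<Longrightarrow> \<bar>Im w\<bar> \<le> pi \<Longrightarrow> Re (lam w) \<le> B * ln (Re w)"
      show ?thesis by (rule that[OF h])
    qed
    have K0: "K \<ge> 0" using univalent_const_ge by (simp add: K_def)
    show "full_dim dist (L \<inter> cball w0 7)"
      unfolding full_dim_def
    proof (intro allI impI)
      fix e b :: real assume e: "e > 0" and b: "b > 0"
      \<comment> \<open>With n of order t and \<delta> = t powr (- 1 - 2 * \<epsilon>), one
        \<epsilon> pays for \<open>deriv_often_large\<close> and the other for the factor (log t)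
        powr (- K) lost in \<open>pull_back\<close>. The count n^2 then suffices as soon as
        \<open>\<delta> powr (e - 2)\<close>, which is t powr q, has q < 2.\<close>
      define \<epsilon> where "\<epsilon> = e / 8"
      have \<epsilon>: "\<epsilon> > 0" using e by (simp add: \<epsilon>_def)
      define q where "q = (- 1 - 2 * \<epsilon>) * (e - 2)"
      have q: "q < 2"
      proof -
        have "q = 2 - e / 2 - e * e / 4" by (simp add: q_def \<epsilon>_def field_simps)
        moreover have "e * e > 0" using e by simp
        ultimately show ?thesis using e by linarith
      qed
      have ev1: "\<forall>\<^sub>F t in at_top. t powr (- 1 - 2 * \<epsilon>) < b" using b \<epsilon> by real_asymp
      have ev2: "\<forall>\<^sub>F t in at_top. 2 * t powr (- 1 - 2 * \<epsilon>) \<le> c * (B * ln t) powr (- K) * t powr (- 1 - \<epsilon>)"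
        using c(1) T2(1) \<epsilon> by real_asymp
      have ev3: "\<forall>\<^sub>F t in at_top. t powr q \<le> (eta * (t - a) / 60 - 2)\<^sup>2"
        using q eta(1) by real_asymp
      have ev4: "\<forall>\<^sub>F t in at_top. 2 \<le> eta * (t - a) / 60" using eta(1) by real_asymp
      have ev5: "\<forall>\<^sub>F t in at_top. X \<le> Re (lam (of_real t))"
        using Re_lam_at_top unfolding filterlim_at_top by blast
      have "\<forall>\<^sub>F t in at_top. t powr (- 1 - 2 * \<epsilon>) < b \<and>
         2 * t powr (- 1 - 2 * \<epsilon>) \<le> c * (B * ln t) powr (- K) * t powr (- 1 - \<epsilon>) \<and>
         t powr q \<le> (eta * (t - a) / 60 - 2)\<^sup>2 \<and> 2 \<le> eta * (t - a) / 60 \<and>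
         X \<le> Re (lam (of_real t)) \<and> T1 \<le> t \<and> T2 \<le> t"
        by (intro eventually_conj ev1 ev2 ev3 ev4 ev5 eventually_ge_at_top)
      then obtain T where T: "\<And>t. T \<le> t \<Longrightarrow> t powr (- 1 - 2 * \<epsilon>) < b \<and>
         2 * t powr (- 1 - 2 * \<epsilon>) \<le> c * (B * ln t) powr (- K) * t powr (- 1 - \<epsilon>) \<and>
         t powr q \<le> (eta * (t - a) / 60 - 2)\<^sup>2 \<and> 2 \<le> eta * (t - a) / 60 \<and>
         X \<le> Re (lam (of_real t)) \<and> T1 \<le> t \<and> T2 \<le> t"
        unfolding eventually_at_top_linorder by auto
      obtain t where tT: "T \<le> t" and big: "t powr (- 1 - \<epsilon>) \<le> cmod (deriv lam (of_real t))"
        using deriv_often_large[OF \<epsilon>, of T] by blast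
      note t = T[OF tT]
      have t1: "t \<ge> 1" using t T2(2) by linarith
      define \<delta> where "\<delta> = t powr (- 1 - 2 * \<epsilon>)"
      have \<delta>: "0 < \<delta>" "\<delta> < b" using t t1 by (simp_all add: \<delta>_def)
      define n where "n = nat \<lfloor>eta * (t - a) / 60 - 1\<rfloor>"
      have n: "real n \<le> eta * (t - a) / 60 - 1" "eta * (t - a) / 60 - 2 \<le> real n"
        using t unfolding n_def by linarith+
      have n60: "60 * (real n + 1) \<le> eta * (t - a)" using n(1) by simp
      have "separated_near (lam (of_real t)) (n\<^sup>2) (cmod (deriv lam (of_real t)))"
        by (rule T1(2)[OF _ n60]) (use t in simp)
      then have s1: "separated_near (lam (of_real t)) (n\<^sup>2) (t powr (- 1 - \<epsilon>))"
        using big by (rule separated_near_mono)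
      have "t powr (- 1 - \<epsilon>) > 0" using t1 by simp
      then obtain w where w: "Re w0 \<le> Re w" "Re w \<le> Re w0 + 2"
        "separated_near w (n\<^sup>2) (c * Re (lam (of_real t)) powr (- K) * t powr (- 1 - \<epsilon>))"
        using c(2)[OF _ _ s1] t by blast
      have Re_le: "Re (lam (of_real t)) \<le> B * ln t" using T2(3)[of "of_real t"] t by simp
      have "(B * ln t) powr (- K) \<le> Re (lam (of_real t)) powr (- K)"
        using Re_le t X(2) K0 by (intro powr_mono2') auto
      then have "c * (B * ln t) powr (- K) * t powr (- 1 - \<epsilon>) \<le> c * Re (lam (of_real t)) powr (- K) * t powr (- 1 - \<epsilon>)"
        using c(1) by (intro mult_right_mono mult_left_mono) auto
      then have "2 * \<delta> \<le> c * Re (lam (of_real t)) powr (- K) * t powr (- 1 - \<epsilon>)" using t by (simp add: \<delta>_def)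
      with w(3) have s2: "separated_near w (n\<^sup>2) (2 * \<delta>)" by (rule separated_near_mono)
      obtain k where k: "\<bar>Im (w - w0 - 2 * of_real pi * \<i> * of_int k)\<bar> \<le> pi" using im_shift by blast
      \<comment> \<open>\<open>pull_back\<close> controls only the real part, up to 2. A vertical
        translation brings the imaginary part within 4 of that of \<open>w0\<close>, so the unit
        disc about \<open>w'\<close> lies within 2 + 4 + 1 = 7 of \<open>w0\<close>.\<close>
      define w' where "w' = w + 2 * of_real pi * \<i> * of_int (- k)"
      have s3: "separated_near w' (n\<^sup>2) (2 * \<delta>)"
        unfolding w'_def by (rule separated_near_shift[OF s2]) (use \<delta> in simp)
      have "\<bar>Im (w' - w0)\<bar> \<le> 4" using k pi_less_4 by (simp add: w'_def)
      moreover have "\<bar>Re (w' - w0)\<bar> \<le> 2" using w by (simp add: w'_def)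
      ultimately have w'w0: "dist w0 w' \<le> 6" using cmod_le[of "w' - w0"] by (simp add: dist_norm norm_minus_commute)
      obtain S where S: "finite S" "S \<subseteq> L \<inter> cball w' 1" "card S = n\<^sup>2" "\<forall>x\<in>S. \<forall>y\<in>S. x \<noteq> y \<longrightarrow> 2 * \<delta> \<le> dist x y"
        using s3 unfolding separated_near_def by (elim exE conjE)
      have "cball w' 1 \<subseteq> cball w0 7"
      proof
        fix p assume "p \<in> cball w' 1"
        then show "p \<in> cball w0 7" using w'w0 dist_triangle[of w0 p w'] by simp
      qed
      then have sub: "S \<subseteq> L \<inter> cball w0 7" using S(2) by blast
      have sep: "\<forall>x\<in>S. \<forall>y\<in>S. x \<noteq> y \<longrightarrow> \<delta> < dist x y"
      proof (intro ballI impI)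
        fix x y assume "x \<in> S" "y \<in> S" "x \<noteq> y"
        then have "2 * \<delta> \<le> dist x y" using S(4) by simp
        then show "\<delta> < dist x y" using \<delta>(1) by linarith
      qed
      have card: "\<delta> powr (e - 2) \<le> real (card S)"
      proof -
        have "\<delta> powr (e - 2) = t powr q" by (simp add: \<delta>_def q_def powr_powr)
        also have "\<dots> \<le> (eta * (t - a) / 60 - 2)\<^sup>2" using t by simp
        also have "\<dots> \<le> (real n)\<^sup>2" using t n(2) by (intro power_mono) auto
        finally show ?thesis using S(3) by simp
      qed
      show "\<exists>\<delta>>0. \<delta> < b \<and> (\<exists>S. finite S \<and> S \<subseteq> L \<inter> cball w0 7 \<and>
        (\<forall>x\<in>S. \<forall>y\<in>S. x \<noteq> y \<longrightarrow> \<delta> < dist x y) \<and> \<delta> powr (e - 2) \<le> real (card S))"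
        using \<delta> S(1) sub sep card by (intro exI[of _ \<delta>] exI[of _ S] conjI)
    qed
  qed
qed

text \<open>\<open>full_dim_L_far\<close> does not say where in a disc of radius 7 the dimension
  sits. Applied at \<open>u (n + j)\<close> and followed by j contracting branches back to
  \<open>u n\<close>, it yields full dimension in discs of radius 7 / 2^j, hence in every disc about
  \<open>u n\<close>, for large n.\<close>

lemma full_dim_L:
  assumes "w \<in> L" "r > 0"
  shows "full_dim dist (L \<inter> cball w r)"
proof -
  obtain X where X: "X > a" "\<And>w. X \<le> Re w \<Longrightarrow> 20 \<le> eta * (Re w - a)"
    "\<And>w. X \<le> Re w \<Longrightarrow> cmod (deriv lam w) \<le> 1/8"
    "\<And>w. X \<le> Re w \<Longrightarrow> full_dim dist (L \<inter> cball w 7)"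
  proof (rule full_dim_L_far)
    fix X assume h: "X > a" "\<And>w. X \<le> Re w \<Longrightarrow> 20 \<le> eta * (Re w - a)"
      "\<And>w. X \<le> Re w \<Longrightarrow> cmod (deriv lam w) \<le> 1/8"
      "\<And>w. X \<le> Re w \<Longrightarrow> full_dim dist (L \<inter> cball w 7)"
    show ?thesis by (rule that[OF h])
  qed
  obtain u where u: "orbit u" "u 0 = w" using assms(1) by (auto simp: L_def)
  have ua: "a < Re (u (Suc n))" and ueq: "exp (lam (u (Suc n))) = exp (u n)" for n
    using u(1) by (auto simp: orbit_def)
  have "\<exists>k::int. u n = lam (u (Suc n)) + 2 * of_real pi * \<i> * of_int k" for n
    using ueq[of n] exp_eq[of "u n" "lam (u (Suc n))"] by (auto simp: algebra_simps)
  then obtain k :: "nat \<Rightarrow> int" where k: "\<And>n. u n = lam (u (Suc n)) + 2 * of_real pi * \<i> * of_int (k n)" by metis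
  define g where "g n p = lam p + 2 * of_real pi * \<i> * of_int (k n)" for n p
  have gu: "g n (u (Suc n)) = u n" for n by (simp add: g_def k[symmetric])
  have gL: "g n p \<in> L" if "p \<in> L" "a < Re p" for n p
    unfolding g_def using L_shift[OF L_lam[OF that]] .
  have "\<forall>\<^sub>F n in sequentially. X \<le> Re (u n)"
    using u(1) unfolding orbit_def filterlim_at_top by blast
  then obtain n0 where n0: "\<And>n. n0 \<le> n \<Longrightarrow> X \<le> Re (u n)" unfolding eventually_sequentially by blast
  have shrink: "full_dim dist (L \<inter> cball (u n) (7 / 2 ^ j))" if "n0 \<le> n" for n j
    using that
  proof (induction j arbitrary: n)
    case 0
    then show ?case using X(4)[OF n0] by simp
  next
    case (Suc j)
    have le: "n0 \<le> Suc n" using Suc.prems by simp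
    have small: "(7::real) / 2 ^ j \<le> 20"
    proof -
      have "(1::real) \<le> 2 ^ j" by simp
      then have "7 / 2 ^ j \<le> 7 / (1::real)" by (intro divide_left_mono) auto
      then show ?thesis by simp
    qed
    have inb: "p \<in> cball (u (Suc n)) (eta * (Re (u (Suc n)) - a))" if "p \<in> cball (u (Suc n)) (7 / 2 ^ j)" for p
      using that small X(2)[OF n0[OF le]] by simp
    show ?case
    proof (rule full_dim_image[OF Suc.IH[OF le]])
      show "0 < cmod (deriv lam (u (Suc n))) / 2" using deriv_nz[OF ua] by simp
      show "g n ` (L \<inter> cball (u (Suc n)) (7 / 2 ^ j)) \<subseteq> L \<inter> cball (u n) (7 / 2 ^ Suc j)"
      proof
        fix z assume "z \<in> g n ` (L \<inter> cball (u (Suc n)) (7 / 2 ^ j))"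
        then obtain p where p: "p \<in> L" "p \<in> cball (u (Suc n)) (7 / 2 ^ j)" "z = g n p" by blast
        have "eta * (Re (u (Suc n)) - a) \<le> 1/100 * (Re (u (Suc n)) - a)"
          using eta ua[of n] by (intro mult_right_mono) auto
        then have "eta * (Re (u (Suc n)) - a) < Re (u (Suc n)) - a" using ua[of n] by simp
        then have "a < Re p" using subsetD[OF cball_subset_H inb[OF p(2)]] by simp
        then have "z \<in> L" using gL p by simp
        have "dist (g n (u (Suc n))) (g n p) = dist (lam (u (Suc n))) (lam p)" by (simp add: g_def dist_norm)
        also have "\<dots> \<le> 3/2 * cmod (deriv lam (u (Suc n))) * dist (u (Suc n)) p"
          by (rule lipschitz_near[OF ua inb inb[OF p(2)]]) simp
        also have "\<dots> \<le> 3/2 * (1/8) * (7 / 2 ^ j)"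
          using X(3)[OF n0[OF le]] p(2) by (intro mult_mono) auto
        also have "\<dots> \<le> 7 / 2 ^ Suc j" by (simp add: field_simps)
        finally have "z \<in> cball (u n) (7 / 2 ^ Suc j)" by (simp only: gu p(3) mem_cball)
        with \<open>z \<in> L\<close> show "z \<in> L \<inter> cball (u n) (7 / 2 ^ Suc j)" ..
      qed
      show "cmod (deriv lam (u (Suc n))) / 2 * dist x y \<le> dist (g n x) (g n y)"
        if "x \<in> L \<inter> cball (u (Suc n)) (7 / 2 ^ j)" "y \<in> L \<inter> cball (u (Suc n)) (7 / 2 ^ j)" for x y
        using expand_near[OF ua[of n], of x y] inb that by (simp add: g_def dist_norm)
    qed simp
  qed
  have base: "full_dim dist (L \<inter> cball (u n0) r)" if r: "r > 0" for r
  proof -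
    have "(\<lambda>j. 7 * (1/2) ^ j) \<longlonglongrightarrow> 7 * (0::real)"
      by (intro tendsto_mult tendsto_const LIMSEQ_power_zero) simp
    then have "\<forall>\<^sub>F j in sequentially. 7 * (1/2) ^ j < r"
      by (rule order_tendstoD) (use r in simp)
    then obtain j where "7 * (1/2) ^ j < r" unfolding eventually_sequentially by blast
    then have "cball (u n0) (7 / 2 ^ j) \<subseteq> cball (u n0) r"
      by (intro subset_cball) (simp add: power_divide)
    then show ?thesis by (intro full_dim_mono[OF shrink[OF order_refl, of j]]) auto
  qed
  \<comment> \<open>Before index \<open>n0\<close> no contraction estimate is available. Only
    finitely many branches remain, and each is locally bi-Lipschitz because its derivative does not
    vanish.\<close>
  have "\<forall>r>0. full_dim dist (L \<inter> cball (u m) r)" if "m \<le> n0" for m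
    using that
  proof (induction rule: inc_induct)
    case base
    show ?case using \<open>\<And>r. r > 0 \<Longrightarrow> full_dim dist (L \<inter> cball (u n0) r)\<close> by simp
  next
    case (step n)
    have dg: "(g n has_field_derivative deriv lam (u (Suc n))) (at (u (Suc n)))"
      unfolding g_def using has_deriv[OF ua] by (auto intro!: derivative_eq_intros)
    have near: "full_dim dist (L \<inter> cball (u (Suc n)) s)" if "s > 0" for s using step.IH that by simp
    have hol_g: "g n holomorphic_on H" unfolding g_def by (intro holomorphic_intros hol)
    have uH: "u (Suc n) \<in> H" using ua by simp
    have dnz: "deriv (g n) (u (Suc n)) \<noteq> 0" using DERIV_imp_deriv[OF dg] deriv_nz[OF ua] by simp
    have im: "g n p \<in> L" if "p \<in> L" "p \<in> H" for p using gL that by simp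
    have "full_dim dist (L \<inter> cball (g n (u (Suc n))) s)" if "s > 0" for s
      by (rule full_dim_local_image[OF near hol_g open_H uH dnz im that])
    then show ?case by (simp add: gu)
  qed
  from this[of 0] assms(2) show ?thesis by (simp add: u(2))
qed

lemma full_dim_exp_L:
  assumes "z \<in> exp ` L" "r > 0"
  shows "full_dim dist (exp ` L \<inter> cball z r)"
proof -
  obtain w where w: "w \<in> L" "z = exp w" using assms(1) by blast
  have "full_dim dist (exp ` L \<inter> cball (exp w) r)"
  proof (rule full_dim_local_image[where S = UNIV and h = exp])
    show "deriv exp w \<noteq> 0" using DERIV_imp_deriv[OF DERIV_exp[of w]] by simp
  qed (use full_dim_L[OF w(1)] assms(2) in \<open>auto intro: holomorphic_intros\<close>)
  then show ?thesis by (simp add: w(2))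
qed

lemma L_nonempty: "L \<noteq> {}"
proof -
  obtain X1 where "\<And>x. X1 \<le> x \<Longrightarrow> \<exists>p\<in>L. cmod (p - of_real x) \<le> 2 * pi"
  proof (rule L_near_real)
    fix X1 assume h: "\<And>x. X1 \<le> x \<Longrightarrow> \<exists>p\<in>L. cmod (p - of_real x) \<le> 2 * pi"
    show ?thesis by (rule that[OF h])
  qed
  then show ?thesis by (metis empty_iff order_refl)
qed

lemma exp_L_subset: "exp ` L \<subseteq> escaping f \<inter> julia f"
  using orbit_escaping orbit_julia by (auto simp: L_def)

lemma upper_box_dim_and_packing_dim:
  "upper_box_dim (\<lambda>a b. chordal (Some a) (Some b)) (escaping f \<inter> julia f) = 2"
  "packing_dim (julia f) = 2"
proof -
  obtain z where z: "z \<in> exp ` L" using L_nonempty by blast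
  \<comment> \<open>On a bounded part of the plane the chordal and Euclidean metrics are comparable,
    so a single disc about a point of the image of \<open>L\<close> decides the box
    dimension.\<close>
  define R where "R = cmod z + 1"
  have R: "cmod p \<le> R" if "p \<in> cball z 1" for p
    using that norm_triangle_ineq2[of p z] by (simp add: R_def dist_norm norm_minus_commute)
  have R0: "2 / (1 + R\<^sup>2) > 0" by (simp add: add_pos_nonneg)
  have "full_dim dist (exp ` L \<inter> cball z 1)" by (rule full_dim_exp_L[OF z]) simp
  then have "full_dim (\<lambda>a b. chordal (Some a) (Some b)) (escaping f \<inter> julia f)"
  proof (rule full_dim_image[OF _ R0, where g = id])
    show "2 / (1 + R\<^sup>2) * dist x y \<le> chordal (Some (id x)) (Some (id y))"
      if "x \<in> exp ` L \<inter> cball z 1" "y \<in> exp ` L \<inter> cball z 1" for x y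
      using that chordal_ge_dist[OF R R, of x y] by simp
  qed (use exp_L_subset in auto)
  then show "upper_box_dim (\<lambda>a b. chordal (Some a) (Some b)) (escaping f \<inter> julia f) = 2"
    using full_dim_imp_upper_box_dim_ge upper_box_dim_chordal_le_two by (metis antisym)
  have "2 \<le> packing_dim (julia f)"
  proof (rule packing_dim_ge_two)
    \<comment> \<open>Baire's theorem needs a closed set. The closure stays in the Julia set, and
      every open set that meets it contains a disc about a point of the image of \<open>L\<close>
      itself.\<close>
    show "closed (closure (exp ` L))" by simp
    show "closure (exp ` L) \<noteq> {}" using z closure_subset by blast
    show "closure (exp ` L) \<subseteq> julia f"
      using closure_minimal[OF _ closed_julia] exp_L_subset by blast
    fix D :: "complex set" assume D: "open D" "D \<inter> closure (exp ` L) \<noteq> {}"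
    then obtain y where y: "y \<in> D" "y \<in> exp ` L" using open_Int_closure_eq_empty[OF D(1), of "exp ` L"] by blast
    then obtain r where r: "r > 0" "cball y r \<subseteq> D"
      using open_contains_cball[THEN iffD1, OF D(1)] by auto
    have "exp ` L \<inter> cball y r \<subseteq> D \<inter> closure (exp ` L)"
      by (rule Int_greatest[OF le_infI2[OF r(2)] le_infI1[OF closure_subset]])
    then show "full_dim dist (D \<inter> closure (exp ` L))"
      by (rule full_dim_mono[OF full_dim_exp_L[OF y(2) r(1)]])
  qed
  then show "packing_dim (julia f) = 2" using packing_dim_le_two by (metis antisym)
qed

end

section \<open>From logarithmic singularities to tracts\<close>

lemma chordal_None_less:
  assumes "r > 0" "2 / r < cmod w"
  shows "chordal (Some w) None < r"
proof -
  have "2 / r < sqrt (1 + (cmod w)\<^sup>2)"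
    using assms(2) real_sqrt_le_mono[of "(cmod w)\<^sup>2" "1 + (cmod w)\<^sup>2"] by simp
  moreover have "0 < sqrt (1 + (cmod w)\<^sup>2)" by (simp add: add_pos_nonneg)
  ultimately show ?thesis using assms(1) by (simp add: field_simps)
qed

text \<open>At a pole this holds because \<open>f\<close> tends to infinity, elsewhere by
  continuity. It makes the tract open, as a component of an open set.\<close>

lemma open_large_set:
  assumes f: "meromorphic_plane f" and r: "r > 0"
  shows "open {z. chordal (fext f (Some z)) None < r}"
  unfolding open_subopen[of "{z. chordal (fext f (Some z)) None < r}"]
proof
  let ?A = "{z. chordal (fext f (Some z)) None < r}"
  fix z assume z: "z \<in> ?A"
  have "\<forall>\<^sub>F w in at z. w \<in> ?A"
  proof (cases "is_pole f z")
    case True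
    then have large: "\<forall>M>0. \<forall>\<^sub>F w in at z. M \<le> cmod (f w)"
      unfolding is_pole_def filterlim_at_infinity[OF order_refl] .
    have "0 < 2 / r + 1" using r by (simp add: add_pos_pos)
    then have "\<forall>\<^sub>F w in at z. 2 / r + 1 \<le> cmod (f w)" by (rule large[THEN spec, THEN mp])
    then show ?thesis
    proof eventually_elim
      case (elim w)
      then have "chordal (Some (f w)) None < r" using r by (intro chordal_None_less) auto
      then show ?case using r by (simp add: fext_def)
    qed
  next
    case False
    then have "isCont f z" using f by (simp add: meromorphic_plane_def)
    then have lim: "(f \<longlongrightarrow> f z) (at z)" by (simp add: isCont_def)
    have "((\<lambda>w. 2 / sqrt (1 + (cmod (f w))\<^sup>2)) \<longlongrightarrow> 2 / sqrt (1 + (cmod (f z))\<^sup>2)) (at z)"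
      by (intro tendsto_intros lim) (simp add: add_pos_nonneg less_imp_neq[symmetric])
    moreover have "2 / sqrt (1 + (cmod (f z))\<^sup>2) < r" using z False by (simp add: fext_def)
    ultimately have "\<forall>\<^sub>F w in at z. 2 / sqrt (1 + (cmod (f w))\<^sup>2) < r" by (rule order_tendstoD)
    then show ?thesis by eventually_elim (use r in \<open>simp add: fext_def\<close>)
  qed
  with z have "\<forall>\<^sub>F w in nhds z. w \<in> ?A" by (simp add: eventually_nhds_conv_at)
  then show "\<exists>T. open T \<and> z \<in> T \<and> T \<subseteq> ?A" unfolding eventually_nhds by blast
qed

text \<open>Lifting the identity through the covering gives a continuous global inverse, so
  \<open>f\<close> tends to infinity at infinity. This excludes the degenerate radius in
  \<open>log_tract_exists\<close> for which the spherical disc without its centre is the whole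
  plane.\<close>

lemma covering_space_of_plane_imp_polynomial:
  assumes cov: "covering_space UNIV f (UNIV :: complex set)" and hol: "f holomorphic_on UNIV"
  shows "\<exists>p :: complex poly. \<forall>z. f z = poly p z"
proof -
  have lpc: "locally path_connected (UNIV :: complex set)"
    using convex_imp_locally_path_connected convex_UNIV by blast
  have sc: "simply_connected (UNIV :: complex set)" using convex_imp_simply_connected convex_UNIV by blast
  obtain g where g: "continuous_on UNIV g" "g (f 0) = 0" "\<And>y. f (g y) = y"
  proof (rule covering_space_lift_strong[OF cov _ _ sc lpc, where a = 0 and z = "f 0" and f = "\<lambda>y. y"])
    fix g assume h: "continuous_on UNIV g" "g (f 0) = 0" "\<And>y. y \<in> UNIV \<Longrightarrow> f (g y) = y"
    show ?thesis by (rule that[OF h(1,2) h(3)[OF UNIV_I]])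
  qed auto
  have cf: "continuous_on UNIV f" using hol by (rule holomorphic_on_imp_continuous_on)
  have gf: "g (f x) = x" for x
  proof (rule covering_space_lift_unique[OF cov, where T = UNIV and f = f and a = 0 and ?g2.0 = "\<lambda>x. x" and ?g1.0 = "\<lambda>x. g (f x)"])
    show "continuous_on UNIV (\<lambda>x. g (f x))"
      using continuous_on_compose2[OF g(1) cf] by simp
  qed (use g cf in auto)
  have lim: "((inverse \<circ> f) \<longlongrightarrow> 0) at_infinity"
  proof -
    have "filterlim f at_infinity at_infinity"
      unfolding filterlim_at_infinity[OF order_refl]
    proof (intro allI impI)
      fix M :: real
      have "compact (g ` cball 0 M)"
        by (rule compact_continuous_image[OF continuous_on_subset[OF g(1)]]) auto
      then obtain B where B: "\<And>x. x \<in> g ` cball 0 M \<Longrightarrow> cmod x \<le> B"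
        using compact_imp_bounded bounded_iff by metis
      have "M \<le> cmod (f z)" if "B + 1 \<le> cmod z" for z
      proof (rule ccontr)
        assume "\<not> M \<le> cmod (f z)"
        then have "g (f z) \<in> g ` cball 0 M" by (intro imageI) simp
        then show False using B[of z] that by (simp add: gf)
      qed
      then show "\<forall>\<^sub>F z in at_infinity. M \<le> cmod (f z)"
        unfolding eventually_at_infinity by blast
    qed
    then show ?thesis unfolding o_def by (rule tendsto_inverse_0[THEN filterlim_compose])
  qed
  obtain a n where "\<And>z. f z = (\<Sum>i\<le>n. a i * z ^ i)"
    using pole_at_infinity[OF hol lim] by metis
  then have "\<forall>z. f z = poly (\<Sum>i\<le>n. monom (a i) i) z" by (simp add: poly_sum poly_monom)
  then show ?thesis ..
qed

text \<open>The difference of \<open>g\<close> and the identity is continuous with values in the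
  discrete set of multiples of 2 pi i, so it is constant on a connected set.\<close>

lemma exp_left_inverse_const:
  fixes g :: "complex \<Rightarrow> complex"
  assumes "connected S" "continuous_on S g" "\<And>w. w \<in> S \<Longrightarrow> exp (g w) = exp w"
  obtains c where "\<And>w. w \<in> S \<Longrightarrow> g w = w + c"
proof -
  have "(\<lambda>w. g w - w) constant_on S"
  proof (rule continuous_discrete_range_constant[OF assms(1)])
    show "continuous_on S (\<lambda>w. g w - w)" by (intro continuous_intros assms(2))
    fix x assume x: "x \<in> S"
    show "\<exists>e>0. \<forall>y. y \<in> S \<and> g y - y \<noteq> g x - x \<longrightarrow> e \<le> cmod (g y - y - (g x - x))"
    proof (intro exI[of _ 1] conjI allI impI)
      fix y assume y: "y \<in> S \<and> g y - y \<noteq> g x - x"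
      obtain m where m: "g y = y + of_int (2 * m) * pi * \<i>" using assms(3)[of y] y by (auto simp: exp_eq)
      obtain n where n: "g x = x + of_int (2 * n) * pi * \<i>" using assms(3)[of x] x by (auto simp: exp_eq)
      have eq: "g y - y - (g x - x) = of_real (2 * pi * of_int (m - n)) * \<i>"
        unfolding m n by (simp add: algebra_simps)
      have "m \<noteq> n" using y m n by auto
      then have "1 \<le> \<bar>real_of_int (m - n)\<bar>" by linarith
      then have "2 * pi * 1 \<le> 2 * pi * \<bar>real_of_int (m - n)\<bar>" by (intro mult_left_mono) auto
      also have "\<dots> = cmod (g y - y - (g x - x))" unfolding eq norm_mult norm_of_real by (simp add: abs_mult)
      finally show "1 \<le> cmod (g y - y - (g x - x))" using pi_ge_two by linarith
    qed simp
  qed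
  then obtain c where "\<And>w. w \<in> S \<Longrightarrow> g w - w = c" unfolding constant_on_def by blast
  then show ?thesis using that[of c] by (metis add.commute diff_add_cancel)
qed

lemma log_tract_exists:
  assumes f: "meromorphic_plane f" and tr: "transcendental_fn f" and ls: "log_sing_infty f"
  shows "\<exists>lam a. log_tract f lam a"
proof -
  obtain U r where r: "r > 0" and comp: "U \<in> components {z. chordal (fext f (Some z)) None < r}"
    and cov: "covering_space U f {w. chordal (Some w) None < r}" and sc: "simply_connected U"
    using ls unfolding log_sing_infty_def by metis
  define A where "A = {z. chordal (fext f (Some z)) None < r}"
  define W where "W = {w. chordal (Some w) None < r}"
  have "open A" unfolding A_def by (rule open_large_set[OF f r])
  have compA: "U \<in> components A" using comp by (simp add: A_def)
  have "open U" using open_components[OF \<open>open A\<close> compA] .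
  have covW: "covering_space U f W" using cov by (simp add: W_def)
  have cf: "continuous_on U f" by (rule covering_space_imp_continuous[OF covW])
  have fU: "f ` U = W" by (rule covering_space_imp_surjective[OF covW])
  \<comment> \<open>The covering map is continuous with finite values on the open set
    \<open>U\<close>, which is incompatible with \<open>f\<close> tending to infinity at a point of
    \<open>U\<close>.\<close>
  have np: "\<not> is_pole f z" if "z \<in> U" for z
  proof
    assume "is_pole f z"
    then have "filterlim f at_infinity (at z)" by (simp add: is_pole_def)
    moreover have "(f \<longlongrightarrow> f z) (at z)"
      using cf \<open>open U\<close> that continuous_on_eq_continuous_at isCont_def by blast
    ultimately show False using not_tendsto_and_filterlim_at_infinity[of "at z" f "f z"] by simp
  qed
  have holf: "f holomorphic_on U"
  proof (rule analytic_imp_holomorphic)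
    show "f analytic_on U"
      using meromorphic_plane_analytic[OF f np] by (subst analytic_on_analytic_at) blast
  qed
  \<comment> \<open>The chordal distance from 0 to infinity is 2. For r \<le> 2 the covered set
    omits 0, so \<open>f\<close> has a logarithm on \<open>U\<close>; for larger r the tract and the
    covered set would both be the plane.\<close>
  have r2: "r \<le> 2"
  proof (rule ccontr)
    assume "\<not> r \<le> 2"
    have le2: "chordal (Some w) None \<le> 2" for w
    proof -
      have "1 \<le> sqrt (1 + (cmod w)\<^sup>2)" by simp
      then have "2 / sqrt (1 + (cmod w)\<^sup>2) \<le> 2 / 1" by (intro divide_left_mono) (auto intro: add_pos_nonneg)
      then show ?thesis by simp
    qed
    have "chordal (fext f (Some z)) None < r" for z
      using le2[of "f z"] \<open>\<not> r \<le> 2\<close> r by (simp add: fext_def)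
    then have "A = UNIV" by (simp add: A_def)
    then have U: "U = UNIV" using compA by simp
    have "chordal (Some w) None < r" for w using le2[of w] \<open>\<not> r \<le> 2\<close> by linarith
    then have "W = UNIV" unfolding W_def by blast
    with U covW holf obtain p where p: "\<forall>z. f z = poly p z"
      using covering_space_of_plane_imp_polynomial by metis
    have "(1 :: complex poly) \<noteq> 0 \<and> (\<forall>z. poly 1 z \<noteq> 0 \<longrightarrow> f z = poly p z / poly 1 z)"
      using p by simp
    then show False using tr unfolding transcendental_fn_def by blast
  qed
  have W0: "w \<noteq> 0" if "w \<in> W" for w using that r2 by (auto simp: W_def)
  have f0: "f z \<noteq> 0" if "z \<in> U" for z using W0 fU that by blast
  obtain \<phi> where \<phi>: "\<phi> holomorphic_on U" "\<And>z. z \<in> U \<Longrightarrow> f z = exp (\<phi> z)"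
    using simply_connected_eq_holomorphic_log[OF \<open>open U\<close>] sc holf f0 by metis
  \<comment> \<open>|w| > 2 / r is a convenient sufficient condition for w to lie in the spherical
    disc; it turns into a half-plane in the coordinate log w.\<close>
  define a0 where "a0 = ln (2 / r)"
  define H0 where "H0 = {w. a0 < Re w}"
  have convH0: "convex H0" unfolding H0_def by (rule convex_halfspace_Re_gt)
  have openH0: "open H0" unfolding H0_def by (rule open_halfspace_Re_gt)
  have large: "2 / r < cmod (exp w)" if "w \<in> H0" for w
  proof -
    have "exp a0 < exp (Re w)" using that by (simp add: H0_def)
    then show ?thesis using r by (simp add: a0_def)
  qed
  have expW: "exp w \<in> W" if "w \<in> H0" for w
    unfolding W_def using chordal_None_less[OF r large[OF that]] by simp
  \<comment> \<open>Lifting \<open>exp\<close> through the covering gives the inverse branch of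
    \<open>f\<close> in the coordinate log f. Up to a translation it inverts the logarithm \<phi> of
    \<open>f\<close>, which makes it injective.\<close>
  obtain \<psi> where \<psi>: "continuous_on H0 \<psi>" "\<psi> \<in> H0 \<rightarrow> U" "\<And>w. w \<in> H0 \<Longrightarrow> f (\<psi> w) = exp w"
  proof (rule covering_space_lift[OF covW])
    show "simply_connected H0" using convH0 by (rule convex_imp_simply_connected)
    show "locally path_connected H0" using convH0 by (rule convex_imp_locally_path_connected)
    show "continuous_on H0 exp" by (intro continuous_intros)
    show "exp \<in> H0 \<rightarrow> W" using expW by blast
  qed blast
  have \<psi>U: "\<psi> w \<in> U" if "w \<in> H0" for w using \<psi>(2) that by blast
  have c\<phi>: "continuous_on U \<phi>" using \<phi>(1) by (rule holomorphic_on_imp_continuous_on)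
  obtain c where c: "\<And>w. w \<in> H0 \<Longrightarrow> \<phi> (\<psi> w) = w + c"
  proof (rule exp_left_inverse_const[OF convex_connected[OF convH0], of "\<lambda>w. \<phi> (\<psi> w)"])
    show "continuous_on H0 (\<lambda>w. \<phi> (\<psi> w))"
      by (rule continuous_on_compose2[OF c\<phi> \<psi>(1)]) (use \<psi>U in auto)
    show "exp (\<phi> (\<psi> w)) = exp w" if "w \<in> H0" for w using \<phi>(2)[OF \<psi>U[OF that]] \<psi>(3)[OF that] by simp
  qed blast
  have inj\<psi>: "inj_on \<psi> H0"
  proof (rule inj_onI)
    fix x y assume "x \<in> H0" "y \<in> H0" "\<psi> x = \<psi> y"
    then have "x + c = y + c" using c[of x, symmetric] c[of y] by (simp only:)
    then show "x = y" by simp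
  qed
  \<comment> \<open>The lift is so far only continuous. Invariance of domain makes its image open,
    so the injective map \<phi> has a holomorphic inverse there, and \<psi> is a translate of that
    inverse.\<close>
  have "open (\<psi> ` H0)" using invariance_of_domain[OF \<psi>(1) openH0 inj\<psi>] .
  have hol\<phi>: "\<phi> holomorphic_on \<psi> ` H0" using \<phi>(1) by (rule holomorphic_on_subset) (use \<psi>U in auto)
  have "inj_on \<phi> (\<psi> ` H0)"
  proof (rule inj_onI)
    fix x y assume "x \<in> \<psi> ` H0" "y \<in> \<psi> ` H0" and eq: "\<phi> x = \<phi> y"
    then obtain v w where vw: "v \<in> H0" "w \<in> H0" "x = \<psi> v" "y = \<psi> w" by blast
    then have "v + c = w + c" using c[OF vw(1)] c[OF vw(2)] eq by (simp only: vw(3,4))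
    then show "x = y" using vw(3,4) by simp
  qed
  then obtain g where g: "g holomorphic_on (\<phi> ` \<psi> ` H0)" "\<And>z. z \<in> \<psi> ` H0 \<Longrightarrow> g (\<phi> z) = z"
    using holomorphic_has_inverse[OF hol\<phi> \<open>open (\<psi> ` H0)\<close>] by metis
  have "(\<lambda>w. g (w + c)) holomorphic_on H0"
  proof -
    have "g \<circ> (\<lambda>w. w + c) holomorphic_on H0"
    proof (rule holomorphic_on_compose_gen[OF _ g(1)])
      show "(\<lambda>w. w + c) ` H0 \<subseteq> \<phi> ` \<psi> ` H0"
      proof
        fix v assume "v \<in> (\<lambda>w. w + c) ` H0"
        then obtain w where w: "w \<in> H0" "v = w + c" by blast
        then have "v = \<phi> (\<psi> w)" by (simp only: c[OF w(1)])
        then show "v \<in> \<phi> ` \<psi> ` H0" using w(1) by blast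
      qed
    qed (intro holomorphic_intros)
    then show ?thesis by (simp add: o_def)
  qed
  then have hol\<psi>: "\<psi> holomorphic_on H0"
  proof (rule holomorphic_transform)
    fix w assume w: "w \<in> H0"
    show "g (w + c) = \<psi> w" unfolding c[OF w, symmetric] by (rule g(2)[OF imageI[OF w]])
  qed
  \<comment> \<open>Being injective, \<psi> vanishes at most once. Moving the half-plane to the
    right of that point makes a holomorphic logarithm \<open>lam\<close> of \<psi>
    available.\<close>
  have "\<exists>a\<ge>a0. \<forall>w. a < Re w \<longrightarrow> \<psi> w \<noteq> 0"
  proof (cases "\<exists>w\<in>H0. \<psi> w = 0")
    case True
    then obtain w0 where w0: "w0 \<in> H0" "\<psi> w0 = 0" by blast
    show ?thesis
    proof (intro exI[of _ "Re w0"] conjI allI impI notI)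
      show "a0 \<le> Re w0" using w0(1) by (simp add: H0_def)
      fix w assume w: "Re w0 < Re w" "\<psi> w = 0"
      then have "w \<in> H0" using w0(1) by (simp add: H0_def)
      then have "w = w0" using inj_onD[OF inj\<psi>, of w w0] w0 w(2) by simp
      then show False using w(1) by simp
    qed
  next
    case False
    then show ?thesis by (auto simp: H0_def)
  qed
  then obtain a where a: "a0 \<le> a" "\<And>w. a < Re w \<Longrightarrow> \<psi> w \<noteq> 0" by blast
  let ?H = "{w. a < Re w}"
  have sub: "?H \<subseteq> H0" using a(1) by (auto simp: H0_def)
  obtain lam where lam: "lam holomorphic_on ?H" "\<And>w. w \<in> ?H \<Longrightarrow> \<psi> w = exp (lam w)"
    using contractible_imp_holomorphic_log[OF holomorphic_on_subset[OF hol\<psi> sub]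
        convex_imp_contractible[OF convex_halfspace_Re_gt]] a(2)
    by (metis mem_Collect_eq)
  have bounded: "bounded {w. x \<le> Re w \<and> Re (lam w) \<le> M}" (is "bounded ?B") if x: "a < x" for x M
  proof (rule ccontr)
    assume "\<not> bounded ?B"
    then have "\<forall>n::nat. \<exists>w\<in>?B. real n < cmod w" unfolding bounded_iff by (meson linorder_not_le)
    then obtain w where w: "\<And>n. w n \<in> ?B" "\<And>n. real n < cmod (w n)" by metis
    have wH: "w n \<in> ?H" for n using w(1)[of n] x by auto
    have wH0: "w n \<in> H0" for n using wH sub by blast
    have "\<psi> (w n) \<in> cball 0 (exp M)" for n
      using w(1)[of n] lam(2)[OF wH[of n]] by simp
    then have "\<forall>n. \<psi> (w n) \<in> cball 0 (exp M)" ..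
    from compact_cball[of "0::complex" "exp M", unfolded compact_def, THEN spec, THEN mp, OF this]
    obtain z s where z: "strict_mono s" "((\<lambda>n. \<psi> (w n)) \<circ> s) \<longlonglongrightarrow> z"
      by (elim bexE exE conjE)
    then have lim: "(\<lambda>n. \<psi> (w (s n))) \<longlonglongrightarrow> z" by (simp add: o_def)
    have "z \<in> A"
    proof (cases "is_pole f z")
      case True
      then show ?thesis using r by (simp add: A_def fext_def)
    next
      case False
      then have "isCont f z" using f by (simp add: meromorphic_plane_def)
      then have "(\<lambda>n. f (\<psi> (w (s n)))) \<longlonglongrightarrow> f z" using lim by (rule isCont_tendsto_compose)
      then have "(\<lambda>n. cmod (f (\<psi> (w (s n))))) \<longlonglongrightarrow> cmod (f z)" by (rule tendsto_norm)
      moreover have "exp x \<le> cmod (f (\<psi> (w (s n))))" for n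
        using \<psi>(3)[OF wH0[of "s n"]] w(1)[of "s n"] by simp
      ultimately have "exp x \<le> cmod (f z)" by (intro LIMSEQ_le_const[of _ "cmod (f z)"]) auto
      moreover have "2 / r < exp x"
      proof -
        have "exp a0 < exp x" using a(1) x by simp
        then show ?thesis using r by (simp add: a0_def)
      qed
      ultimately have "chordal (Some (f z)) None < r" using r by (intro chordal_None_less) auto
      then show ?thesis using False by (simp add: A_def fext_def)
    qed
    \<comment> \<open>A component is relatively closed in \<open>A\<close>, so the limit of points
      of the tract is again in the tract once it lies in \<open>A\<close>. Continuity of \<phi>
      there makes the sequence \<open>w (s n)\<close> converge, although it was chosen to be
      unbounded.\<close>
    obtain T where T: "closed T" "U = A \<inter> T"
      using closedin_component[OF compA] by (auto simp: closedin_closed)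
    have "\<psi> (w (s n)) \<in> T" for n using \<psi>U[OF wH0[of "s n"]] T(2) by blast
    then have "z \<in> T" by (rule closed_sequentially[OF T(1) _ lim])
    with \<open>z \<in> A\<close> have "z \<in> U" using T(2) by blast
    then have "isCont \<phi> z" using c\<phi> \<open>open U\<close> continuous_on_eq_continuous_at by blast
    then have "(\<lambda>n. \<phi> (\<psi> (w (s n)))) \<longlonglongrightarrow> \<phi> z" using lim by (rule isCont_tendsto_compose)
    then have "(\<lambda>n. w (s n) + c) \<longlonglongrightarrow> \<phi> z" by (simp add: c[OF wH0])
    then have "(\<lambda>n. w (s n) + c - c) \<longlonglongrightarrow> \<phi> z - c" by (intro tendsto_diff tendsto_const)
    then have "(\<lambda>n. w (s n)) \<longlonglongrightarrow> \<phi> z - c" by simp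
    then have "Bseq (\<lambda>n. w (s n))" by (intro convergent_imp_Bseq) (auto simp: convergent_def)
    then obtain Q where Q: "\<And>n. cmod (w (s n)) \<le> Q" unfolding Bseq_def by blast
    obtain n :: nat where "Q < real n" using reals_Archimedean2 by blast
    moreover have "n \<le> s n" using seq_suble[OF z(1)] .
    ultimately show False using w(2)[of "s n"] Q[of n] by linarith
  qed
  have "log_tract f lam a"
  proof
    show "lam holomorphic_on ?H" by (rule lam(1))
    show "inj_on (\<lambda>w. exp (lam w)) ?H"
    proof (rule inj_onI)
      fix x y assume xy: "x \<in> ?H" "y \<in> ?H" "exp (lam x) = exp (lam y)"
      then have "\<psi> x = \<psi> y" using lam(2) by simp
      then show "x = y" using inj_onD[OF inj\<psi>] xy sub by blast
    qed
    fix w assume "a < Re w"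
    then have w: "w \<in> ?H" "w \<in> H0" using sub by auto
    show "f (exp (lam w)) = exp w" using lam(2)[OF w(1)] \<psi>(3)[OF w(2)] by simp
    show "\<not> is_pole f (exp (lam w))" using np[OF \<psi>U[OF w(2)]] lam(2)[OF w(1)] by simp
  qed (use f bounded in auto)
  then show ?thesis by blast
qed

theorem theorem1p4:
  fixes f :: "complex \<Rightarrow> complex"
  assumes "meromorphic_plane f"
    and "transcendental_fn f"
    and "log_sing_infty f"
  shows "upper_box_dim (\<lambda>a b. chordal (Some a) (Some b)) (escaping f \<inter> julia f) = 2
         \<and> packing_dim (julia f) = 2"
proof -
  obtain lam a where "log_tract f lam a" using log_tract_exists[OF assms] by blast
  then interpret log_tract f lam a .
  show ?thesis using upper_box_dim_and_packing_dim by blast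
qed

end
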